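(* Suppose $H$ and $H'$ are finite index subgroups of $F$. Let $a,b,c,d$ be positive integers such that $K_{(a,b)}=\operatorname{Outer}(H)$ and $K_{(c,d)}=\operatorname{Outer}(H')$. Then $H$ is isomorphic to $H'$ if and only if $\tau_{(a,b)}(H)=\tau_{(c,d)}(H')$ or $\tau_{(a,b)}(H)=\operatorname{Rev}(\tau_{(c,d)}(H'))$.
   Context: $F$ (R. Thompson's group $F$) is the group, under composition, of all piecewise-linear, orientation-preserving homeomorphisms of $[0,1]$ which admit finitely many breaks in slope, all breaks occurring over dyadic rationals (elements of $\mathbb{Z}[1/2]$), and all of whose affine pieces have slopes that are integral powers of $2$. For $f\in F$, $f'(0)$ denotes the right derivative at $0$ and $f'(1)$ the left derivative at $1$. The homomorphism $\phi:F\to\mathbb{Z}^2$ is defined by $\phi(f)=(\log_2 f'(0),\log_2 f'(1))$. For positive integers $a,b$, $\tilde K_{(a,b)}=\langle (a,0),(0,b)\rangle\le\mathbb{Z}^2$ and $K_{(a,b)}=\phi^{-1}(\tilde K_{(a,b)})\le F$; the groups $K_{(a,b)}$ are called rectangular subgroups of $F$. For a finite index subgroup $H$ of $F$, $\operatorname{Outer}(H)$ denotes the unique minimal (with respect to inclusion) rectangular subgroup of $F$ containing $H$ (it exists for every finite index $H$). For each pair of positive integers $a,b$, $\tau_{(a,b)}:K_{(a,b)}\to F$ is a fixed isomorphism with the property that if $f\in K_{(a,b)}$ and $\phi(f)=(as,bt)$ then $\phi(\tau_{(a,b)}(f))=(s,t)$ (such isomorphisms exist). $\operatorname{Rev}:F\to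 F$ is the automorphism obtained by conjugating elements of $F$ by the orientation-reversing map $\mathrm{rev}:[0,1]\to[0,1]$, $\mathrm{rev}(x)=1-x$. *)

theory Defs
  imports "HOL-Analysis.Analysis" "HOL-Algebra.Algebra"
begin

definition dyadic_rationals :: "real set" where
  "dyadic_rationals = {x. \<exists>(m::int) (n::nat). x = of_int m / 2 ^ n}"

text \<open>The finite set \<open>B\<close> contains the breaks of \<open>f\<close>: on every closed subinterval of \<open>[0,1]\<close> with
  no point of \<open>B\<close> in its interior, \<open>f\<close> is affine with slope an integral power of \<open>2\<close>.\<close>

definition dyadic_PL :: "(real \<Rightarrow> real) \<Rightarrow> bool" where
  "dyadic_PL f \<longleftrightarrow> (\<exists>B. finite B \<and> B \<subseteq> dyadic_rationals \<and>
     (\<forall>x y. 0 \<le> x \<longrightarrow> x < y \<longrightarrow> y \<le> 1 \<longrightarrow> {x<..<y} \<inter> B = {} \<longrightarrow>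
        (\<exists>(k::int) c. \<forall>t\<in>{x..y}. f t = 2 powi k * t + c)))"

text \<open>Self-maps of \<open>[0,1]\<close> are represented as in \<^const>\<open>BijGroup\<close>, by functions that are
  \<^const>\<open>undefined\<close> outside \<open>[0,1]\<close>; the operation is composition.\<close>

definition thompson_carrier :: "(real \<Rightarrow> real) set" where
  "thompson_carrier = {f \<in> Bij {0..1}. (\<exists>g. homeomorphism {0..1} {0..1} f g) \<and>
     strict_mono_on {0..1} f \<and> dyadic_PL f}"

definition thompson_F :: "(real \<Rightarrow> real) monoid" where
  "thompson_F = (BijGroup {0..1})\<lparr>carrier := thompson_carrier\<rparr>"

definition Z2 :: "(int \<times> int) monoid" where
  "Z2 = integer_group \<times>\<times> integer_group"

text \<open>The two logarithms are integers for \<open>f\<close> in Thompson's group (see \<open>phi_exact\<close> below), so the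
  floor is only a conversion from \<^typ>\<open>real\<close> to \<^typ>\<open>int\<close>.\<close>

definition phi :: "(real \<Rightarrow> real) \<Rightarrow> int \<times> int" where
  "phi f = (\<lfloor>log 2 (vector_derivative f (at_right 0))\<rfloor>, \<lfloor>log 2 (vector_derivative f (at_left 1))\<rfloor>)"

definition K_tilde :: "nat \<Rightarrow> nat \<Rightarrow> (int \<times> int) set" where
  "K_tilde a b = generate Z2 {(int a, 0), (0, int b)}"

definition K_rect :: "nat \<Rightarrow> nat \<Rightarrow> (real \<Rightarrow> real) set" where
  "K_rect a b = {f \<in> carrier thompson_F. phi f \<in> K_tilde a b}"

definition rectangular :: "(real \<Rightarrow> real) set \<Rightarrow> bool" where
  "rectangular K \<longleftrightarrow> (\<exists>a b. 0 < a \<and> 0 < b \<and> K = K_rect a b)"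

definition finite_index_subgroup :: "'a set \<Rightarrow> ('a, 'b) monoid_scheme \<Rightarrow> bool" where
  "finite_index_subgroup H G \<longleftrightarrow> subgroup H G \<and> finite (rcosets\<^bsub>G\<^esub> H)"

definition Outer :: "(real \<Rightarrow> real) set \<Rightarrow> (real \<Rightarrow> real) set" where
  "Outer H = (THE K. rectangular K \<and> H \<subseteq> K \<and>
     (\<forall>K'. rectangular K' \<and> H \<subseteq> K' \<and> K' \<subseteq> K \<longrightarrow> K' = K))"

definition rev01 :: "real \<Rightarrow> real" where
  "rev01 = (\<lambda>x\<in>{0..1}. 1 - x)"

definition Rev :: "(real \<Rightarrow> real) \<Rightarrow> real \<Rightarrow> real" where
  "Rev f = rev01 \<otimes>\<^bsub>BijGroup {0..1}\<^esub> f \<otimes>\<^bsub>BijGroup {0..1}\<^esub> inv\<^bsub>BijGroup {0..1}\<^esub> rev01"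

definition rect_iso :: "nat \<Rightarrow> nat \<Rightarrow> ((real \<Rightarrow> real) \<Rightarrow> real \<Rightarrow> real) \<Rightarrow> bool" where
  "rect_iso a b T \<longleftrightarrow> T \<in> iso (thompson_F\<lparr>carrier := K_rect a b\<rparr>) thompson_F \<and>
     (\<forall>f\<in>K_rect a b. \<forall>s t. phi f = (int a * s, int b * t) \<longrightarrow> phi (T f) = (s, t))"

lemma affine_right_derivative:
  fixes f :: "real \<Rightarrow> real"
  assumes "x < y" "\<forall>t\<in>{x..y}. f t = s * t + c"
  shows "vector_derivative f (at_right x) = s"
proof (rule vector_derivative_within)
  show "at_right x \<noteq> bot" by simp
  have "((\<lambda>t. s * t + c) has_vector_derivative s) (at x within {x<..})"
    by (auto intro!: derivative_eq_intros)
  moreover have ev: "\<forall>\<^sub>F t in at_right x. s * t + c = f t"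
    using assms by (intro eventually_at_rightI[of x y]) auto
  moreover have eq: "s * x + c = f x" using assms by auto
  ultimately show "(f has_vector_derivative s) (at_right x)"
    unfolding has_real_derivative_iff_has_vector_derivative[symmetric]
    by (simp only: has_field_derivative_cong_eventually[OF ev eq])
qed

lemma affine_left_derivative:
  fixes f :: "real \<Rightarrow> real"
  assumes "x < y" "\<forall>t\<in>{x..y}. f t = s * t + c"
  shows "vector_derivative f (at_left y) = s"
proof (rule vector_derivative_within)
  show "at_left y \<noteq> bot" by simp
  have "((\<lambda>t. s * t + c) has_vector_derivative s) (at y within {..<y})"
    by (auto intro!: derivative_eq_intros)
  moreover have ev: "\<forall>\<^sub>F t in at_left y. s * t + c = f t"
    using assms by (intro eventually_at_leftI[of x y]) auto
  moreover have eq: "s * y + c = f y" using assms by auto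
  ultimately show "(f has_vector_derivative s) (at_left y)"
    unfolding has_real_derivative_iff_has_vector_derivative[symmetric]
    by (simp only: has_field_derivative_cong_eventually[OF ev eq])
qed

lemma phi_exact:
  assumes "f \<in> carrier thompson_F"
  shows "vector_derivative f (at_right 0) = 2 powi fst (phi f)"
    and "vector_derivative f (at_left 1) = 2 powi snd (phi f)"
proof -
  from assms have "dyadic_PL f" by (simp add: thompson_F_def thompson_carrier_def)
  then obtain B where B: "finite B" and
    aff: "\<And>x y. 0 \<le> x \<Longrightarrow> x < y \<Longrightarrow> y \<le> 1 \<Longrightarrow> {x<..<y} \<inter> B = {} \<Longrightarrow>
        \<exists>(k::int) c. \<forall>t\<in>{x..y}. f t = 2 powi k * t + c"
    unfolding dyadic_PL_def by metis
  have fl: "\<lfloor>log 2 ((2::real) powi k)\<rfloor> = k" for k :: int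
    by (simp flip: powr_real_of_int')
  define y where "y = Min (insert 1 {t\<in>B. 0 < t})"
  have "y \<in> insert 1 {t\<in>B. 0 < t}" unfolding y_def using B by (intro Min_in) auto
  moreover have "y \<le> t" if "t = 1 \<or> t \<in> B \<and> 0 < t" for t
    unfolding y_def using B that by (intro Min_le) auto
  ultimately have "0 < y" "y \<le> 1" "{0<..<y} \<inter> B = {}" by force+
  with aff[of 0 y] obtain k c where k: "\<forall>t\<in>{0..y}. f t = 2 powi (k::int) * t + c" by auto
  show "vector_derivative f (at_right 0) = 2 powi fst (phi f)"
    using affine_right_derivative[OF \<open>0 < y\<close> k] fl by (simp add: phi_def)
  define x where "x = Max (insert 0 {t\<in>B. t < 1})"
  have "x \<in> insert 0 {t\<in>B. t < 1}" unfolding x_def using B by (intro Max_in) auto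
  moreover have "t \<le> x" if "t = 0 \<or> t \<in> B \<and> t < 1" for t
    unfolding x_def using B that by (intro Max_ge) auto
  ultimately have "0 \<le> x" "x < 1" "{x<..<1} \<inter> B = {}" by force+
  with aff[of x 1] obtain k c where k: "\<forall>t\<in>{x..1}. f t = 2 powi (k::int) * t + c" by auto
  show "vector_derivative f (at_left 1) = 2 powi snd (phi f)"
    using affine_left_derivative[OF \<open>x < 1\<close> k] fl by (simp add: phi_def)
qed

end

theory Submission
  imports Defs
begin

text \<open>Write \<open>F\<close> for the group and \<open>K\<close> for the kernel of \<open>phi\<close>: the elements that are the identity near \<open>0\<close>
and near \<open>1\<close>.

Two facts reduce everything to lattices in \<open>\<int>\<^sup>2\<close>. First, \<open>K\<close> lies in every subgroup of finite index
(\<open>finite_index_contains_ker_phi\<close>), so such a subgroup is determined by its image under \<open>phi\<close>. Second,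
\<open>K\<close> is the derived subgroup of every group between \<open>K\<close> and \<open>F\<close> (\<open>derived_intermediate\<close>), so an isomorphism
\<open>\<theta>\<close> from \<open>H\<close> to \<open>H'\<close> maps \<open>K\<close> onto itself and induces a linear isomorphism of the lattices \<open>phi(H)\<close> and
\<open>phi(H')\<close>.

The induced isomorphism also remembers dynamics. If both endpoint slopes of \<open>h\<close> are less than \<open>1\<close>, then some
element of the coset of \<open>h\<close> pushes every interior point towards the ends, and the conjugates of finitely
many elements of \<open>K\<close> by its powers generate \<open>K\<close>; if one of the slopes is at least \<open>1\<close>, then such
conjugates stay away from that endpoint and never generate \<open>K\<close> (\<open>exists_expanding\<close>, \<open>expands_neg\<close>).
This describes the open negative quadrant in terms of the group alone, so the lattice isomorphism preserves
this quadrant. A linear map that does so is diagonal or antidiagonal with positive entries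
(\<open>quadrant_preserving\<close>). The projections of \<open>phi(H)\<close> and \<open>phi(H')\<close> to the axes are generated by \<open>a\<close>, \<open>b\<close>
and \<open>c\<close>, \<open>d\<close>, because \<open>Outer\<close> is the least rectangular subgroup; this fixes the entries
(\<open>iso_preserves_phi\<close>). The maps \<open>\<tau>\<close> divide out \<open>a\<close>, \<open>b\<close> and \<open>c\<close>, \<open>d\<close>, so after applying them the lattices agree or
differ by the coordinate swap, which \<open>Rev\<close> realises.

That \<open>K\<close> is perfect rests on a generation theorem: \<open>F\<close> is generated by two elements whose values under \<open>phi\<close>
are linearly independent (\<open>thompson_two_generators\<close>), so every homomorphism from \<open>F\<close> to an abelian group
kills \<open>K\<close>. Modulo the commutators of \<open>K\<close> the group \<open>F\<close> is abelian: an element acts on a given \<open>k \<in> K\<close> like some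
element of \<open>K\<close> does, and two commuting elements with disjoint supports generate \<open>F\<close> together with \<open>K\<close>.\<close>

section \<open>Dyadic rationals\<close>

lemma dyadic_of_int [simp]: "of_int m \<in> dyadic_rationals"
  unfolding dyadic_rationals_def by (intro CollectI exI[of _ m] exI[of _ 0]) simp

lemma dyadic_0 [simp]: "0 \<in> dyadic_rationals" and dyadic_1 [simp]: "1 \<in> dyadic_rationals"
  and dyadic_numeral [simp]: "numeral n \<in> dyadic_rationals"
  using dyadic_of_int[of 0] dyadic_of_int[of 1] dyadic_of_int[of "numeral n"] by simp_all

lemma dyadic_add [simp]:
  assumes "x \<in> dyadic_rationals" "y \<in> dyadic_rationals" shows "x + y \<in> dyadic_rationals"
proof -
  from assms obtain m n m' n' where "x = of_int m / 2 ^ n" "y = of_int m' / 2 ^ n'"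
    unfolding dyadic_rationals_def by auto
  then have "x + y = of_int (m * 2 ^ n' + m' * 2 ^ n) / 2 ^ (n + n')"
    by (simp add: power_add add_divide_distrib)
  thus ?thesis unfolding dyadic_rationals_def by blast
qed

lemma dyadic_mult [simp]:
  assumes "x \<in> dyadic_rationals" "y \<in> dyadic_rationals" shows "x * y \<in> dyadic_rationals"
proof -
  from assms obtain m n m' n' where "x = of_int m / 2 ^ n" "y = of_int m' / 2 ^ n'"
    unfolding dyadic_rationals_def by auto
  hence "x * y = of_int (m * m') / 2 ^ (n + n')"
    by (simp add: power_add)
  thus ?thesis unfolding dyadic_rationals_def by blast
qed

lemma dyadic_uminus [simp]: "x \<in> dyadic_rationals \<Longrightarrow> - x \<in> dyadic_rationals"
  using dyadic_mult[of "-1" x] dyadic_of_int[of "-1"] by simp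

lemma dyadic_diff [simp]:
  "x \<in> dyadic_rationals \<Longrightarrow> y \<in> dyadic_rationals \<Longrightarrow> x - y \<in> dyadic_rationals"
  using dyadic_add[of x "- y"] by simp

lemma dyadic_power [simp]: "x \<in> dyadic_rationals \<Longrightarrow> x ^ n \<in> dyadic_rationals"
  by (induction n) auto

lemma dyadic_powi [simp]: "2 powi k \<in> dyadic_rationals"
proof (cases "k \<ge> 0")
  case False
  then have "(2::real) powi k = of_int 1 / 2 ^ nat (- k)"
    by (simp add: power_int_def field_simps)
  thus ?thesis unfolding dyadic_rationals_def by blast
qed (simp add: power_int_def)

lemma dyadic_half [simp]: "x \<in> dyadic_rationals \<Longrightarrow> x / 2 \<in> dyadic_rationals"
  using dyadic_mult[OF _ dyadic_powi[of "-1"], of x] by (simp add: power_int_minus field_simps)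

lemma dyadic_divide_power [simp]: "x \<in> dyadic_rationals \<Longrightarrow> x / 2 ^ n \<in> dyadic_rationals"
  using dyadic_mult[OF _ dyadic_powi[of "- int n"], of x]
  by (simp add: power_int_minus field_simps)

lemma dyadic_quarter [simp]: "x / 4 \<in> dyadic_rationals" "x / 8 \<in> dyadic_rationals"
  if "x \<in> dyadic_rationals"
  using dyadic_divide_power[OF that, of 2] dyadic_divide_power[OF that, of 3] by simp_all

lemma exists_small_dyadic:
  assumes "0 < (e::real)" obtains d where "0 < d" "d < e" "d \<in> dyadic_rationals"
proof -
  obtain n where "(1/2::real) ^ n < e" using real_arch_pow_inv[OF assms, of "1/2"] by auto
  thus ?thesis using that[of "1 / 2 ^ n"] by (simp add: power_divide)
qed

section \<open>Dyadic piecewise linear maps between intervals\<close>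

text \<open>The notion \<open>dyadic_PL\<close> on an arbitrary interval with dyadic endpoints. Unlike membership in the group, it can
be cut and glued, which is how all elements below are built.\<close>
definition dpl_on :: "(real \<Rightarrow> real) \<Rightarrow> real \<Rightarrow> real \<Rightarrow> bool" where
  "dpl_on f a b \<longleftrightarrow> a < b \<and> a \<in> dyadic_rationals \<and> b \<in> dyadic_rationals \<and>
     (\<exists>B. finite B \<and> B \<subseteq> dyadic_rationals \<and>
       (\<forall>x y. a \<le> x \<longrightarrow> x < y \<longrightarrow> y \<le> b \<longrightarrow> {x<..<y} \<inter> B = {} \<longrightarrow>
          (\<exists>(k::int) c. \<forall>t\<in>{x..y}. f t = 2 powi k * t + c)))"

definition dpl :: "(real \<Rightarrow> real) \<Rightarrow> real \<Rightarrow> real \<Rightarrow> real \<Rightarrow> real \<Rightarrow> bool" where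
  "dpl f a b c d \<longleftrightarrow> dpl_on f a b \<and> f a = c \<and> f b = d \<and> c \<in> dyadic_rationals"

lemma dyadic_PL_iff: "dyadic_PL f \<longleftrightarrow> dpl_on f 0 1"
  by (simp add: dyadic_PL_def dpl_on_def)

lemma dpl_on_cong:
  assumes "dpl_on f a b" "\<And>t. a \<le> t \<Longrightarrow> t \<le> b \<Longrightarrow> g t = f t" shows "dpl_on g a b"
proof -
  from assms(1) obtain B where B: "finite B" "B \<subseteq> dyadic_rationals" and
    aff: "\<And>x y. a \<le> x \<Longrightarrow> x < y \<Longrightarrow> y \<le> b \<Longrightarrow> {x<..<y} \<inter> B = {} \<Longrightarrow>
          \<exists>(k::int) c. \<forall>t\<in>{x..y}. f t = 2 powi k * t + c"
    unfolding dpl_on_def by metis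
  have "\<exists>(k::int) c. \<forall>t\<in>{x..y}. g t = 2 powi k * t + c"
    if xy: "a \<le> x" "x < y" "y \<le> b" "{x<..<y} \<inter> B = {}" for x y
  proof -
    obtain k c where "\<forall>t\<in>{x..y}. f t = 2 powi (k::int) * t + c" using aff[OF xy] by blast
    hence "\<forall>t\<in>{x..y}. g t = 2 powi k * t + c" using assms(2) xy by auto
    thus ?thesis by blast
  qed
  thus ?thesis using assms(1) B unfolding dpl_on_def by blast
qed

lemma dpl_cong:
  assumes "dpl f a b c d" "\<And>t. a \<le> t \<Longrightarrow> t \<le> b \<Longrightarrow> g t = f t" shows "dpl g a b c d"
  using assms dpl_on_cong[of f a b g] unfolding dpl_def by (auto simp: dpl_on_def)

lemma dpl_on_affine:
  assumes "a < b" "a \<in> dyadic_rationals" "b \<in> dyadic_rationals"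
    "\<And>t. a \<le> t \<Longrightarrow> t \<le> b \<Longrightarrow> f t = 2 powi k * t + c"
  shows "dpl_on f a b"
  unfolding dpl_on_def using assms
  by (intro conjI exI[of _ "{}"] allI impI exI[of _ k] exI[of _ c]) auto

lemma dpl_on_subinterval:
  assumes "dpl_on f a b" "a \<le> a'" "a' < b'" "b' \<le> b" "a' \<in> dyadic_rationals" "b' \<in> dyadic_rationals"
  shows "dpl_on f a' b'"
proof -
  from assms(1) obtain B where "finite B" "B \<subseteq> dyadic_rationals"
    and aff: "\<And>x y. a \<le> x \<Longrightarrow> x < y \<Longrightarrow> y \<le> b \<Longrightarrow> {x<..<y} \<inter> B = {} \<Longrightarrow>
          \<exists>(k::int) c. \<forall>t\<in>{x..y}. f t = 2 powi k * t + c"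
    unfolding dpl_on_def by metis
  thus ?thesis unfolding dpl_on_def using assms(2-6)
    by (intro conjI exI[of _ B]) (auto intro: aff)
qed

lemma dpl_on_join:
  assumes "dpl_on f a m" "dpl_on f m b"
  shows "dpl_on f a b"
proof -
  from assms(1) obtain B where B: "finite B" "B \<subseteq> dyadic_rationals"
    and aff: "\<And>x y. a \<le> x \<Longrightarrow> x < y \<Longrightarrow> y \<le> m \<Longrightarrow> {x<..<y} \<inter> B = {} \<Longrightarrow>
          \<exists>(k::int) c. \<forall>t\<in>{x..y}. f t = 2 powi k * t + c"
    unfolding dpl_on_def by metis
  from assms(2) obtain C where C: "finite C" "C \<subseteq> dyadic_rationals"
    and aff': "\<And>x y. m \<le> x \<Longrightarrow> x < y \<Longrightarrow> y \<le> b \<Longrightarrow> {x<..<y} \<inter> C = {} \<Longrightarrow>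
          \<exists>(k::int) c. \<forall>t\<in>{x..y}. f t = 2 powi k * t + c"
    unfolding dpl_on_def by metis
  show ?thesis unfolding dpl_on_def
  proof (intro conjI exI[of _ "insert m (B \<union> C)"] allI impI)
    fix x y assume *: "a \<le> x" "x < y" "y \<le> b" "{x<..<y} \<inter> insert m (B \<union> C) = {}"
    hence "y \<le> m \<or> m \<le> x" by force
    thus "\<exists>(k::int) c. \<forall>t\<in>{x..y}. f t = 2 powi k * t + c"
      using aff[of x y] aff'[of x y] * by blast
  qed (use assms B C in \<open>auto simp: dpl_on_def\<close>)
qed

text \<open>Cutting at the breaks one after the other leaves affine pieces. With this rule the set of breaks
need not be mentioned again.\<close>
lemma dpl_on_induct [consumes 1, case_names affine join]:
  assumes "dpl_on f a b"
    and affine: "\<And>a b k c. a < b \<Longrightarrow> a \<in> dyadic_rationals \<Longrightarrow> b \<in> dyadic_rationals \<Longrightarrow>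
        (\<And>t. a \<le> t \<Longrightarrow> t \<le> b \<Longrightarrow> f t = 2 powi (k::int) * t + c) \<Longrightarrow> P a b"
    and join: "\<And>a m b. a < m \<Longrightarrow> m < b \<Longrightarrow> a \<in> dyadic_rationals \<Longrightarrow> m \<in> dyadic_rationals \<Longrightarrow>
        b \<in> dyadic_rationals \<Longrightarrow> P a m \<Longrightarrow> P m b \<Longrightarrow> P a b"
  shows "P a b"
proof -
  from assms(1) obtain B where B: "finite B" "B \<subseteq> dyadic_rationals" and
    aff: "\<And>x y. a \<le> x \<Longrightarrow> x < y \<Longrightarrow> y \<le> b \<Longrightarrow> {x<..<y} \<inter> B = {} \<Longrightarrow>
          \<exists>(k::int) c. \<forall>t\<in>{x..y}. f t = 2 powi k * t + c"
    unfolding dpl_on_def by metis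
  have "P x y" if "a \<le> x" "x < y" "y \<le> b" "x \<in> dyadic_rationals" "y \<in> dyadic_rationals" for x y
    using that
  proof (induction "card (B \<inter> {x<..<y})" arbitrary: x y rule: less_induct)
    case less
    show ?case
    proof (cases "B \<inter> {x<..<y} = {}")
      case True
      then obtain k c where "\<forall>t\<in>{x..y}. f t = 2 powi (k::int) * t + c"
        using aff[of x y] less.prems by blast
      thus ?thesis using affine[of x y k c] less.prems by auto
    next
      case False
      then obtain m where m: "m \<in> B" "x < m" "m < y" by auto
      have "card (B \<inter> {x<..<m}) < card (B \<inter> {x<..<y})" "card (B \<inter> {m<..<y}) < card (B \<inter> {x<..<y})"
        using m B by (auto intro!: psubset_card_mono)
      with less m B show ?thesis by (intro join[of x m y]) auto
    qed
  qed
  thus ?thesis using assms(1) by (auto simp: dpl_on_def)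
qed

text \<open>Slopes are positive and pieces match at the cuts, hence \<open>f\<close> is an increasing homeomorphism onto its image. It
preserves dyadic points because the constant term of a piece is \<open>f a - 2 powi k * a\<close>, which is dyadic once
\<open>f a\<close> is.\<close>
lemma dpl_on_image:
  assumes "dpl_on f a b" "f a \<in> dyadic_rationals"
  shows "f b \<in> dyadic_rationals \<and> strict_mono_on {a..b} f \<and> f ` {a..b} = {f a..f b}
    \<and> continuous_on {a..b} f \<and> (\<forall>t\<in>{a..b}. t \<in> dyadic_rationals \<longrightarrow> f t \<in> dyadic_rationals)"
  using assms
proof (induction rule: dpl_on_induct)
  case (affine a b k c)
  have c: "c \<in> dyadic_rationals"
  proof -
    have "c = f a - 2 powi k * a" using affine by simp
    thus ?thesis using affine by (metis dyadic_diff dyadic_mult dyadic_powi)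
  qed
  have mono: "strict_mono_on {a..b} f" by (auto simp: strict_mono_on_def affine.hyps(4))
  have "{f a..f b} \<subseteq> f ` {a..b}"
  proof
    fix s assume s: "s \<in> {f a..f b}"
    define t where "t = (s - c) / 2 powi k"
    have "a \<le> t" "t \<le> b" "s = 2 powi k * t + c"
      using s affine.hyps(4)[of a] affine.hyps(4)[of b] affine.hyps(1)
      by (auto simp: t_def field_simps)
    hence "s = f t" using affine.hyps(4)[of t] by simp
    thus "s \<in> f ` {a..b}" using \<open>a \<le> t\<close> \<open>t \<le> b\<close> by auto
  qed
  moreover have "f ` {a..b} \<subseteq> {f a..f b}"
    using affine.hyps(1,4) by auto
  moreover have "continuous_on {a..b} f"
    by (rule continuous_on_eq[of _ "\<lambda>t. 2 powi k * t + c"]) (auto intro!: continuous_intros simp: affine)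
  ultimately show ?case using mono affine c by auto
next
  case (join a m b)
  note 1 = conjunct1[OF join.IH(1)[OF join.prems]]
    conjunct1[OF conjunct2[OF join.IH(1)[OF join.prems]]]
    conjunct1[OF conjunct2[OF conjunct2[OF join.IH(1)[OF join.prems]]]]
    conjunct1[OF conjunct2[OF conjunct2[OF conjunct2[OF join.IH(1)[OF join.prems]]]]]
    conjunct2[OF conjunct2[OF conjunct2[OF conjunct2[OF join.IH(1)[OF join.prems]]]]]
  note 2 = conjunct1[OF join.IH(2)[OF 1(1)]]
    conjunct1[OF conjunct2[OF join.IH(2)[OF 1(1)]]]
    conjunct1[OF conjunct2[OF conjunct2[OF join.IH(2)[OF 1(1)]]]]
    conjunct1[OF conjunct2[OF conjunct2[OF conjunct2[OF join.IH(2)[OF 1(1)]]]]]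
    conjunct2[OF conjunct2[OF conjunct2[OF conjunct2[OF join.IH(2)[OF 1(1)]]]]]
  have U: "{a..b} = {a..m} \<union> {m..b}" using join by auto
  have lt: "f a < f m" "f m < f b"
    using 1(2) 2(2) join.hyps by (auto simp: strict_mono_on_def)
  have "f ` {a..b} = {f a..f b}"
    unfolding U image_Un 1(3) 2(3) using lt by auto
  moreover have "continuous_on {a..b} f"
    unfolding U by (rule continuous_on_closed_Un) (use 1 2 in auto)
  moreover have "strict_mono_on {a..b} f"
  proof (rule strict_mono_onI)
    fix s t assume st: "s \<in> {a..b}" "t \<in> {a..b}" "s < t"
    consider "t \<le> m" | "m \<le> s" | "s < m" "m < t" by linarith
    thus "f s < f t"
    proof cases
      case 3
      then have "f s < f m" "f m < f t"
        using 1(2) 2(2) st by (auto simp: strict_mono_on_def)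
      thus ?thesis by simp
    qed (use 1(2) 2(2) st in \<open>auto simp: strict_mono_on_def\<close>)
  qed
  ultimately show ?case using 1(5) 2(1,5) unfolding U by blast
qed

lemma dplD:
  assumes "dpl f a b c d"
  shows "a < b" "c < d" "a \<in> dyadic_rationals" "b \<in> dyadic_rationals" "c \<in> dyadic_rationals"
    "d \<in> dyadic_rationals" "f a = c" "f b = d" "strict_mono_on {a..b} f" "f ` {a..b} = {c..d}"
    "continuous_on {a..b} f"
    "\<And>t. a \<le> t \<Longrightarrow> t \<le> b \<Longrightarrow> t \<in> dyadic_rationals \<Longrightarrow> f t \<in> dyadic_rationals"
    "\<And>t. a \<le> t \<Longrightarrow> t \<le> b \<Longrightarrow> c \<le> f t \<and> f t \<le> d"
proof -
  have 1: "a < b" "f a = c" "f b = d" "dpl_on f a b" "f a \<in> dyadic_rationals"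
    using assms by (auto simp: dpl_def dpl_on_def)
  note 2 = dpl_on_image[OF 1(4,5)]
  show "strict_mono_on {a..b} f" "f ` {a..b} = {c..d}" using 1 2 by auto
  show "c < d" using 1 2 by (auto simp: strict_mono_on_def)
  show "c \<le> f t \<and> f t \<le> d" if "a \<le> t" "t \<le> b" for t
    using that \<open>f ` {a..b} = {c..d}\<close> by fastforce
qed (use assms dpl_on_image[of f a b] in \<open>auto simp: dpl_def dpl_on_def\<close>)

lemma dpl_affine:
  assumes "a < b" "a \<in> dyadic_rationals" "b \<in> dyadic_rationals" "c \<in> dyadic_rationals"
    "\<And>t. a \<le> t \<Longrightarrow> t \<le> b \<Longrightarrow> f t = c + 2 powi k * (t - a)" "d = c + 2 powi k * (b - a)"
  shows "dpl f a b c d"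
  unfolding dpl_def
proof (intro conjI)
  show "dpl_on f a b"
    using assms by (intro dpl_on_affine[of a b f k "c - 2 powi k * a"]) (auto simp: algebra_simps)
qed (use assms(1,4,6) assms(5)[of a] assms(5)[of b] in simp_all)

lemma dpl_subinterval:
  assumes "dpl f a b c d" "a \<le> a'" "a' < b'" "b' \<le> b" "a' \<in> dyadic_rationals" "b' \<in> dyadic_rationals"
  shows "dpl f a' b' (f a') (f b')"
  using assms dpl_on_subinterval[of f a b a' b'] dplD(12)[OF assms(1), of a'] unfolding dpl_def by auto

lemma dpl_join: "dpl f a m c n \<Longrightarrow> dpl f m b n d \<Longrightarrow> dpl f a b c d"
  unfolding dpl_def using dpl_on_join by blast

lemma dpl_glue:
  assumes "dpl f a m c n" "dpl g m b n d"
  shows "dpl (\<lambda>t. if t \<le> m then f t else g t) a b c d"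
proof (rule dpl_join)
  show "dpl (\<lambda>t. if t \<le> m then f t else g t) a m c n" by (rule dpl_cong[OF assms(1)]) auto
  show "dpl (\<lambda>t. if t \<le> m then f t else g t) m b n d"
    by (rule dpl_cong[OF assms(2)]) (use dplD(7,8)[OF assms(1)] dplD(7,8)[OF assms(2)] in auto)
qed

lemma dpl_inverse:
  assumes "dpl f a b c d" "\<And>t. a \<le> t \<Longrightarrow> t \<le> b \<Longrightarrow> g (f t) = t"
  shows "dpl g c d a b"
proof -
  have "dpl_on f a b" using assms by (simp add: dpl_def)
  moreover have "f a \<in> dyadic_rationals" using assms dplD by metis
  ultimately have "dpl_on g (f a) (f b) \<and> f b \<in> dyadic_rationals" using assms(2)
  proof (induction rule: dpl_on_induct)
    case (affine a b k c)
    have c: "c = f a - 2 powi k * a" using affine by simp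
    have "f b = 2 powi k * b + c" using affine by simp
    hence fb: "f b \<in> dyadic_rationals" unfolding c
      by (metis affine.hyps(2,3) affine.prems(1) dyadic_add dyadic_diff dyadic_mult dyadic_powi)
    have "dpl_on g (f a) (f b)"
    proof (rule dpl_on_affine)
      fix s assume s: "f a \<le> s" "s \<le> f b"
      define t where "t = (s - c) / 2 powi k"
      have t: "a \<le> t" "t \<le> b" "s = 2 powi k * t + c"
        using s affine.hyps(4)[of a] affine.hyps(4)[of b] affine.hyps(1)
        by (auto simp: t_def field_simps)
      hence "g s = t" using affine.hyps(4)[of t] affine.prems(2)[of t] by auto
      thus "g s = 2 powi (- k) * s + (- c * 2 powi (-k))"
        by (simp add: t_def power_int_minus field_simps)
    qed (use affine fb in auto)
    thus ?case using fb by simp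
  next
    case (join a m b)
    thus ?case by (auto intro: dpl_on_join)
  qed
  thus ?thesis using assms dplD[OF assms(1)] unfolding dpl_def by auto
qed

text \<open>Precomposing with an affine piece of \<open>f\<close> pulls the pieces of \<open>g\<close> back to affine pieces; the general case
follows by cutting \<open>f\<close>.\<close>
lemma dpl_comp:
  assumes "dpl f a b c d" "dpl g c d e h"
  shows "dpl (\<lambda>t. g (f t)) a b e h"
proof -
  have aff: "dpl_on (\<lambda>t. g (f t)) a b" if "dpl_on g (f a) (f b)" "f a \<in> dyadic_rationals"
    "a \<in> dyadic_rationals" "b \<in> dyadic_rationals"
    "\<And>t. a \<le> t \<Longrightarrow> t \<le> b \<Longrightarrow> f t = 2 powi k * t + l" "a < b" for k l a b
  proof -
    define i where "i = (\<lambda>s. 2 powi (- k) * s + (- l * 2 powi (-k)))"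
    have i: "i (2 powi k * t + l) = t" "2 powi k * i t + l = t" for t
      by (auto simp: i_def power_int_minus field_simps)
    have le: "s \<le> i t \<longleftrightarrow> 2 powi k * s + l \<le> t" "i t \<le> s \<longleftrightarrow> t \<le> 2 powi k * s + l" for s t
      by (auto simp: i_def power_int_minus field_simps)
    have l: "l = f a - 2 powi k * a" using that(5)[of a] that by auto
    have ld: "l \<in> dyadic_rationals"
      by (subst l, intro dyadic_diff dyadic_mult dyadic_powi) (use that in auto)
    have "dpl_on (\<lambda>t. g (2 powi k * t + l)) (i (f a)) (i (f b))" using that(1)
    proof (induction rule: dpl_on_induct)
      case (affine x y k' c)
      show ?case
      proof (rule dpl_on_affine)
        fix t assume "i x \<le> t" "t \<le> i y"
        hence "x \<le> 2 powi k * t + l" "2 powi k * t + l \<le> y" by (auto simp: le)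
        thus "g (2 powi k * t + l) = 2 powi (k' + k) * t + (2 powi k' * l + c)"
          using affine(4)[of "2 powi k * t + l"] by (simp add: power_int_add algebra_simps)
      qed (use affine ld in \<open>auto simp: i_def\<close>)
    next
      case (join x m y)
      thus ?case by (auto intro: dpl_on_join)
    qed
    moreover have "i (f a) = a" "i (f b) = b" using that by (auto simp: i)
    ultimately show ?thesis using that by (auto intro: dpl_on_cong)
  qed
  have "dpl_on f a b" "f a \<in> dyadic_rationals" using assms dplD[OF assms(1)] by (auto simp: dpl_def)
  hence "f a < f b \<and> f b \<in> dyadic_rationals \<and>
     (dpl_on g (f a) (f b) \<longrightarrow> dpl_on (\<lambda>t. g (f t)) a b)"
  proof (induction rule: dpl_on_induct)
    case (affine a b k c)
    have "c = f a - 2 powi k * a" using affine by simp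
    moreover have "f b = 2 powi k * b + c" using affine by simp
    ultimately have "f b \<in> dyadic_rationals"
      by (metis affine.hyps(2,3) affine.prems(1) dyadic_add dyadic_diff dyadic_mult dyadic_powi)
    thus ?case using aff[of a b k c] affine by auto
  next
    case (join a m b)
    have *: "dpl_on g (f a) (f m)" "dpl_on g (f m) (f b)" if "dpl_on g (f a) (f b)"
      using join that by (auto intro: dpl_on_subinterval)
    show ?case
      using join * by (auto intro: dpl_on_join)
  qed
  thus ?thesis using assms unfolding dpl_def by auto
qed

section \<open>Dyadic intervals are equivalent\<close>
definition pl_sim :: "real \<Rightarrow> real \<Rightarrow> bool" where
  "pl_sim l l' \<longleftrightarrow> (\<exists>f. dpl f 0 l 0 l')"

lemma pl_sim_scale:
  assumes "0 < l" "l \<in> dyadic_rationals" shows "pl_sim l (2 powi k * l)"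
  unfolding pl_sim_def using assms
  by (intro exI[of _ "\<lambda>t. 2 powi k * t"] dpl_affine[of _ _ _ _ k]) auto

lemma pl_sim_trans: "pl_sim a b \<Longrightarrow> pl_sim b c \<Longrightarrow> pl_sim a c"
  unfolding pl_sim_def using dpl_comp by blast

lemma dpl_inv_into:
  assumes "dpl f a b c d" shows "dpl (inv_into {a..b} f) c d a b"
proof (rule dpl_inverse[OF assms])
  have "inj_on f {a..b}" using dplD(9)[OF assms] by (rule strict_mono_on_imp_inj_on)
  thus "inv_into {a..b} f (f t) = t" if "a \<le> t" "t \<le> b" for t
    using that by (intro inv_into_f_f) auto
qed

lemma pl_sim_sym: "pl_sim a b \<Longrightarrow> pl_sim b a"
  unfolding pl_sim_def using dpl_inv_into by blast

lemma dpl_shift: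
  assumes "a < b" "a \<in> dyadic_rationals" "b \<in> dyadic_rationals" "c \<in> dyadic_rationals"
  shows "dpl (\<lambda>t. t + c) a b (a + c) (b + c)"
  by (rule dpl_affine[of _ _ _ _ 0]) (use assms in auto)

lemma dpl_translate:
  assumes "pl_sim (b - a) (d - c)" "a \<in> dyadic_rationals" "c \<in> dyadic_rationals"
  shows "\<exists>f. dpl f a b c d"
proof -
  obtain f where f: "dpl f 0 (b - a) 0 (d - c)" using assms unfolding pl_sim_def by blast
  note D = dplD[OF f]
  have bd: "b \<in> dyadic_rationals" using dyadic_add[OF D(4) assms(2)] by simp
  have 1: "dpl (\<lambda>t. t + (- a)) a b 0 (b - a)"
    using dpl_shift[of a b "-a"] D(1) assms bd by simp
  have 2: "dpl (\<lambda>t. t + c) 0 (d - c) c d"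
    using dpl_shift[of 0 "d - c" c] D(2,6) assms by simp
  show ?thesis using dpl_comp[OF dpl_comp[OF 1 f] 2] by blast
qed

lemma pl_sim_add:
  assumes "pl_sim a a'" "pl_sim b b'" shows "pl_sim (a + b) (a' + b')"
proof -
  obtain f where f: "dpl f 0 a 0 a'" using assms unfolding pl_sim_def by blast
  have "\<exists>g. dpl g a (a + b) a' (a' + b')"
    using dpl_translate[of "a + b" a "a' + b'" a'] assms dplD[OF f] by simp
  thus ?thesis unfolding pl_sim_def using dpl_glue[OF f] by blast
qed

text \<open>Doubling the scale turns a dyadic length into an integer \<open>m + 1\<close>, and \<open>m + 1 \<sim> 1 + 1 = 2 \<sim> 1\<close> by
induction and another change of scale. It is here that slopes are powers of \<open>2\<close>: for powers of a larger
base \<open>n\<close> the length modulo \<open>n - 1\<close> would be an invariant.\<close>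
lemma pl_sim_1:
  assumes "0 < l" "l \<in> dyadic_rationals" shows "pl_sim l 1"
proof -
  have nat: "pl_sim (real (Suc m)) 1" for m
  proof (induction m)
    case 0
    show ?case using pl_sim_scale[of 1 0] by simp
  next
    case (Suc m)
    have "pl_sim (real (Suc m) + 1) (1 + 1)" by (intro pl_sim_add Suc) (use pl_sim_scale[of 1 0] in simp)
    moreover have "pl_sim (1 + 1) 1" using pl_sim_scale[of 2 "-1"] by (simp add: power_int_minus)
    ultimately have "pl_sim (real (Suc m) + 1) 1" by (rule pl_sim_trans)
    moreover have "real (Suc m) + 1 = real (Suc (Suc m))" by simp
    ultimately show ?case by (simp only:)
  qed
  obtain m n where l: "l = of_int m / 2 ^ n" using assms unfolding dyadic_rationals_def by blast
  hence "0 < m" using assms by (simp add: zero_less_divide_iff)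
  then obtain k where k: "m = int (Suc k)" using zero_less_imp_eq_int gr0_implies_Suc by metis
  have "pl_sim l (2 powi (int n) * l)" using assms by (rule pl_sim_scale)
  also have "2 powi (int n) * l = real (Suc k)" by (simp add: l k)
  finally show ?thesis using pl_sim_trans nat by blast
qed

lemma dpl_exists:
  assumes "a < b" "c < d" "a \<in> dyadic_rationals" "b \<in> dyadic_rationals" "c \<in> dyadic_rationals"
    "d \<in> dyadic_rationals"
  shows "\<exists>f. dpl f a b c d"
  using assms
  by (intro dpl_translate pl_sim_trans[OF pl_sim_1 pl_sim_sym[OF pl_sim_1]]) auto

section \<open>The group of dyadic piecewise linear homeomorphisms\<close>

abbreviation tmult (infixl "\<star>" 70) where "f \<star> g \<equiv> f \<otimes>\<^bsub>thompson_F\<^esub> g"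

abbreviation tinv where "tinv f \<equiv> inv\<^bsub>thompson_F\<^esub> f"

text \<open>A dyadic piecewise linear map fixing \<open>0\<close> and \<open>1\<close> is automatically an increasing homeomorphism.\<close>
lemma thompson_iff:
  "f \<in> carrier thompson_F \<longleftrightarrow> f \<in> extensional {0..1} \<and> dpl f 0 1 0 1"
proof
  assume "f \<in> carrier thompson_F"
  hence *: "bij_betw f {0..1} {0..1}" "f \<in> extensional {0..1}" "strict_mono_on {0..1} f" "dpl_on f 0 1"
    unfolding thompson_F_def thompson_carrier_def Bij_def dyadic_PL_iff by simp_all
  have im: "f ` {0..1} = {0..1}" using * by (simp add: bij_betw_def)
  obtain u v where uv: "u \<in> {0..1}" "f u = 0" "v \<in> {0..1}" "f v = 1"
  proof -
    have "0 \<in> f ` {0..1}" "1 \<in> f ` {0..1}" by (simp_all add: im)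
    thus ?thesis using that by (metis imageE)
  qed
  have "f 0 \<in> f ` {0..1}" "f 1 \<in> f ` {0..1}" by simp_all
  hence "f 0 \<in> {0..1}" "f 1 \<in> {0..1}" by (simp_all only: im)
  moreover have "f 0 \<le> f u" "f v \<le> f 1"
    by (rule strict_mono_on_leD[OF *(3)]; use uv in simp)+
  ultimately have "f 0 = 0" "f 1 = 1" using uv by auto
  thus "f \<in> extensional {0..1} \<and> dpl f 0 1 0 1" using * by (auto simp: dpl_def)
next
  assume *: "f \<in> extensional {0..1} \<and> dpl f 0 1 0 1"
  note D = dplD[OF conjunct2[OF *]]
  have inj: "inj_on f {0..1}" using D(9) by (rule strict_mono_on_imp_inj_on)
  have "\<exists>g. homeomorphism {0..1} {0..1} f g"
    using homeomorphism_compact[OF compact_Icc D(11) D(10) inj] by blast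
  thus "f \<in> carrier thompson_F"
    using D(9,10) inj * unfolding thompson_F_def thompson_carrier_def Bij_def dyadic_PL_iff bij_betw_def dpl_def
    by simp
qed

lemma thompson_dpl: "f \<in> carrier thompson_F \<Longrightarrow> dpl f 0 1 0 1"
  unfolding thompson_iff by blast

lemma thompson_of_dpl:
  assumes "dpl f 0 1 0 1" shows "\<exists>g\<in>carrier thompson_F. \<forall>t\<in>{0..1}. g t = f t"
  by (intro bexI[of _ "restrict f {0..1}"])
     (auto simp: thompson_iff intro: dpl_cong[OF assms])

lemma thompson_ext:
  assumes "f \<in> carrier thompson_F" "g \<in> carrier thompson_F" "\<And>t. 0 \<le> t \<Longrightarrow> t \<le> 1 \<Longrightarrow> f t = g t"
  shows "f = g"
  using assms by (intro extensionalityI[of f "{0..1}" g]) (auto simp: thompson_iff)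

lemma thompson_Bij: "f \<in> carrier thompson_F \<Longrightarrow> f \<in> Bij {0..1}"
  by (simp add: thompson_F_def thompson_carrier_def)

lemma thompson_mult [simp]:
  assumes "f \<in> carrier thompson_F" "g \<in> carrier thompson_F" "0 \<le> t" "t \<le> 1"
  shows "(f \<star> g) t = f (g t)"
  using assms thompson_Bij[of f] thompson_Bij[of g]
  by (simp add: thompson_F_def BijGroup_def compose_def)

lemma thompson_bounds [simp]:
  assumes "f \<in> carrier thompson_F" "0 \<le> t" "t \<le> 1" shows "0 \<le> f t" "f t \<le> 1"
  using assms dplD(13)[of f 0 1 0 1 t] by (auto simp: thompson_iff)

lemma thompson_less:
  assumes "f \<in> carrier thompson_F" "0 \<le> s" "t \<le> 1" "s < t" shows "f s < f t"
  using assms dplD(9)[of f 0 1 0 1] by (auto simp: thompson_iff strict_mono_on_def)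

lemma thompson_less_iff:
  assumes "f \<in> carrier thompson_F" "0 \<le> s" "s \<le> 1" "0 \<le> t" "t \<le> 1"
  shows "f s < f t \<longleftrightarrow> s < t" and "f s \<le> f t \<longleftrightarrow> s \<le> t" and "f s = f t \<longleftrightarrow> s = t"
  using assms thompson_less[of f s t] thompson_less[of f t s] by (cases s t rule: linorder_cases; auto)+

lemma thompson_ends [simp]: "f \<in> carrier thompson_F \<Longrightarrow> f 0 = 0" "f \<in> carrier thompson_F \<Longrightarrow> f 1 = 1"
  by (auto simp: thompson_iff dpl_def)

lemma thompson_dyadic:
  "f \<in> carrier thompson_F \<Longrightarrow> 0 \<le> t \<Longrightarrow> t \<le> 1 \<Longrightarrow> t \<in> dyadic_rationals \<Longrightarrow> f t \<in> dyadic_rationals"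
  using dplD(12)[of f 0 1 0 1 t] by (auto simp: thompson_iff)

lemma group_thompson: "group thompson_F"
proof -
  interpret B: group "BijGroup {0..1::real}" by (rule group_BijGroup)
  have sub: "f \<in> Bij {0..1}" if "f \<in> carrier thompson_F" for f using that by (rule thompson_Bij)
  have "subgroup (carrier thompson_F) (BijGroup {0..1})"
  proof (rule B.subgroupI)
    show "carrier thompson_F \<subseteq> carrier (BijGroup {0..1})" using sub by (auto simp: BijGroup_def)
    have "dpl (\<lambda>t. t) 0 1 0 1" by (rule dpl_affine[of _ _ _ _ 0]) auto
    thus "carrier thompson_F \<noteq> {}" using thompson_of_dpl by blast
    show "f \<otimes>\<^bsub>BijGroup {0..1}\<^esub> g \<in> carrier thompson_F"
      if "f \<in> carrier thompson_F" "g \<in> carrier thompson_F" for f g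
    proof -
      have "dpl (compose {0..1} f g) 0 1 0 1"
      proof (rule dpl_cong)
        show "dpl (\<lambda>t. f (g t)) 0 1 0 1" using that dpl_comp[of g 0 1 0 1 f 0 1]
          by (simp add: thompson_iff)
      qed (simp add: compose_def)
      thus ?thesis using that sub by (simp add: BijGroup_def thompson_iff)
    qed
    show "inv\<^bsub>BijGroup {0..1}\<^esub> f \<in> carrier thompson_F" if "f \<in> carrier thompson_F" for f
    proof -
      have "dpl (\<lambda>x\<in>{0..1}. inv_into {0..1} f x) 0 1 0 1"
      proof (rule dpl_cong)
        show "dpl (inv_into {0..1} f) 0 1 0 1" using that by (intro dpl_inv_into) (simp add: thompson_iff)
      qed simp
      thus ?thesis using that sub by (simp add: inv_BijGroup thompson_iff)
    qed
  qed
  from B.subgroup_imp_group[OF this] show ?thesis by (simp add: thompson_F_def)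
qed

interpretation F: group thompson_F by (rule group_thompson)

lemma thompson_one [simp]: "0 \<le> t \<Longrightarrow> t \<le> 1 \<Longrightarrow> \<one>\<^bsub>thompson_F\<^esub> t = t"
  by (simp add: thompson_F_def BijGroup_def)

lemma thompson_inv [simp]:
  assumes "f \<in> carrier thompson_F" "0 \<le> t" "t \<le> 1"
  shows "tinv f (f t) = t" "f (tinv f t) = t"
  using thompson_mult[of "tinv f" f t] thompson_mult[of f "tinv f" t] assms by simp_all

lemma thompson_inv_eq:
  assumes "f \<in> carrier thompson_F" "0 \<le> t" "t \<le> 1" "f t = s" shows "tinv f s = t"
  using assms thompson_inv(1)[of f t] by simp

text \<open>Each map preserves its own support, so where one moves a point the other one fixes both the point and its
image.\<close>
lemma disjoint_commute:
  assumes "f \<in> carrier thompson_F" "g \<in> carrier thompson_F"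
    and disj: "\<And>t. 0 \<le> t \<Longrightarrow> t \<le> 1 \<Longrightarrow> f t = t \<or> g t = t"
  shows "f \<star> g = g \<star> f"
proof (rule thompson_ext)
  fix t :: real assume t: "0 \<le> t" "t \<le> 1"
  have "f (g t) = g (f t)"
  proof -
    have "f (f t) = f t \<longleftrightarrow> f t = t" "g (g t) = g t \<longleftrightarrow> g t = t"
      using thompson_less_iff(3)[of f "f t" t] thompson_less_iff(3)[of g "g t" t] assms(1,2) t by simp_all
    moreover have "f (f t) = f t \<or> g (f t) = f t" "f (g t) = g t \<or> g (g t) = g t"
      using disj[of "f t"] disj[of "g t"] assms(1,2) t by simp_all
    ultimately show ?thesis using disj[OF t] by metis
  qed
  thus "(f \<star> g) t = (g \<star> f) t" using assms t by simp
qed (use assms in auto)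

section \<open>Slopes at the endpoints\<close>

lemma powi_2_inject: "(2::real) powi k = 2 powi l \<longleftrightarrow> k = l"
proof
  assume "(2::real) powi k = 2 powi l"
  hence "log 2 ((2::real) powi k) = log 2 (2 powi l)" by simp
  thus "k = l" by (simp flip: powr_real_of_int')
qed auto

lemma phi_fst_unique:
  assumes "f \<in> carrier thompson_F" "0 < e" "\<And>t. 0 \<le> t \<Longrightarrow> t \<le> e \<Longrightarrow> f t = 2 powi k * t"
  shows "fst (phi f) = k"
  using affine_right_derivative[of 0 e f "2 powi k" 0] phi_exact(1)[OF assms(1)] assms(2,3)
  by (auto simp: powi_2_inject)

lemma phi_snd_unique:
  assumes "f \<in> carrier thompson_F" "e < 1" "\<And>t. e \<le> t \<Longrightarrow> t \<le> 1 \<Longrightarrow> f t = 1 - 2 powi k * (1 - t)"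
  shows "snd (phi f) = k"
  using affine_left_derivative[of e 1 f "2 powi k" "1 - 2 powi k"] phi_exact(2)[OF assms(1)] assms(2,3)
  by (auto simp: powi_2_inject algebra_simps)

text \<open>A piece that starts at the fixed point \<open>0\<close> has no constant term.\<close>
lemma germ_0:
  assumes "f \<in> carrier thompson_F"
  shows "\<exists>e>0. e \<le> 1 \<and> (\<forall>t. 0 \<le> t \<longrightarrow> t \<le> e \<longrightarrow> f t = 2 powi fst (phi f) * t)"
proof -
  have "dpl_on f 0 1" using thompson_dpl[OF assms] unfolding dpl_def by blast
  hence "\<exists>e>0. e \<le> 1 \<and> (\<exists>k c. \<forall>t. 0 \<le> t \<longrightarrow> t \<le> e \<longrightarrow> f t = 2 powi (k::int) * t + c)"
  proof (induction rule: dpl_on_induct)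
    case (affine a b k c)
    thus ?case by blast
  next
    case (join a m b)
    thus ?case by (metis less_imp_le order.trans)
  qed
  then obtain e k c where e: "0 < e" "e \<le> 1" "\<forall>t. 0 \<le> t \<longrightarrow> t \<le> e \<longrightarrow> f t = 2 powi (k::int) * t + c"
    by blast
  moreover from this have "c = 0" using assms spec[OF e(3), of 0] by simp
  ultimately show ?thesis using phi_fst_unique[of f e k] assms by auto
qed

lemma germ_1:
  assumes "f \<in> carrier thompson_F"
  shows "\<exists>e<1. 0 \<le> e \<and> (\<forall>t. e \<le> t \<longrightarrow> t \<le> 1 \<longrightarrow> f t = 1 - 2 powi snd (phi f) * (1 - t))"
proof -
  have "dpl_on f 0 1" using thompson_dpl[OF assms] unfolding dpl_def by blast
  hence "\<exists>e<1. 0 \<le> e \<and> (\<exists>k c. \<forall>t. e \<le> t \<longrightarrow> t \<le> 1 \<longrightarrow> f t = 2 powi (k::int) * t + c)"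
  proof (induction rule: dpl_on_induct)
    case (affine a b k c)
    thus ?case by blast
  next
    case (join a m b)
    thus ?case by (metis less_imp_le order.trans)
  qed
  then obtain e k c where e: "e < 1" "0 \<le> e" "\<forall>t. e \<le> t \<longrightarrow> t \<le> 1 \<longrightarrow> f t = 2 powi (k::int) * t + c"
    by blast
  moreover from this have "c = 1 - 2 powi k" using assms spec[OF e(3), of 1] by simp
  ultimately have "\<forall>t. e \<le> t \<longrightarrow> t \<le> 1 \<longrightarrow> f t = 1 - 2 powi k * (1 - t)"
    by (simp add: algebra_simps)
  thus ?thesis using phi_snd_unique[of f e k] assms e(1,2) by auto
qed

lemma phi_mult:
  assumes "f \<in> carrier thompson_F" "g \<in> carrier thompson_F"
  shows "phi (f \<star> g) = phi f + phi g"
proof -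
  define k l where "k = fst (phi f)" and "l = fst (phi g)"
  obtain e where e: "e > 0" "e \<le> 1" "\<And>t. 0 \<le> t \<Longrightarrow> t \<le> e \<Longrightarrow> f t = 2 powi k * t"
    using germ_0[OF assms(1)] unfolding k_def by blast
  obtain d where d: "d > 0" "d \<le> 1" "\<And>t. 0 \<le> t \<Longrightarrow> t \<le> d \<Longrightarrow> g t = 2 powi l * t"
    using germ_0[OF assms(2)] unfolding l_def by blast
  have "fst (phi (f \<star> g)) = k + l"
  proof (rule phi_fst_unique)
    show "0 < min d (e / 2 powi l)" using e d by simp
    fix t assume t: "0 \<le> t" "t \<le> min d (e / 2 powi l)"
    hence "2 powi l * t \<le> e" by (simp add: field_simps)
    thus "(f \<star> g) t = 2 powi (k + l) * t"
      using t d e(3)[of "2 powi l * t"] assms by (simp add: power_int_add)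
  qed (use assms in auto)
  moreover define m n where "m = snd (phi f)" and "n = snd (phi g)"
  obtain e where e: "e < 1" "0 \<le> e" "\<And>t. e \<le> t \<Longrightarrow> t \<le> 1 \<Longrightarrow> f t = 1 - 2 powi m * (1 - t)"
    using germ_1[OF assms(1)] unfolding m_def by blast
  obtain d where d: "d < 1" "0 \<le> d" "\<And>t. d \<le> t \<Longrightarrow> t \<le> 1 \<Longrightarrow> g t = 1 - 2 powi n * (1 - t)"
    using germ_1[OF assms(2)] unfolding n_def by blast
  have "snd (phi (f \<star> g)) = m + n"
  proof (rule phi_snd_unique)
    show "max d (1 - (1 - e) / 2 powi n) < 1" using e d by simp
    fix t assume t: "max d (1 - (1 - e) / 2 powi n) \<le> t" "t \<le> 1"
    hence "1 - t \<le> (1 - e) / 2 powi n" by linarith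
    hence "2 powi n * (1 - t) \<le> 1 - e" by (simp add: field_simps)
    hence "e \<le> 1 - 2 powi n * (1 - t)" "1 - 2 powi n * (1 - t) \<le> 1" using t by auto
    thus "(f \<star> g) t = 1 - 2 powi (m + n) * (1 - t)"
      using t d e(3)[of "1 - 2 powi n * (1 - t)"] assms by (simp add: power_int_add)
  qed (use assms in auto)
  ultimately show ?thesis by (simp add: prod_eq_iff k_def l_def m_def n_def)
qed

lemma phi_one [simp]: "phi \<one>\<^bsub>thompson_F\<^esub> = 0"
  using phi_mult[of "\<one>\<^bsub>thompson_F\<^esub>" "\<one>\<^bsub>thompson_F\<^esub>"] by simp

lemma phi_inv: "f \<in> carrier thompson_F \<Longrightarrow> phi (tinv f) = - phi f"
  using phi_mult[of f "tinv f"] by (simp add: eq_neg_iff_add_eq_0 add.commute)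

text \<open>Both endpoint germs can be prescribed; any dyadic piecewise linear map fills the gap between them, and the
last hypothesis says that the gap in the image is not empty.\<close>
lemma exists_with_germs:
  assumes "0 < p" "p < q" "q < 1" "p \<in> dyadic_rationals" "q \<in> dyadic_rationals"
    "2 powi m * p < 1 - 2 powi n * (1 - q)"
  shows "\<exists>f\<in>carrier thompson_F. phi f = (m, n) \<and> (\<forall>t. 0 \<le> t \<longrightarrow> t \<le> p \<longrightarrow> f t = 2 powi m * t) \<and>
    (\<forall>t. q \<le> t \<longrightarrow> t \<le> 1 \<longrightarrow> f t = 1 - 2 powi n * (1 - t))"
proof -
  have 1: "dpl (\<lambda>t. 2 powi m * t) 0 p 0 (2 powi m * p)"
    by (rule dpl_affine[of _ _ _ _ m]) (use assms in auto)
  have 2: "dpl (\<lambda>t. 1 - 2 powi n * (1 - t)) q 1 (1 - 2 powi n * (1 - q)) 1"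
    by (rule dpl_affine[of _ _ _ _ n]) (use assms in \<open>auto simp: algebra_simps\<close>)
  obtain g where g: "dpl g p q (2 powi m * p) (1 - 2 powi n * (1 - q))"
    using dpl_exists[of p q "2 powi m * p" "1 - 2 powi n * (1 - q)"] assms by auto
  obtain f where f: "f \<in> carrier thompson_F" "\<forall>t\<in>{0..1}. f t =
      (if t \<le> q then if t \<le> p then 2 powi m * t else g t else 1 - 2 powi n * (1 - t))"
    using thompson_of_dpl[OF dpl_glue[OF dpl_glue[OF 1 g] 2]] by blast
  have a: "f t = 2 powi m * t" if "0 \<le> t" "t \<le> p" for t
    using f(2) that assms by auto
  have "g q = 1 - 2 powi n * (1 - q)" using dplD[OF g] by auto
  hence b: "f t = 1 - 2 powi n * (1 - t)" if "q \<le> t" "t \<le> 1" for t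
    using f(2) that assms by (cases "t = q") auto
  have "phi f = (m, n)"
    using phi_fst_unique[OF f(1) assms(1) a] phi_snd_unique[OF f(1) assms(3) b] by (simp add: prod_eq_iff)
  thus ?thesis using f(1) a b by blast
qed

section \<open>Two generators\<close>

text \<open>The affine map of \<open>[a,b]\<close> onto \<open>[c,d]\<close>. Recording endpoints instead of slope and constant makes composition
and merging of adjacent pieces a matter of matching endpoints.\<close>
definition aff :: "(real \<Rightarrow> real) \<Rightarrow> real \<Rightarrow> real \<Rightarrow> real \<Rightarrow> real \<Rightarrow> bool" where
  "aff f a b c d \<longleftrightarrow> a < b \<and> c < d \<and> (\<forall>t. a \<le> t \<longrightarrow> t \<le> b \<longrightarrow> f t = c + (d - c) / (b - a) * (t - a))"

lemma affI:
  assumes "a < b" "0 < s" "\<And>t. a \<le> t \<Longrightarrow> t \<le> b \<Longrightarrow> f t = c + s * (t - a)" "d = c + s * (b - a)"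
  shows "aff f a b c d"
  using assms by (auto simp: aff_def)

lemma aff_ends:
  assumes "aff f a b c d" shows "a < b" "c < d" "f a = c" "f b = d"
  using assms by (auto simp: aff_def)

lemma aff_comp:
  assumes "aff g a b c d" "aff f c d e h" "\<And>t. a \<le> t \<Longrightarrow> t \<le> b \<Longrightarrow> fg t = f (g t)"
  shows "aff fg a b e h"
proof (rule affI)
  have lt: "a < b" "c < d" "e < h" using assms by (auto simp: aff_def)
  thus "a < b" "0 < (h - e) / (b - a)" by auto
  show "h = e + (h - e) / (b - a) * (b - a)" using lt by simp
  fix t assume t: "a \<le> t" "t \<le> b"
  define u where "u = c + (d - c) / (b - a) * (t - a)"
  have r: "0 \<le> (t - a) / (b - a)" "(t - a) / (b - a) \<le> 1" using t lt by auto
  have "u = c + (d - c) * ((t - a) / (b - a))" by (simp add: u_def)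
  moreover have "0 \<le> (d - c) * ((t - a) / (b - a))" using r lt by (intro mult_nonneg_nonneg) auto
  ultimately have "c \<le> u" "u \<le> d" using mult_left_mono[OF r(2), of "d - c"] lt by auto
  hence "fg t = e + (h - e) / (d - c) * (u - c)"
    using assms t by (auto simp: aff_def u_def)
  also have "u - c = (d - c) * ((t - a) / (b - a))" by (simp add: u_def)
  also have "(h - e) / (d - c) * ((d - c) * ((t - a) / (b - a))) = (h - e) / (b - a) * (t - a)"
    using lt by simp
  finally show "fg t = e + (h - e) / (b - a) * (t - a)" .
qed

lemma aff_join:
  assumes "aff f a m c n" "aff f m b n d" "(n - c) * (b - m) = (d - n) * (m - a)"
  shows "aff f a b c d"
proof (rule affI)
  have lt: "a < m" "m < b" "c < n" "n < d" using assms by (auto simp: aff_def)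
  define s where "s = (n - c) / (m - a)"
  have s1: "n = c + s * (m - a)" using lt by (simp add: s_def)
  have "(d - n) / (b - m) = s" using assms(3) lt by (simp add: s_def field_simps)
  hence s2: "d = n + s * (b - m)" "\<And>t. m \<le> t \<Longrightarrow> t \<le> b \<Longrightarrow> f t = n + s * (t - m)"
    using lt assms(2) by (auto simp: aff_def)
  show "a < b" "0 < s" using lt by (auto simp: s_def)
  show "d = c + s * (b - a)" using s1 s2(1) by (simp add: algebra_simps)
  fix t assume t: "a \<le> t" "t \<le> b"
  show "f t = c + s * (t - a)"
  proof (cases "t \<le> m")
    case True
    thus ?thesis using assms(1) t by (simp add: aff_def s_def)
  next
    case False
    thus ?thesis using s2(2)[of t] t s1 by (simp add: algebra_simps)
  qed
qed

text \<open>For \<open>w = 1 / 2 ^ j\<close> this is the standard generator \<open>x\<^sub>j\<close> of Thompson's group: the identity up to the point \<open>1 - w\<close>, after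
which it maps \<open>1 - 1 / 2 ^ i\<close> to \<open>1 - 1 / 2 ^ (i + 1)\<close> for all \<open>i > j\<close>, and the two halves of the first interval
to the first two intervals.\<close>
definition vine_shift :: "real \<Rightarrow> (real \<Rightarrow> real) \<Rightarrow> bool" where
  "vine_shift w g \<longleftrightarrow> g \<in> carrier thompson_F \<and>
     (\<forall>t. 0 \<le> t \<longrightarrow> t \<le> 1 - w \<longrightarrow> g t = t) \<and>
     (\<forall>t. 1 - w \<le> t \<longrightarrow> t \<le> 1 - 3 * w / 4 \<longrightarrow> g t = 2 * t - (1 - w)) \<and>
     (\<forall>t. 1 - 3 * w / 4 \<le> t \<longrightarrow> t \<le> 1 - w / 2 \<longrightarrow> g t = t + w / 4) \<and>
     (\<forall>t. 1 - w / 2 \<le> t \<longrightarrow> t \<le> 1 \<longrightarrow> g t = (1 + t) / 2)"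

lemma vine_shift_exists:
  assumes "0 < w" "w \<le> 1" "w \<in> dyadic_rationals"
  shows "\<exists>g. vine_shift w g"
proof -
  define h where "h = (\<lambda>t. if t \<le> 1 - w / 2 then if t \<le> 1 - 3 * w / 4 then 2 * t - (1 - w)
     else t + w / 4 else (1 + t) / 2)"
  have "dpl (\<lambda>t. 2 * t - (1 - w)) (1 - w) (1 - 3 * w / 4) (1 - w) (1 - w / 2)"
    by (rule dpl_affine[of _ _ _ _ 1]) (use assms in auto)
  moreover have "dpl (\<lambda>t. t + w / 4) (1 - 3 * w / 4) (1 - w / 2) (1 - w / 2) (1 - w / 4)"
    by (rule dpl_affine[of _ _ _ _ 0]) (use assms in auto)
  moreover have "dpl (\<lambda>t. (1 + t) / 2) (1 - w / 2) 1 (1 - w / 4) 1"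
    by (rule dpl_affine[of _ _ _ _ "-1"]) (use assms in \<open>auto simp: power_int_minus field_simps\<close>)
  ultimately have h: "dpl h (1 - w) 1 (1 - w) 1" unfolding h_def by (intro dpl_glue)
  have "dpl (\<lambda>t. if t \<le> 1 - w then t else h t) 0 1 0 1"
  proof (cases "w = 1")
    case True
    thus ?thesis using dpl_cong[OF h, of "\<lambda>t. if t \<le> 1 - w then t else h t"] by (auto simp: h_def)
  next
    case False
    have "dpl (\<lambda>t. t) 0 (1 - w) 0 (1 - w)"
      by (rule dpl_affine[of _ _ _ _ 0]) (use assms False in auto)
    thus ?thesis using h by (rule dpl_glue)
  qed
  from thompson_of_dpl[OF this] obtain g where g: "g \<in> carrier thompson_F"
    "\<And>t. 0 \<le> t \<Longrightarrow> t \<le> 1 \<Longrightarrow> g t = (if t \<le> 1 - w then t else h t)" by auto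
  have "vine_shift w g" unfolding vine_shift_def
    using assms g by (auto simp: h_def field_simps)
  thus ?thesis by blast
qed

text \<open>The classical relation \<open>x\<^sub>0 x\<^sub>j x\<^sub>0\<inverse> = x\<^sub>j\<^sub>+\<^sub>1\<close> for \<open>j \<ge> 1\<close>: on the support of \<open>x\<^sub>j\<close> the map \<open>x\<^sub>0\<close> is \<open>(1 + t) / 2\<close>.\<close>
lemma vine_shift_conj:
  assumes "vine_shift 1 x" "vine_shift w g" "0 < w" "w \<le> 1 / 2"
  shows "vine_shift (w / 2) (x \<star> g \<star> tinv x)"
proof -
  have x: "x \<in> carrier thompson_F" "\<And>t. 1 / 2 \<le> t \<Longrightarrow> t \<le> 1 \<Longrightarrow> x t = (1 + t) / 2"
    using assms(1) by (auto simp: vine_shift_def)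
  have g: "g \<in> carrier thompson_F" using assms(2) by (auto simp: vine_shift_def)
  have *: "(x \<star> g \<star> tinv x) s = x (g (tinv x s))" if "0 \<le> s" "s \<le> 1" for s
    using x g that by simp
  have low: "(x \<star> g \<star> tinv x) s = s" if s: "0 \<le> s" "s \<le> 1 - w / 2" for s
  proof -
    have "x (1 - w) = 1 - w / 2" using x(2)[of "1 - w"] assms by (simp add: field_simps)
    hence "x (tinv x s) \<le> x (1 - w)" using x(1) s assms(3) by (simp del: atLeastAtMost_iff)
    moreover have "0 \<le> tinv x s" "tinv x s \<le> 1" using x s assms by auto
    ultimately have "tinv x s \<le> 1 - w"
      using thompson_less_iff(2)[of x "tinv x s" "1 - w"] x assms by auto
    hence "g (tinv x s) = tinv x s" using assms(2) \<open>0 \<le> tinv x s\<close> by (auto simp: vine_shift_def)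
    thus ?thesis using *[of s] s assms x by simp
  qed
  have high: "(x \<star> g \<star> tinv x) s = (1 + g (2 * s - 1)) / 2" if s: "1 - w / 2 \<le> s" "s \<le> 1" for s
  proof -
    have "tinv x s = 2 * s - 1"
      using thompson_inv_eq[of x "2 * s - 1" s] x(2)[of "2 * s - 1"] x s assms by simp
    moreover have "g (1 - w) = 1 - w" using assms by (simp add: vine_shift_def)
    hence "1 - w \<le> g (2 * s - 1)" "g (2 * s - 1) \<le> 1"
      using thompson_less_iff(2)[of g "1 - w" "2 * s - 1"] g s assms by auto
    ultimately show ?thesis using *[of s] x(2)[of "g (2 * s - 1)"] s assms by simp
  qed
  have g4: "\<And>t. 1 - w \<le> t \<Longrightarrow> t \<le> 1 - 3 * w / 4 \<Longrightarrow> g t = 2 * t - (1 - w)"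
     "\<And>t. 1 - 3 * w / 4 \<le> t \<Longrightarrow> t \<le> 1 - w / 2 \<Longrightarrow> g t = t + w / 4"
     "\<And>t. 1 - w / 2 \<le> t \<Longrightarrow> t \<le> 1 \<Longrightarrow> g t = (1 + t) / 2"
    using assms(2) by (auto simp: vine_shift_def)
  show ?thesis unfolding vine_shift_def
  proof (intro conjI allI impI)
    show "x \<star> g \<star> tinv x \<in> carrier thompson_F" using x g by simp
    fix t :: real
    show "(x \<star> g \<star> tinv x) t = t" if "0 \<le> t" "t \<le> 1 - w / 2" using low that by simp
    show "(x \<star> g \<star> tinv x) t = 2 * t - (1 - w / 2)" if "1 - w / 2 \<le> t" "t \<le> 1 - 3 * (w / 2) / 4"
      using high[of t] g4(1)[of "2 * t - 1"] that assms(3) by (simp add: field_simps)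
    show "(x \<star> g \<star> tinv x) t = t + w / 2 / 4" if "1 - 3 * (w / 2) / 4 \<le> t" "t \<le> 1 - w / 2 / 2"
      using high[of t] g4(2)[of "2 * t - 1"] that assms(3) by (simp add: field_simps)
    show "(x \<star> g \<star> tinv x) t = (1 + t) / 2" if "1 - w / 2 / 2 \<le> t" "t \<le> 1"
      using high[of t] g4(3)[of "2 * t - 1"] that assms(3) by (simp add: field_simps)
  qed
qed

text \<open>The partition of \<open>[0,1]\<close> into \<open>M + 1\<close> intervals given by the leaves of the binary tree that always branches to
the right; the last two intervals have equal length.\<close>
definition vine :: "nat \<Rightarrow> nat \<Rightarrow> real" where
  "vine M i = (if i \<le> M then 1 - 1 / 2 ^ i else 1)"

text \<open>The values of \<open>q\<close> cut \<open>[0,1]\<close> into \<open>M + 1\<close> standard dyadic intervals, the leaves of a binary tree.\<close>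
definition standard :: "nat \<Rightarrow> (nat \<Rightarrow> real) \<Rightarrow> bool" where
  "standard M q \<longleftrightarrow> q 0 = 0 \<and> q (Suc M) = 1 \<and>
     (\<forall>i\<le>M. \<exists>(k::nat) (m::int). q i = m / 2 ^ k \<and> q (Suc i) = (m + 1) / 2 ^ k)"

text \<open>The element carrying the leaves of the right vine to the intervals cut by \<open>q\<close>; it is the positive element
of the tree of \<open>q\<close>.\<close>
definition vine_map :: "nat \<Rightarrow> (nat \<Rightarrow> real) \<Rightarrow> (real \<Rightarrow> real) \<Rightarrow> bool" where
  "vine_map M q f \<longleftrightarrow> f \<in> carrier thompson_F \<and>
     (\<forall>i\<le>M. aff f (vine M i) (vine M (Suc i)) (q i) (q (Suc i)))"

definition skip :: "nat \<Rightarrow> (nat \<Rightarrow> real) \<Rightarrow> nat \<Rightarrow> real" where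
  "skip j q i = (if i \<le> j then q i else q (Suc i))"

text \<open>Some two neighbouring intervals are siblings and can be merged to a standard one. Take the first of the
shortest intervals, \<open>[m / 2 ^ K, (m + 1) / 2 ^ K]\<close>. If \<open>m\<close> were odd, the interval to the left would end at a
point with denominator \<open>2 ^ K\<close> and so be as short, contrary to the choice. So \<open>m\<close> is even, \<open>m + 1\<close> is odd,
and the interval to the right has length \<open>1 / 2 ^ K\<close> for the same reason: it is the sibling.\<close>
lemma standard_merge:
  assumes "standard (Suc M) q"
  shows "\<exists>j\<le>M. q (Suc j) - q j = q (Suc (Suc j)) - q (Suc j) \<and> standard M (skip j q)"
proof -
  have q0: "q 0 = 0" and q1: "q (Suc (Suc M)) = 1"
    and "\<forall>i\<le>Suc M. \<exists>(k::nat) (m::int). q i = m / 2 ^ k \<and> q (Suc i) = (m + 1) / 2 ^ k"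
    using assms by (auto simp: standard_def)
  then obtain k :: "nat \<Rightarrow> nat" and m :: "nat \<Rightarrow> int" where
    "\<forall>i\<le>Suc M. q i = m i / 2 ^ k i \<and> q (Suc i) = (real_of_int (m i) + 1) / 2 ^ k i"
    by metis
  hence km: "\<And>i. i \<le> Suc M \<Longrightarrow> q i = m i / 2 ^ k i"
    "\<And>i. i \<le> Suc M \<Longrightarrow> q (Suc i) = (m i + 1) / 2 ^ k i" by auto
  define K where "K = Max (k ` {..Suc M})"
  have K_ge: "k i \<le> K" if "i \<le> Suc M" for i
    unfolding K_def using that by (intro Max_ge) auto
  have "K \<in> k ` {..Suc M}" unfolding K_def by (intro Max_in) auto
  hence ex: "\<exists>i. i \<le> Suc M \<and> k i = K" by auto
  define j where "j = (LEAST i. i \<le> Suc M \<and> k i = K)"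
  have j: "j \<le> Suc M" "k j = K" using LeastI_ex[OF ex] by (auto simp: j_def)
  have lt: "k i < K" if "i < j" for i
    using not_less_Least[of i "\<lambda>i. i \<le> Suc M \<and> k i = K"] that j K_ge[of i] by (auto simp: j_def)
  have frac: "a = b * 2 ^ (K - l)" if "real_of_int a / 2 ^ K = real_of_int b / 2 ^ l" "l \<le> K" for a b :: int and l
  proof -
    have "(2::real) ^ K = 2 ^ (K - l) * 2 ^ l" using that(2) by (simp flip: power_add)
    hence "real_of_int a = real_of_int (b * 2 ^ (K - l))" using that(1) by (simp add: field_simps)
    thus ?thesis by linarith
  qed
  have K0: "K \<noteq> 0"
  proof
    assume "K = 0"
    hence "q (Suc i) = q i + 1" if "i \<le> Suc M" for i
      using km[OF that] K_ge[OF that] by simp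
    hence "q i = real i" if "i \<le> Suc (Suc M)" for i using that q0 by (induction i) auto
    thus False using q1 by fastforce
  qed
  have even: "even (m j)"
  proof (cases j)
    case 0
    thus ?thesis using km(1)[of 0] q0 by simp
  next
    case (Suc i)
    hence i: "i \<le> Suc M" "k i < K" using j lt by auto
    have "m j / 2 ^ K = real_of_int (m i + 1) / 2 ^ k i" using km(1)[of j] km(2)[of i] i j Suc by simp
    hence "m j = (m i + 1) * 2 ^ (K - k i)" using i by (intro frac) auto
    thus ?thesis using i by simp
  qed
  have "j \<noteq> Suc M"
  proof
    assume "j = Suc M"
    hence "real_of_int (m j + 1) / 2 ^ K = real_of_int 1 / 2 ^ 0"
      using km(2)[OF j(1)] q1 unfolding j(2) by (metis div_by_1 of_int_1 power_0)
    hence "m j + 1 = 1 * 2 ^ (K - 0)" by (intro frac) auto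
    moreover have "even (2 ^ K :: int)" using K0 by simp
    moreover have "odd (m j + 1)" using even by simp
    ultimately show False by simp
  qed
  hence jM: "j \<le> M" using j by simp
  have e1: "real_of_int (m j + 1) / 2 ^ K = m (Suc j) / 2 ^ k (Suc j)"
    using km(2)[of j] km(1)[of "Suc j"] j jM by simp
  hence e2: "m j + 1 = m (Suc j) * 2 ^ (K - k (Suc j))" using K_ge[of "Suc j"] jM by (intro frac) auto
  have "K - k (Suc j) = 0"
  proof (rule ccontr)
    assume "K - k (Suc j) \<noteq> 0"
    hence "even (m (Suc j) * 2 ^ (K - k (Suc j)))" by simp
    thus False using even e2 by (metis even_plus_one_iff)
  qed
  hence kS: "k (Suc j) = K" and mS: "m (Suc j) = m j + 1" using K_ge[of "Suc j"] jM e2 by auto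
  obtain n where n: "m j = 2 * n" using even by auto
  obtain K' where K': "K = Suc K'" using K0 not0_implies_Suc by blast
  have qs: "q j = n / 2 ^ K'" "q (Suc j) = (2 * n + 1) / 2 ^ K" "q (Suc (Suc j)) = (n + 1) / 2 ^ K'"
    using km(1)[of j] km(2)[of j] km(2)[of "Suc j"] j jM n kS mS K' by (simp_all add: add_divide_distrib)
  have "q (Suc j) - q j = q (Suc (Suc j)) - q (Suc j)" unfolding qs K' by (simp add: field_simps)
  moreover have "standard M (skip j q)"
    unfolding standard_def
  proof (intro conjI allI impI)
    show "skip j q 0 = 0" "skip j q (Suc M) = 1" using q0 q1 jM by (auto simp: skip_def)
    fix i assume i: "i \<le> M"
    consider "i < j" | "i = j" | "i > j" by linarith
    thus "\<exists>(k::nat) (m::int). skip j q i = m / 2 ^ k \<and> skip j q (Suc i) = (m + 1) / 2 ^ k"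
    proof cases
      case 1
      thus ?thesis using km[of i] i by (intro exI[of _ "k i"] exI[of _ "m i"]) (auto simp: skip_def)
    next
      case 2
      thus ?thesis using qs by (intro exI[of _ K'] exI[of _ n]) (auto simp: skip_def)
    next
      case 3
      thus ?thesis using km[of "Suc i"] i
        by (intro exI[of _ "k (Suc i)"] exI[of _ "m (Suc i)"]) (auto simp: skip_def)
    qed
  qed
  ultimately show ?thesis using jM by blast
qed

text \<open>Precomposing with \<open>x\<^sub>j\<close> merges the vine intervals \<open>j\<close> and \<open>j + 1\<close> into one and shifts the later ones, so it undoes
one branching of the tree of \<open>q\<close>.\<close>
lemma vine_map_merge:
  assumes f: "vine_map (Suc M) q f" and j: "j < M"
    and eq: "q (Suc j) - q j = q (Suc (Suc j)) - q (Suc j)" and g: "vine_shift (1 / 2 ^ j) g"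
  shows "vine_map M (skip j q) (f \<star> g)"
  unfolding vine_map_def
proof (intro conjI allI impI)
  have c: "f \<in> carrier thompson_F" "g \<in> carrier thompson_F"
    using f g by (auto simp: vine_map_def vine_shift_def)
  thus "f \<star> g \<in> carrier thompson_F" by simp
  define w where "w = (1::real) / 2 ^ j"
  have w: "0 < w" "w \<le> 1" by (auto simp: w_def)
  have fa: "aff f (vine (Suc M) i) (vine (Suc M) (Suc i)) (q i) (q (Suc i))" if "i \<le> Suc M" for i
    using f that by (auto simp: vine_map_def)
  have g1: "\<And>t. 0 \<le> t \<Longrightarrow> t \<le> 1 - w \<Longrightarrow> g t = t"
    "\<And>t. 1 - w \<le> t \<Longrightarrow> t \<le> 1 - 3 * w / 4 \<Longrightarrow> g t = 2 * t - (1 - w)"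
    "\<And>t. 1 - 3 * w / 4 \<le> t \<Longrightarrow> t \<le> 1 - w / 2 \<Longrightarrow> g t = t + w / 4"
    "\<And>t. 1 - w / 2 \<le> t \<Longrightarrow> t \<le> 1 \<Longrightarrow> g t = (1 + t) / 2"
    using g by (auto simp: vine_shift_def w_def)
  fix i assume i: "i \<le> M"
  have v01: "0 \<le> vine M i" "vine M (Suc i) \<le> 1" by (auto simp: vine_def)
  have fg: "(f \<star> g) t = f (g t)" if "vine M i \<le> t" "t \<le> vine M (Suc i)" for t
    using c v01 that by simp
  consider "i < j" | "i = j" | "i > j" by linarith
  thus "aff (f \<star> g) (vine M i) (vine M (Suc i)) (skip j q i) (skip j q (Suc i))"
  proof cases
    case 1
    have v: "vine M i = vine (Suc M) i" "vine M (Suc i) = vine (Suc M) (Suc i)"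
      using 1 j by (auto simp: vine_def)
    have "(1::real) / 2 ^ j \<le> 1 / 2 ^ Suc i" using 1
      by (intro divide_left_mono power_increasing) auto
    hence "vine M (Suc i) \<le> 1 - w" using 1 j by (simp add: vine_def w_def)
    hence gid: "g t = t" if "vine M i \<le> t" "t \<le> vine M (Suc i)" for t
      using g1(1)[of t] that v01 by simp
    have "aff (f \<star> g) (vine (Suc M) i) (vine (Suc M) (Suc i)) (q i) (q (Suc i))"
      using fa[of i] i gid fg unfolding v[symmetric] aff_def by auto
    thus ?thesis using 1 v by (simp add: skip_def)
  next
    case 2
    have v: "vine M i = 1 - w" "vine M (Suc i) = 1 - w / 2" "vine (Suc M) i = 1 - w"
      "vine (Suc M) (Suc i) = 1 - w / 2" "vine (Suc M) (Suc (Suc i)) = 1 - w / 4"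
      using 2 j by (auto simp: vine_def w_def)
    have a: "aff g (1 - w) (1 - 3 * w / 4) (1 - w) (1 - w / 2)"
      by (rule affI[of _ _ 2]) (use g1(2) w in auto)
    have b: "aff g (1 - 3 * w / 4) (1 - w / 2) (1 - w / 2) (1 - w / 4)"
      by (rule affI[of _ _ 1]) (use g1(3) w in auto)
    have a': "aff (f \<star> g) (1 - w) (1 - 3 * w / 4) (q i) (q (Suc i))"
      by (rule aff_comp[OF a]) (use fa[of i] i v fg w in auto)
    have b': "aff (f \<star> g) (1 - 3 * w / 4) (1 - w / 2) (q (Suc i)) (q (Suc (Suc i)))"
      by (rule aff_comp[OF b]) (use fa[of "Suc i"] i v fg w in auto)
    have "aff (f \<star> g) (1 - w) (1 - w / 2) (q i) (q (Suc (Suc i)))"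
      by (rule aff_join[OF a' b']) (use eq 2 in auto)
    thus ?thesis using 2 v by (simp add: skip_def)
  next
    case 3
    have v: "(1 + vine M i) / 2 = vine (Suc M) (Suc i)" "(1 + vine M (Suc i)) / 2 = vine (Suc M) (Suc (Suc i))"
      "vine M i < vine M (Suc i)"
      using 3 i by (auto simp: vine_def field_simps)
    have "(1::real) / 2 ^ i \<le> 1 / 2 ^ Suc j" using 3
      by (intro divide_left_mono power_increasing) auto
    hence "1 - w / 2 \<le> vine M i" using i by (simp add: vine_def w_def)
    hence gh: "g t = (1 + t) / 2" if "vine M i \<le> t" "t \<le> vine M (Suc i)" for t
      using g1(4)[of t] that v01 by simp
    have "aff g (vine M i) (vine M (Suc i)) (vine (Suc M) (Suc i)) (vine (Suc M) (Suc (Suc i)))"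
      by (rule affI[of _ _ "1 / 2"]) (use v gh in \<open>auto simp: field_simps\<close>)
    hence "aff (f \<star> g) (vine M i) (vine M (Suc i)) (q (Suc i)) (q (Suc (Suc i)))"
      by (rule aff_comp) (use fa[of "Suc i"] i fg in auto)
    thus ?thesis using 3 by (simp add: skip_def)
  qed
qed

text \<open>The last two vine intervals are siblings themselves; merging them leaves the element unchanged.\<close>
lemma vine_map_merge_last:
  assumes f: "vine_map (Suc M) q f"
    and eq: "q (Suc M) - q M = q (Suc (Suc M)) - q (Suc M)"
  shows "vine_map M (skip M q) f"
  unfolding vine_map_def
proof (intro conjI allI impI)
  show "f \<in> carrier thompson_F" using f by (simp add: vine_map_def)
  have fa: "aff f (vine (Suc M) i) (vine (Suc M) (Suc i)) (q i) (q (Suc i))" if "i \<le> Suc M" for i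
    using f that by (auto simp: vine_map_def)
  fix i assume i: "i \<le> M"
  show "aff f (vine M i) (vine M (Suc i)) (skip M q i) (skip M q (Suc i))"
  proof (cases "i = M")
    case True
    have "aff f (vine (Suc M) M) (vine (Suc M) (Suc (Suc M))) (q M) (q (Suc (Suc M)))"
      by (rule aff_join[OF fa fa]) (use eq in \<open>auto simp: vine_def field_simps\<close>)
    thus ?thesis using True by (simp add: vine_def skip_def)
  next
    case False
    thus ?thesis using fa[of i] i by (simp add: vine_def skip_def)
  qed
qed

lemma vine_map_generated:
  assumes gens: "\<And>j. \<exists>g\<in>S. vine_shift (1 / 2 ^ j) g" and S: "subgroup S thompson_F"
  shows "vine_map M q f \<Longrightarrow> standard M q \<Longrightarrow> f \<in> S"
proof (induction M arbitrary: q f)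
  case 0
  have "f = \<one>\<^bsub>thompson_F\<^esub>"
    by (rule thompson_ext) (use 0 in \<open>auto simp: vine_map_def vine_def standard_def aff_def\<close>)
  thus ?case using S by (simp add: subgroup.one_closed)
next
  case (Suc M)
  obtain j where j: "j \<le> M" "q (Suc j) - q j = q (Suc (Suc j)) - q (Suc j)" "standard M (skip j q)"
    using standard_merge[OF Suc.prems(2)] by blast
  have f: "f \<in> carrier thompson_F" using Suc.prems by (simp add: vine_map_def)
  show ?case
  proof (cases "j = M")
    case True
    thus ?thesis using vine_map_merge_last[OF Suc.prems(1)] j Suc.IH by blast
  next
    case False
    obtain g where g: "g \<in> S" "vine_shift (1 / 2 ^ j) g" using gens by blast
    have "f \<star> g \<in> S"
      using vine_map_merge[OF Suc.prems(1) _ j(2) g(2)] False j Suc.IH by force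
    hence "f \<star> g \<star> tinv g \<in> S" using S g by (simp add: subgroup.m_closed subgroup.m_inv_closed)
    moreover have "g \<in> carrier thompson_F" using g by (simp add: vine_shift_def)
    ultimately show ?thesis using f by (simp add: F.m_assoc)
  qed
qed

lemma vine_piece_exists:
  assumes "standard M q" "i \<le> M"
  shows "\<exists>h. dpl h (vine M i) (vine M (Suc i)) (q i) (q (Suc i)) \<and>
    aff h (vine M i) (vine M (Suc i)) (q i) (q (Suc i))"
proof -
  from assms have "\<exists>(k::nat) (m::int). q i = m / 2 ^ k \<and> q (Suc i) = (of_int m + 1) / 2 ^ k"
    unfolding standard_def by simp
  then obtain k :: nat and m :: int where km: "q i = m / 2 ^ k" "q (Suc i) = (of_int m + 1) / 2 ^ k"
    by (elim exE conjE)
  define e where "e = (if i < M then Suc i else i)"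
  have v: "vine M (Suc i) = vine M i + 1 / 2 ^ e"
  proof (cases "i < M")
    case True
    thus ?thesis by (simp add: vine_def e_def)
  next
    case False
    hence "i = M" using assms(2) by simp
    thus ?thesis by (simp add: vine_def e_def)
  qed
  define s where "s = (2::real) powi (int e - int k)"
  have s: "s = 2 ^ e / 2 ^ k" "0 < s" by (simp_all add: s_def power_int_diff)
  have q: "q (Suc i) = q i + s * (vine M (Suc i) - vine M i)"
    by (simp add: km v s add_divide_distrib)
  have lt: "vine M i < vine M (Suc i)" by (simp add: v)
  have "vine M j \<in> dyadic_rationals" for j by (simp add: vine_def del: power_Suc)
  moreover have "q i \<in> dyadic_rationals" by (simp add: km)
  ultimately have d: "vine M i \<in> dyadic_rationals" "vine M (Suc i) \<in> dyadic_rationals"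
    "q i \<in> dyadic_rationals" by simp_all
  have "dpl (\<lambda>t. q i + s * (t - vine M i)) (vine M i) (vine M (Suc i)) (q i) (q (Suc i))"
    by (rule dpl_affine[OF lt d, where k = "int e - int k"]) (simp_all only: s_def[symmetric] q[symmetric])
  moreover have "aff (\<lambda>t. q i + s * (t - vine M i)) (vine M i) (vine M (Suc i)) (q i) (q (Suc i))"
    by (rule affI[OF lt s(2) refl q])
  ultimately show ?thesis by blast
qed

lemma aff_cong:
  assumes "aff f a b c d" "\<And>t. a \<le> t \<Longrightarrow> t \<le> b \<Longrightarrow> g t = f t" shows "aff g a b c d"
  using assms by (auto simp: aff_def)

lemma vine_bounds: "0 \<le> vine M i" "vine M i \<le> 1" "vine M i \<le> vine M (Suc i)"
  by (auto simp: vine_def field_simps)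

lemma vine_mono: "i \<le> j \<Longrightarrow> vine M i \<le> vine M j"
  by (rule lift_Suc_mono_le) (rule vine_bounds(3))

lemma vine_map_exists:
  assumes "standard M q" shows "\<exists>f. vine_map M q f"
proof -
  have "\<exists>g. dpl g 0 (vine M (Suc j)) 0 (q (Suc j)) \<and>
    (\<forall>i\<le>j. aff g (vine M i) (vine M (Suc i)) (q i) (q (Suc i)))" if "j \<le> M" for j
    using that
  proof (induction j)
    case 0
    have "vine M 0 = 0" "q 0 = 0" using assms by (auto simp: vine_def standard_def)
    thus ?case using vine_piece_exists[OF assms, of 0] by auto
  next
    case (Suc j)
    then obtain g where g: "dpl g 0 (vine M (Suc j)) 0 (q (Suc j))"
      "\<And>i. i \<le> j \<Longrightarrow> aff g (vine M i) (vine M (Suc i)) (q i) (q (Suc i))" by auto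
    obtain h where h: "dpl h (vine M (Suc j)) (vine M (Suc (Suc j))) (q (Suc j)) (q (Suc (Suc j)))"
       "aff h (vine M (Suc j)) (vine M (Suc (Suc j))) (q (Suc j)) (q (Suc (Suc j)))"
      using vine_piece_exists[OF assms, of "Suc j"] Suc.prems by blast
    define f where "f = (\<lambda>t. if t \<le> vine M (Suc j) then g t else h t)"
    have ends: "g (vine M (Suc j)) = h (vine M (Suc j))"
      using dplD(8)[OF g(1)] dplD(7)[OF h(1)] by simp
    have "aff f (vine M i) (vine M (Suc i)) (q i) (q (Suc i))" if i: "i \<le> Suc j" for i
    proof (cases "i = Suc j")
      case True
      show ?thesis unfolding True
      proof (rule aff_cong[OF h(2)])
        show "f t = h t" if "vine M (Suc j) \<le> t" for t
          using that ends by (cases "t = vine M (Suc j)") (simp_all add: f_def)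
      qed
    next
      case False
      hence "vine M (Suc i) \<le> vine M (Suc j)" using i by (intro vine_mono) simp
      hence "f t = g t" if "t \<le> vine M (Suc i)" for t using that by (simp add: f_def)
      thus ?thesis using False i by (intro aff_cong[OF g(2)]) simp_all
    qed
    moreover have "dpl f 0 (vine M (Suc (Suc j))) 0 (q (Suc (Suc j)))"
      unfolding f_def by (rule dpl_glue[OF g(1) h(1)])
    ultimately show ?case by blast
  qed
  from this[of M] obtain g where g: "dpl g 0 1 0 1"
    "\<And>i. i \<le> M \<Longrightarrow> aff g (vine M i) (vine M (Suc i)) (q i) (q (Suc i))"
    using assms by (auto simp: vine_def standard_def)
  obtain f where f: "f \<in> carrier thompson_F" "\<forall>t\<in>{0..1}. f t = g t"
    using thompson_of_dpl[OF g(1)] by blast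
  have "aff f (vine M i) (vine M (Suc i)) (q i) (q (Suc i))" if "i \<le> M" for i
  proof (rule aff_cong[OF g(2)[OF that]])
    show "f t = g t" if "vine M i \<le> t" "t \<le> vine M (Suc i)" for t
      using f(2) vine_bounds(1)[of M i] vine_bounds(2)[of M "Suc i"] that by simp
  qed
  thus ?thesis using f(1) unfolding vine_map_def by blast
qed

text \<open>An affine map \<open>2 powi \<kappa> * t + c\<close> sends multiples of \<open>1 / 2 ^ n\<close> to multiples of \<open>2 powi (\<kappa> - n)\<close> as soon as the
latter divides \<open>c\<close>, that is, for all large \<open>n\<close>. Beyond the denominator of the cut no interval of the uniform
partition straddles it.\<close>
lemma standard_intervals:
  assumes "dpl f a b c d" "0 \<le> a"
  shows "\<exists>N. \<forall>n\<ge>N. \<forall>i::nat. a \<le> i / 2 ^ n \<longrightarrow> (real i + 1) / 2 ^ n \<le> b \<longrightarrow>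
    (\<exists>(k::nat) (m::int). aff f (i / 2 ^ n) ((real i + 1) / 2 ^ n) (m / 2 ^ k) ((of_int m + 1) / 2 ^ k))"
proof -
  have "dpl_on f a b" "f a \<in> dyadic_rationals" using assms(1) unfolding dpl_def by simp_all
  hence "f b \<in> dyadic_rationals \<and> (\<exists>N. \<forall>n\<ge>N. \<forall>i::nat. a \<le> i / 2 ^ n \<longrightarrow> (real i + 1) / 2 ^ n \<le> b \<longrightarrow>
    (\<exists>(k::nat) (m::int). aff f (i / 2 ^ n) ((real i + 1) / 2 ^ n) (m / 2 ^ k) ((of_int m + 1) / 2 ^ k)))"
  proof (induction rule: dpl_on_induct)
    case (affine a b \<kappa> c)
    have c: "c = f a - 2 powi \<kappa> * a" using affine by simp
    have cd: "c \<in> dyadic_rationals" unfolding c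
      by (intro dyadic_diff dyadic_mult dyadic_powi affine.hyps(2) affine.prems(1))
    then obtain z s where zs: "c = of_int z / 2 ^ s" unfolding dyadic_rationals_def by blast
    have fb: "f b \<in> dyadic_rationals" using affine.hyps(4)[of b] affine.hyps(1,3) cd by simp
    \<comment> \<open>This bound makes both \<open>n - \<kappa>\<close> and \<open>n - \<kappa> - s\<close> nonnegative.\<close>
    show ?case
    proof (rule conjI[OF fb], rule exI[of _ "nat (int s + \<bar>\<kappa>\<bar>)"], intro allI impI)
      fix n i :: nat
      assume n: "nat (int s + \<bar>\<kappa>\<bar>) \<le> n" and i: "a \<le> i / 2 ^ n" "(real i + 1) / 2 ^ n \<le> b"
      define k where "k = nat (int n - \<kappa>)"
      have k: "int k = int n - \<kappa>" and sk: "s \<le> k" using n by (auto simp: k_def)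
      have p: "(2::real) powi \<kappa> = 2 ^ n / 2 ^ k"
        using k by (simp add: power_int_diff flip: power_int_of_nat)
      define m where "m = int i + z * 2 ^ (k - s)"
      have cz: "c = of_int (z * 2 ^ (k - s)) / 2 ^ k" using sk
      by (simp add: zs power_diff_conv_inverse field_simps)
      have ft: "f t = m / 2 ^ k + 2 ^ n / 2 ^ k * (t - i / 2 ^ n)"
        if "i / 2 ^ n \<le> t" "t \<le> (real i + 1) / 2 ^ n" for t
      proof -
        have "f t = 2 ^ n / 2 ^ k * t + of_int (z * 2 ^ (k - s)) / 2 ^ k"
          using affine.hyps(4)[of t] that i p cz by simp
        thus ?thesis by (simp add: m_def add_divide_distrib right_diff_distrib)
      qed
      show "\<exists>(k::nat) (m::int). aff f (i / 2 ^ n) ((real i + 1) / 2 ^ n) (m / 2 ^ k) ((of_int m + 1) / 2 ^ k)"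
        by (intro exI[of _ k] exI[of _ m] affI[of _ _ "2 ^ n / 2 ^ k"])
           (use ft in \<open>auto simp: field_simps\<close>)
    qed
  next
    case (join a m b)
    obtain z s where zs: "m = of_int z / 2 ^ s" using join.hyps unfolding dyadic_rationals_def by blast
    obtain N where N: "\<And>n i::nat. N \<le> n \<Longrightarrow> a \<le> i / 2 ^ n \<Longrightarrow> (real i + 1) / 2 ^ n \<le> m \<Longrightarrow>
      (\<exists>(k::nat) (m::int). aff f (i / 2 ^ n) ((real i + 1) / 2 ^ n) (m / 2 ^ k) ((of_int m + 1) / 2 ^ k))"
      and fm: "f m \<in> dyadic_rationals"
      using join by blast
    obtain N' where N': "\<And>n i::nat. N' \<le> n \<Longrightarrow> m \<le> i / 2 ^ n \<Longrightarrow> (real i + 1) / 2 ^ n \<le> b \<Longrightarrow>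
      (\<exists>(k::nat) (m::int). aff f (i / 2 ^ n) ((real i + 1) / 2 ^ n) (m / 2 ^ k) ((of_int m + 1) / 2 ^ k))"
      and fb: "f b \<in> dyadic_rationals"
      using join.IH(2)[OF fm] by blast
    show ?case
    proof (rule conjI[OF fb], rule exI[of _ "N + N' + s"], intro allI impI)
      fix n i :: nat
      assume n: "N + N' + s \<le> n" and i: "a \<le> i / 2 ^ n" "(real i + 1) / 2 ^ n \<le> b"
      have m: "m = of_int (z * 2 ^ (n - s)) / 2 ^ n" using n
        by (simp add: zs power_diff_conv_inverse field_simps)
      have "int i + 1 \<le> z * 2 ^ (n - s) \<or> z * 2 ^ (n - s) \<le> int i" by linarith
      hence "real_of_int (int i + 1) \<le> of_int (z * 2 ^ (n - s)) \<or> real_of_int (z * 2 ^ (n - s)) \<le> of_int (int i)"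
        by (simp only: of_int_le_iff)
      hence "(real i + 1) / 2 ^ n \<le> m \<or> m \<le> i / 2 ^ n" unfolding m by (auto intro!: divide_right_mono)
      thus "\<exists>(k::nat) (m::int). aff f (i / 2 ^ n) ((real i + 1) / 2 ^ n) (m / 2 ^ k) ((of_int m + 1) / 2 ^ k)"
        using N[of n i] N'[of n i] n i by auto
    qed
  qed
  thus ?thesis by blast
qed

text \<open>Let \<open>Q\<close> carry the vine to a fine uniform partition. Then \<open>f \<star> Q\<close> carries the vine to the images of the uniform
partition, which are standard intervals as well. So \<open>Q\<close> and \<open>f \<star> Q\<close> are both products of the \<open>x\<^sub>j\<close>.\<close>
lemma thompson_generated:
  assumes gens: "\<And>j. \<exists>g\<in>S. vine_shift (1 / 2 ^ j) g" and S: "subgroup S thompson_F"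
    and f: "f \<in> carrier thompson_F"
  shows "f \<in> S"
proof -
  obtain n where n: "\<And>i::nat. 0 \<le> i / 2 ^ n \<Longrightarrow> (real i + 1) / 2 ^ n \<le> 1 \<Longrightarrow>
    (\<exists>(k::nat) (m::int). aff f (i / 2 ^ n) ((real i + 1) / 2 ^ n) (m / 2 ^ k) ((of_int m + 1) / 2 ^ k))"
    using standard_intervals[OF thompson_dpl[OF f]] by auto
  define M where "M = (2::nat) ^ n - 1"
  have M: "Suc M = 2 ^ n" by (simp add: M_def)
  define q where "q = (\<lambda>i::nat. real i / 2 ^ n)"
  have q01: "q 0 = 0" "q (Suc M) = 1" by (simp_all add: q_def M)
  have "standard M q" unfolding standard_def
  proof (intro conjI allI impI q01)
    show "\<exists>(k::nat) (m::int). q i = m / 2 ^ k \<and> q (Suc i) = (of_int m + 1) / 2 ^ k" for i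
      by (intro exI[of _ n] exI[of _ "int i"]) (simp add: q_def add.commute)
  qed
  then obtain Q where Q: "vine_map M q Q" using vine_map_exists by blast
  have fq: "\<exists>(k::nat) (m::int). aff f (q i) (q (Suc i)) (m / 2 ^ k) ((of_int m + 1) / 2 ^ k)" if "i \<le> M" for i
  proof -
    have "real (Suc i) \<le> real (2 ^ n)" using that M by (simp only: of_nat_le_iff)
    thus ?thesis using n[of i] by (simp add: q_def add.commute)
  qed
  define p where "p = (\<lambda>i. f (q i))"
  have sp: "standard M p" unfolding standard_def
  proof (intro conjI allI impI)
    show "p 0 = 0" "p (Suc M) = 1" using q01 f by (simp_all add: p_def)
    fix i assume "i \<le> M"
    then obtain k :: nat and m :: int where "aff f (q i) (q (Suc i)) (m / 2 ^ k) ((of_int m + 1) / 2 ^ k)"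
      using fq by blast
    from aff_ends(3,4)[OF this]
    show "\<exists>(k::nat) (m::int). p i = m / 2 ^ k \<and> p (Suc i) = (of_int m + 1) / 2 ^ k"
      unfolding p_def by blast
  qed
  have Qc: "Q \<in> carrier thompson_F" using Q by (simp add: vine_map_def)
  have "vine_map M p (f \<star> Q)" unfolding vine_map_def
  proof (intro conjI allI impI)
    fix i assume i: "i \<le> M"
    have fa: "aff f (q i) (q (Suc i)) (p i) (p (Suc i))"
      using fq[OF i] aff_ends unfolding p_def by metis
    have Qa: "aff Q (vine M i) (vine M (Suc i)) (q i) (q (Suc i))"
      using Q i by (simp add: vine_map_def)
    show "aff (f \<star> Q) (vine M i) (vine M (Suc i)) (p i) (p (Suc i))"
    proof (rule aff_comp[OF Qa fa])
      show "(f \<star> Q) t = f (Q t)" if "vine M i \<le> t" "t \<le> vine M (Suc i)" for t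
        using f Qc vine_bounds(1)[of M i] vine_bounds(2)[of M "Suc i"] that by simp
    qed
  qed (use f Qc in simp)
  hence "f \<star> Q \<in> S" using vine_map_generated[OF gens S] sp by blast
  moreover have "Q \<in> S" using vine_map_generated[OF gens S] Q \<open>standard M q\<close> by blast
  ultimately have "f \<star> Q \<star> tinv Q \<in> S" using S by (simp add: subgroup.m_closed subgroup.m_inv_closed)
  thus ?thesis using f Qc by (simp add: F.m_assoc)
qed

lemma thompson_two_generators:
  obtains x y where "x \<in> carrier thompson_F" "y \<in> carrier thompson_F"
    "carrier thompson_F = generate thompson_F {x, y}" "phi x = (1, -1)" "phi y = (0, -1)"
proof -
  obtain x y where xy: "vine_shift 1 x" "vine_shift (1 / 2) y"
    using vine_shift_exists[of 1] vine_shift_exists[of "1 / 2"] by auto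
  have c: "x \<in> carrier thompson_F" "y \<in> carrier thompson_F" using xy by (auto simp: vine_shift_def)
  let ?S = "generate thompson_F {x, y}"
  have S: "subgroup ?S thompson_F" using c by (intro F.generate_is_subgroup) auto
  have mem: "x \<in> ?S" "y \<in> ?S" by (auto intro: generate.incl)
  have "\<exists>g\<in>?S. vine_shift (1 / 2 ^ Suc j) g" for j
  proof (induction j)
    case 0
    show ?case using xy mem by auto
  next
    case (Suc j)
    then obtain g where g: "g \<in> ?S" "vine_shift (1 / 2 ^ Suc j) g" by blast
    have "(1::real) / 2 ^ Suc j \<le> 1 / 2" by (auto simp: field_simps)
    hence "vine_shift (1 / 2 ^ Suc j / 2) (x \<star> g \<star> tinv x)" using xy g by (intro vine_shift_conj) auto
    moreover have "x \<star> g \<star> tinv x \<in> ?S"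
      using S g mem by (simp add: subgroup.m_closed subgroup.m_inv_closed)
    moreover have "(1::real) / 2 ^ Suc j / 2 = 1 / 2 ^ Suc (Suc j)" by simp
    ultimately show ?case by metis
  qed
  hence gens: "\<exists>g\<in>?S. vine_shift (1 / 2 ^ j) g" for j
    using xy(1) mem(1) by (cases j) auto
  have "carrier thompson_F = ?S"
    using thompson_generated[OF gens S] subgroup.subset[OF S] by blast
  moreover have "phi x = (1, -1)"
    using phi_fst_unique[of x "1 / 4" 1] phi_snd_unique[of x "1 / 2" "-1"] xy(1)
    by (auto simp: vine_shift_def prod_eq_iff power_int_minus field_simps)
  moreover have "phi y = (0, -1)"
    using phi_fst_unique[of y "1 / 2" 0] phi_snd_unique[of y "3 / 4" "-1"] xy(2)
    by (auto simp: vine_shift_def prod_eq_iff power_int_minus field_simps)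
  ultimately show ?thesis using that c by blast
qed

section \<open>The kernel of \<open>phi\<close>\<close>

definition ker_phi :: "(real \<Rightarrow> real) set" where
  "ker_phi = {f \<in> carrier thompson_F. phi f = 0}"

lemma ker_phi_carrier: "f \<in> ker_phi \<Longrightarrow> f \<in> carrier thompson_F"
  by (simp add: ker_phi_def)

lemma normal_ker_phi: "ker_phi \<lhd> thompson_F"
  unfolding F.normal_inv_iff
proof (intro conjI ballI)
  show "subgroup ker_phi thompson_F"
  proof (rule F.subgroupI)
    have "\<one>\<^bsub>thompson_F\<^esub> \<in> ker_phi" by (simp add: ker_phi_def)
    thus "ker_phi \<noteq> {}" by blast
  qed (simp_all add: ker_phi_def phi_mult phi_inv subset_iff)
  show "x \<star> h \<star> tinv x \<in> ker_phi" if "x \<in> carrier thompson_F" "h \<in> ker_phi" for x h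
    using that by (simp add: ker_phi_def phi_mult phi_inv)
qed

lemma subgroup_ker_phi: "subgroup ker_phi thompson_F"
  using normal_ker_phi F.normal_inv_iff by blast

text \<open>For a member of the group and \<open>e < 1 / 2\<close>: the support lies in \<open>[e, 1 - e]\<close>.\<close>
definition supported :: "real \<Rightarrow> (real \<Rightarrow> real) \<Rightarrow> bool" where
  "supported e f \<longleftrightarrow> (\<forall>t. 0 \<le> t \<longrightarrow> t \<le> 1 \<longrightarrow> t \<le> e \<or> 1 - e \<le> t \<longrightarrow> f t = t)"

lemma supportedD: "supported e f \<Longrightarrow> 0 \<le> t \<Longrightarrow> t \<le> 1 \<Longrightarrow> t \<le> e \<or> 1 - e \<le> t \<Longrightarrow> f t = t"
  unfolding supported_def by blast

lemma supported_mono: "supported e f \<Longrightarrow> d \<le> e \<Longrightarrow> supported d f"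
  by (auto simp: supported_def)

lemma ker_phiI:
  assumes "f \<in> carrier thompson_F" "0 < e" "supported e f" shows "f \<in> ker_phi"
proof -
  have "f t = 2 powi 0 * t" if "0 \<le> t" "t \<le> min e 1" for t
    using supportedD[OF assms(3), of t] that by simp
  hence "fst (phi f) = 0" using assms by (intro phi_fst_unique[of f "min e 1"]) auto
  moreover have "f t = 1 - 2 powi 0 * (1 - t)" if "max 0 (1 - e) \<le> t" "t \<le> 1" for t
    using supportedD[OF assms(3), of t] that by simp
  hence "snd (phi f) = 0" using assms by (intro phi_snd_unique[of f "max 0 (1 - e)"]) auto
  ultimately show ?thesis using assms by (simp add: ker_phi_def prod_eq_iff)
qed

lemma ker_phi_supported:
  assumes "f \<in> ker_phi" shows "\<exists>e>0. supported e f"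
proof -
  have f: "f \<in> carrier thompson_F" "phi f = 0" using assms by (auto simp: ker_phi_def)
  obtain a where a: "0 < a" "\<And>t. 0 \<le> t \<Longrightarrow> t \<le> a \<Longrightarrow> f t = t"
    using germ_0[OF f(1)] f(2) by auto
  obtain b where b: "b < 1" "\<And>t. b \<le> t \<Longrightarrow> t \<le> 1 \<Longrightarrow> f t = t"
    using germ_1[OF f(1)] f(2) by auto
  have "supported (min a (1 - b)) f" unfolding supported_def using a(2) b(2) by simp
  moreover have "0 < min a (1 - b)" using a(1) b(1) by simp
  ultimately show ?thesis by blast
qed

lemma finite_supported:
  assumes "finite A" "A \<subseteq> ker_phi"
  shows "\<exists>e>0. e < 1 / 4 \<and> e \<in> dyadic_rationals \<and> (\<forall>f\<in>A. supported e f)"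
  using assms
proof (induction A rule: finite_induct)
  case empty
  show ?case by (intro exI[of _ "1 / 8"]) auto
next
  case (insert f A)
  then obtain e where e: "0 < e" "e < 1 / 4" "\<forall>f\<in>A. supported e f" by auto
  obtain d where d: "0 < d" "supported d f" using ker_phi_supported[of f] insert.prems by auto
  obtain c where "0 < c" "c < min d e" "c \<in> dyadic_rationals"
    using exists_small_dyadic[of "min d e"] d e by auto
  thus ?case using d e by (intro exI[of _ c]) (auto intro: supported_mono)
qed

section \<open>The kernel of \<open>phi\<close> is perfect\<close>

text \<open>On a compact part of \<open>(0,1)\<close> every element is imitated by one in the kernel: keep \<open>f\<close> there and interpolate
to the identity near the ends.\<close>
lemma ker_phi_agrees_inside:
  assumes f: "f \<in> carrier thompson_F" and e: "0 < e" "e < 1 / 4" "e \<in> dyadic_rationals"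
  shows "\<exists>g\<in>ker_phi. \<forall>t. e \<le> t \<longrightarrow> t \<le> 1 - e \<longrightarrow> g t = f t"
proof -
  have fe: "0 < f e" "f e < f (1 - e)" "f (1 - e) < 1"
    using thompson_less[OF f, of 0 e] thompson_less[OF f, of e "1 - e"] thompson_less[OF f, of "1 - e" 1]
      e(1,2) thompson_ends[OF f] by simp_all
  have fd: "f e \<in> dyadic_rationals" "f (1 - e) \<in> dyadic_rationals"
    using thompson_dyadic[OF f] e by auto
  obtain d where d: "0 < d" "d < min e (min (f e) (1 - f (1 - e)))" "d \<in> dyadic_rationals"
    using exists_small_dyadic[of "min e (min (f e) (1 - f (1 - e)))"] e fe by auto
  have 1: "dpl (\<lambda>t. t) 0 d 0 d" by (rule dpl_affine[of _ _ _ _ 0]) (use d in auto)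
  obtain h where h: "dpl h d e d (f e)" using dpl_exists[of d e d "f e"] d e fd by auto
  have 3: "dpl f e (1 - e) (f e) (f (1 - e))"
    using e by (intro dpl_subinterval[OF thompson_dpl[OF f]] dyadic_diff dyadic_1) simp_all
  obtain k where k: "dpl k (1 - e) (1 - d) (f (1 - e)) (1 - d)"
    using dpl_exists[of "1 - e" "1 - d" "f (1 - e)" "1 - d"] d e fd by auto
  have 5: "dpl (\<lambda>t. t) (1 - d) 1 (1 - d) 1" by (rule dpl_affine[of _ _ _ _ 0]) (use d in auto)
  obtain g where g: "g \<in> carrier thompson_F" "\<And>t. 0 \<le> t \<Longrightarrow> t \<le> 1 \<Longrightarrow> g t =
     (if t \<le> 1 - d then if t \<le> 1 - e then if t \<le> e then if t \<le> d then t else h t else f t else k t else t)"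
    using thompson_of_dpl[OF dpl_glue[OF dpl_glue[OF dpl_glue[OF dpl_glue[OF 1 h] 3] k] 5]] by auto
  have "g t = f t" if "e \<le> t" "t \<le> 1 - e" for t
  proof (cases "t = e")
    case True
    thus ?thesis using g(2)[of t] dplD(8)[OF h] d e by simp
  next
    case False
    thus ?thesis using g(2)[of t] that e d by simp
  qed
  moreover have "supported d g"
    unfolding supported_def
  proof (intro allI impI)
    fix t :: real assume t: "0 \<le> t" "t \<le> 1" "t \<le> d \<or> 1 - d \<le> t"
    show "g t = t"
    proof (cases "t = 1 - d")
      case True
      thus ?thesis using g(2)[of t] dplD(8)[OF k] d e by simp
    next
      case False
      thus ?thesis using g(2)[of t] t e d by auto
    qed
  qed
  ultimately show ?thesis using ker_phiI[OF g(1) d(1)] by blast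
qed

lemma exists_mapping_point:
  assumes "0 < p" "p < 1" "0 < q" "q < 1" "p \<in> dyadic_rationals" "q \<in> dyadic_rationals"
  shows "\<exists>g\<in>carrier thompson_F. g p = q"
proof -
  obtain h k where h: "dpl h 0 p 0 q" and k: "dpl k p 1 q 1"
    using dpl_exists[of 0 p 0 q] dpl_exists[of p 1 q 1] assms by auto
  obtain g where "g \<in> carrier thompson_F" "\<And>t. 0 \<le> t \<Longrightarrow> t \<le> 1 \<Longrightarrow> g t = (if t \<le> p then h t else k t)"
    using thompson_of_dpl[OF dpl_glue[OF h k]] by auto
  moreover from this have "g p = q" using dplD(8)[OF h] assms(1,2) by simp
  ultimately show ?thesis by blast
qed

abbreviation tconj where "tconj g x \<equiv> g \<star> x \<star> tinv g"

text \<open>A conjugate \<open>f k f\<inverse>\<close> depends only on the values of \<open>f\<close> on the support of \<open>k\<close>.\<close>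
lemma tconj_cong:
  assumes "f \<in> carrier thompson_F" "g \<in> carrier thompson_F" "k \<in> carrier thompson_F"
    "supported e k" "0 < e" "e < 1 / 4" "\<And>t. e \<le> t \<Longrightarrow> t \<le> 1 - e \<Longrightarrow> g t = f t"
  shows "tconj f k = tconj g k"
proof -
  have "f \<star> k = (g \<star> k \<star> tinv g) \<star> f"
  proof (rule thompson_ext)
    fix t :: real assume t: "0 \<le> t" "t \<le> 1"
    show "(f \<star> k) t = (tconj g k \<star> f) t"
    proof (cases "t \<le> e \<or> 1 - e \<le> t")
      case True
      hence kt: "k t = t" using supportedD[OF assms(4)] t by blast
      have mid: "g e = f e" "g (1 - e) = f (1 - e)" using assms(5-7) by auto
      have "tinv g (f t) \<le> e \<or> 1 - e \<le> tinv g (f t)"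
      proof (rule ccontr)
        assume "\<not> ?thesis"
        hence *: "e < tinv g (f t)" "tinv g (f t) < 1 - e" by auto
        hence "f e < f t" "f t < f (1 - e)"
          using thompson_less[of g e "tinv g (f t)"] thompson_less[of g "tinv g (f t)" "1 - e"] assms t mid by auto
        thus False using True thompson_less_iff(1)[of f e t] thompson_less_iff(1)[of f t "1 - e"] assms t by auto
      qed
      hence "k (tinv g (f t)) = tinv g (f t)" using supportedD[OF assms(4)] assms t by simp
      thus ?thesis using kt assms t by simp
    next
      case False
      have k01: "k e = e" "k (1 - e) = 1 - e" using supportedD[OF assms(4)] assms by auto
      have "e \<le> k t" "k t \<le> 1 - e"
        using thompson_less_iff(2)[of k e t] thompson_less_iff(2)[of k t "1 - e"] k01 False assms t by auto
      moreover have "tinv g (f t) = t" using assms(7)[of t] False assms(2) t by (intro thompson_inv_eq) auto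
      ultimately show ?thesis using assms t False by simp
    qed
  qed (use assms in auto)
  hence "f \<star> k \<star> tinv f = tconj g k \<star> f \<star> tinv f" by simp
  thus ?thesis using assms by (simp add: F.m_assoc)
qed

lemma phi_nat_pow: "f \<in> carrier thompson_F \<Longrightarrow>
    phi (f [^]\<^bsub>thompson_F\<^esub> (n::nat)) = (int n * fst (phi f), int n * snd (phi f))"
  by (induction n) (auto simp: phi_mult prod_eq_iff algebra_simps)

lemma phi_int_pow: "f \<in> carrier thompson_F \<Longrightarrow>
    phi (f [^]\<^bsub>thompson_F\<^esub> (i::int)) = (i * fst (phi f), i * snd (phi f))"
  by (cases i rule: int_cases2) (simp_all add: F.int_pow_neg int_pow_int phi_nat_pow phi_inv)

lemma commuting_germs:
  "\<exists>u\<in>carrier thompson_F. \<exists>v\<in>carrier thompson_F. phi u = (1, 0) \<and> phi v = (0, 1) \<and> u \<star> v = v \<star> u"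
proof -
  \<comment> \<open>One element is the identity on the right half, the other one on the left half.\<close>
  have "(2::real) powi 1 * (1 / 8) < 1 - 2 powi 0 * (1 - 1 / 2)" by simp
  from exists_with_germs[OF _ _ _ _ _ this]
  obtain u where u: "u \<in> carrier thompson_F" "phi u = (1, 0)"
     "\<forall>t. 1 / 2 \<le> t \<longrightarrow> t \<le> 1 \<longrightarrow> u t = 1 - 2 powi 0 * (1 - t)" by force
  have "(2::real) powi 0 * (1 / 2) < 1 - 2 powi 1 * (1 - 7 / 8)" by simp
  from exists_with_germs[OF _ _ _ _ _ this]
  obtain v where v: "v \<in> carrier thompson_F" "phi v = (0, 1)"
     "\<forall>t. 0 \<le> t \<longrightarrow> t \<le> 1 / 2 \<longrightarrow> v t = 2 powi 0 * t"
    using dyadic_quarter(2)[of 7] by force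
  have "u t = t \<or> v t = t" if t: "0 \<le> t" "t \<le> 1" for t
  proof (cases "t \<le> 1 / 2")
    case True
    thus ?thesis using spec[OF v(3), of t] t by simp
  next
    case False
    thus ?thesis using spec[OF u(3), of t] t by simp
  qed
  hence "u \<star> v = v \<star> u" by (rule disjoint_commute[OF u(1) v(1)])
  thus ?thesis using u(1,2) v(1,2) by blast
qed

lemma mem_if_contains_ker_phi:
  assumes S: "subgroup S thompson_F" and "ker_phi \<subseteq> S" "u \<in> S" "v \<in> S" "phi u = (1, 0)" "phi v = (0, 1)"
    and f: "f \<in> carrier thompson_F"
  shows "f \<in> S"
proof -
  define w where "w = u [^]\<^bsub>thompson_F\<^esub> (fst (phi f)) \<star> v [^]\<^bsub>thompson_F\<^esub> (snd (phi f))"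
  have uv: "u \<in> carrier thompson_F" "v \<in> carrier thompson_F" using subgroup.mem_carrier[OF S] assms(3,4) by blast+
  have "u [^]\<^bsub>thompson_F\<^esub> (fst (phi f)) \<in> S" "v [^]\<^bsub>thompson_F\<^esub> (snd (phi f)) \<in> S"
    using F.subgroup_int_pow_closed[OF S] assms(3,4) by blast+
  hence w: "w \<in> S" unfolding w_def by (rule subgroup.m_closed[OF S])
  hence wc: "w \<in> carrier thompson_F" by (rule subgroup.mem_carrier[OF S])
  have "phi w = phi f" using uv assms by (simp add: w_def phi_mult phi_int_pow prod_eq_iff)
  hence "f \<star> tinv w \<in> ker_phi" using f wc by (simp add: ker_phi_def phi_mult phi_inv)
  hence "f \<star> tinv w \<star> w \<in> S" using assms(2) w subgroup.m_closed[OF S] by blast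
  thus ?thesis using f wc by (simp add: F.m_assoc)
qed

lemma (in group) inv_comm_commute:
  assumes "a \<in> carrier G" "b \<in> carrier G" "a \<otimes> b = b \<otimes> a"
  shows "inv a \<otimes> b = b \<otimes> inv a"
proof -
  have "inv a \<otimes> b \<otimes> a = inv a \<otimes> (a \<otimes> b)" using m_assoc[of "inv a" b a] assms(1,2)
    by (simp only: assms(3) inv_closed)
  also have "\<dots> = b" using assms(1,2) by (simp flip: m_assoc)
  finally show ?thesis using inv_solve_right[of "inv a \<otimes> b" b a] assms(1,2) by simp
qed

lemma (in group) inv_mult_cancel [simp]:
  assumes "a \<in> carrier G" "b \<in> carrier G" shows "inv a \<otimes> (a \<otimes> b) = b" "a \<otimes> (inv a \<otimes> b) = b"
  using assms by (simp_all flip: m_assoc)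

lemma (in group) subgroup_commuting:
  assumes "group_hom G Q p" "a \<in> carrier Q"
  shows "subgroup {f \<in> carrier G. p f \<otimes>\<^bsub>Q\<^esub> a = a \<otimes>\<^bsub>Q\<^esub> p f} G"
proof -
  interpret p: group_hom G Q p by (rule assms(1))
  let ?C = "{f \<in> carrier G. p f \<otimes>\<^bsub>Q\<^esub> a = a \<otimes>\<^bsub>Q\<^esub> p f}"
  show ?thesis
  proof (rule subgroupI)
    have "\<one> \<in> ?C" using assms(2) by simp
    thus "?C \<noteq> {}" by blast
    show "inv f \<in> ?C" if "f \<in> ?C" for f
      using that assms(2) p.H.inv_comm_commute[of "p f" a] by simp
    show "f \<otimes> h \<in> ?C" if "f \<in> ?C" "h \<in> ?C" for f h
    proof -
      have fh: "f \<in> carrier G" "h \<in> carrier G" "p f \<otimes>\<^bsub>Q\<^esub> a = a \<otimes>\<^bsub>Q\<^esub> p f"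
        "p h \<otimes>\<^bsub>Q\<^esub> a = a \<otimes>\<^bsub>Q\<^esub> p h" using that by auto
      have "p f \<otimes>\<^bsub>Q\<^esub> p h \<otimes>\<^bsub>Q\<^esub> a = p f \<otimes>\<^bsub>Q\<^esub> (a \<otimes>\<^bsub>Q\<^esub> p h)"
        using fh assms(2) by (simp add: p.H.m_assoc)
      also have "\<dots> = a \<otimes>\<^bsub>Q\<^esub> p f \<otimes>\<^bsub>Q\<^esub> p h"
        using fh assms(2) by (simp flip: p.H.m_assoc)
      finally show ?thesis using fh assms(2) by (simp add: p.H.m_assoc)
    qed
  qed auto
qed

text \<open>If the image of the kernel is commutative, it is central in the whole image, since \<open>f\<close> conjugates \<open>k\<close> in the same
way as some element of the kernel does. The images of the commuting elements \<open>u\<close>, \<open>v\<close> then commute with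
everything, as \<open>u\<close>, \<open>v\<close> and the kernel generate the group.\<close>
lemma hom_image_commutative:
  assumes hom: "group_hom thompson_F Q p"
    and K: "\<And>k l. k \<in> ker_phi \<Longrightarrow> l \<in> ker_phi \<Longrightarrow> p k \<otimes>\<^bsub>Q\<^esub> p l = p l \<otimes>\<^bsub>Q\<^esub> p k"
    and "f \<in> carrier thompson_F" "g \<in> carrier thompson_F"
  shows "p f \<otimes>\<^bsub>Q\<^esub> p g = p g \<otimes>\<^bsub>Q\<^esub> p f"
proof -
  interpret p: group_hom thompson_F Q p by (rule hom)
  define C where "C = (\<lambda>g. {f \<in> carrier thompson_F. p f \<otimes>\<^bsub>Q\<^esub> p g = p g \<otimes>\<^bsub>Q\<^esub> p f})"
  have C_sub: "subgroup (C g) thompson_F" if "g \<in> carrier thompson_F" for g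
    unfolding C_def by (intro F.subgroup_commuting hom p.hom_closed that)
  have C_sym: "f \<in> C g \<Longrightarrow> g \<in> carrier thompson_F \<Longrightarrow> g \<in> C f" for f g
    unfolding C_def by simp
  have K_cent: "k \<in> C f" if f: "f \<in> carrier thompson_F" and k: "k \<in> ker_phi" for f k
  proof -
    obtain e where e: "0 < e" "e < 1 / 4" "e \<in> dyadic_rationals" "supported e k"
      using finite_supported[of "{k}"] k by auto
    obtain g where g: "g \<in> ker_phi" "\<And>t. e \<le> t \<Longrightarrow> t \<le> 1 - e \<Longrightarrow> g t = f t"
      using ker_phi_agrees_inside[OF f e(1-3)] by blast
    have c: "g \<in> carrier thompson_F" "k \<in> carrier thompson_F"
      using g k by (auto dest: ker_phi_carrier)
    have "tconj f k = tconj g k" by (rule tconj_cong[OF f c e(4,1,2) g(2)])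
    hence "p f \<otimes>\<^bsub>Q\<^esub> p k \<otimes>\<^bsub>Q\<^esub> inv\<^bsub>Q\<^esub> p f = p g \<otimes>\<^bsub>Q\<^esub> p k \<otimes>\<^bsub>Q\<^esub> inv\<^bsub>Q\<^esub> p g"
      using f c by (simp flip: p.hom_mult p.hom_inv)
    also have "\<dots> = p k" using K[OF g(1) k] c by (simp add: p.H.m_assoc)
    finally have "p f \<otimes>\<^bsub>Q\<^esub> p k = p k \<otimes>\<^bsub>Q\<^esub> p f"
      using p.H.inv_solve_right'[of "p k" "p f \<otimes>\<^bsub>Q\<^esub> p k" "p f"] f c by simp
    thus ?thesis unfolding C_def using c(2) by simp
  qed
  obtain u v where uv: "u \<in> carrier thompson_F" "v \<in> carrier thompson_F" "phi u = (1, 0)" "phi v = (0, 1)"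
     "u \<star> v = v \<star> u" using commuting_germs by blast
  have "p u \<otimes>\<^bsub>Q\<^esub> p v = p v \<otimes>\<^bsub>Q\<^esub> p u"
    using p.hom_mult[OF uv(1,2)] p.hom_mult[OF uv(2,1)] uv(5) by simp
  hence mem: "v \<in> C u" "u \<in> C v" "u \<in> C u" "v \<in> C v" unfolding C_def using uv(1,2) by simp_all
  have KC: "ker_phi \<subseteq> C g" if "g \<in> carrier thompson_F" for g using K_cent[OF that] by blast
  have all: "h \<in> C u" "h \<in> C v" if h: "h \<in> carrier thompson_F" for h
    using mem_if_contains_ker_phi[OF C_sub[OF uv(1)] KC[OF uv(1)] mem(3,1) uv(3,4) h]
      mem_if_contains_ker_phi[OF C_sub[OF uv(2)] KC[OF uv(2)] mem(2,4) uv(3,4) h] by blast+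
  have "f \<in> C g"
    using mem_if_contains_ker_phi[OF C_sub[OF assms(4)] KC[OF assms(4)] C_sym[OF all(1)[OF assms(4)] uv(1)]
       C_sym[OF all(2)[OF assms(4)] uv(2)] uv(3,4) assms(3)] .
  thus ?thesis unfolding C_def by simp
qed

text \<open>On the two generators, and hence everywhere, \<open>p\<close> agrees with a homomorphism that factors through \<open>phi\<close>: if
\<open>phi f = (s, t)\<close> then \<open>f\<close> has exponent sum \<open>s\<close> in \<open>x\<close> and \<open>- s - t\<close> in \<open>y\<close>.\<close>
lemma abelian_hom_trivial_on_ker_phi:
  assumes hom: "group_hom thompson_F Q p" and "comm_group Q" and f: "f \<in> ker_phi"
  shows "p f = \<one>\<^bsub>Q\<^esub>"
proof -
  interpret Q: comm_group Q by (rule assms(2))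
  interpret p: group_hom thompson_F Q p by (rule hom)
  obtain x y where xy: "x \<in> carrier thompson_F" "y \<in> carrier thompson_F"
    "carrier thompson_F = generate thompson_F {x, y}" "phi x = (1, -1)" "phi y = (0, -1)"
    using thompson_two_generators by blast
  define E where "E = (\<lambda>w::int \<times> int. p x [^]\<^bsub>Q\<^esub> fst w \<otimes>\<^bsub>Q\<^esub> p y [^]\<^bsub>Q\<^esub> (- fst w - snd w))"
  have pxy: "p x \<in> carrier Q" "p y \<in> carrier Q" using xy(1,2) by auto
  have Ec: "E w \<in> carrier Q" for w
    unfolding E_def by (intro Q.m_closed Q.int_pow_closed pxy)
  have E_add: "E (v + w) = E v \<otimes>\<^bsub>Q\<^esub> E w" for v w
  proof -
    have *: "- fst (v + w) - snd (v + w) = (- fst v - snd v) + (- fst w - snd w)" by (simp add: algebra_simps)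
    have "E (v + w) = (p x [^]\<^bsub>Q\<^esub> fst v \<otimes>\<^bsub>Q\<^esub> p x [^]\<^bsub>Q\<^esub> fst w) \<otimes>\<^bsub>Q\<^esub>
      (p y [^]\<^bsub>Q\<^esub> (- fst v - snd v) \<otimes>\<^bsub>Q\<^esub> p y [^]\<^bsub>Q\<^esub> (- fst w - snd w))"
      unfolding E_def * by (simp only: fst_add Q.int_pow_mult[OF pxy(1)] Q.int_pow_mult[OF pxy(2)])
    thus ?thesis using pxy by (simp add: E_def Q.m_ac)
  qed
  have E0: "E 0 = \<one>\<^bsub>Q\<^esub>" using pxy by (simp add: E_def)
  have gen_E: "p z = E (phi z)" if "z \<in> {x, y}" for z
    using that xy(4,5) pxy by (auto simp: E_def)
  have "p f = E (phi f)" if "f \<in> generate thompson_F {x, y}" for f using that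
  proof (induction rule: generate.induct)
    case one
    show ?case by (simp only: p.hom_one phi_one E0)
  next
    case (incl h)
    thus ?case by (rule gen_E)
  next
    case (inv h)
    hence h: "h \<in> carrier thompson_F" using xy(1,2) by blast
    have "E (phi (tinv h)) \<otimes>\<^bsub>Q\<^esub> E (phi h) = \<one>\<^bsub>Q\<^esub>"
      by (simp only: E_add[symmetric] phi_inv[OF h] E0 ab_left_minus)
    hence "E (phi (tinv h)) = inv\<^bsub>Q\<^esub> E (phi h)" using Ec Q.inv_equality by metis
    thus ?case using gen_E[OF inv] p.hom_inv[OF h] by simp
  next
    case (eng g h)
    hence "g \<in> carrier thompson_F" "h \<in> carrier thompson_F" using xy(3) by blast+
    thus ?case using eng by (simp add: phi_mult E_add)
  qed
  hence "p f = E (phi f)" using ker_phi_carrier[OF f] xy(3) by blast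
  thus ?thesis using f E0 by (simp add: ker_phi_def)
qed

lemma (in normal) commutator_mem_iff:
  assumes "x \<in> carrier G" "y \<in> carrier G"
  shows "x \<otimes> y \<otimes> inv x \<otimes> inv y \<in> H \<longleftrightarrow>
    (H #> x) \<otimes>\<^bsub>G Mod H\<^esub> (H #> y) = (H #> y) \<otimes>\<^bsub>G Mod H\<^esub> (H #> x)"
proof -
  have e: "x \<otimes> y \<otimes> inv x \<otimes> inv y = (x \<otimes> y) \<otimes> inv (y \<otimes> x)"
    using assms by (simp add: inv_mult_group m_assoc)
  have "(x \<otimes> y) \<otimes> inv (y \<otimes> x) \<in> H \<longleftrightarrow> H #> (x \<otimes> y) = H #> (y \<otimes> x)"
  proof
    assume "(x \<otimes> y) \<otimes> inv (y \<otimes> x) \<in> H"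
    hence "H #> ((x \<otimes> y) \<otimes> inv (y \<otimes> x)) = H" using assms coset_join2 subgroup_axioms by simp
    thus "H #> (x \<otimes> y) = H #> (y \<otimes> x)" using assms coset_mult_inv1[of H "x \<otimes> y" "y \<otimes> x"] subset by simp
  next
    assume "H #> (x \<otimes> y) = H #> (y \<otimes> x)"
    hence "H #> ((x \<otimes> y) \<otimes> inv (y \<otimes> x)) = H" using assms coset_mult_inv2[of H "x \<otimes> y" "y \<otimes> x"] subset by simp
    thus "(x \<otimes> y) \<otimes> inv (y \<otimes> x) \<in> H" using assms coset_join1 subgroup_axioms by blast
  qed
  thus ?thesis using assms by (simp add: e rcos_sum FactGroup_def)
qed

text \<open>In the quotient by \<open>D\<close> the image of the kernel is commutative, hence so is the whole quotient.\<close>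
lemma derived_subset_if_kernel_commutes:
  assumes D: "D \<lhd> thompson_F" and K: "derived thompson_F ker_phi \<subseteq> D"
  shows "derived thompson_F (carrier thompson_F) \<subseteq> D"
proof -
  interpret D: normal D thompson_F by (rule D)
  interpret Q: group "thompson_F Mod D" by (rule D.factorgroup_is_group)
  have hom: "group_hom thompson_F (thompson_F Mod D) ((#>\<^bsub>thompson_F\<^esub>) D)"
    by unfold_locales (rule D.r_coset_hom_Mod)
  have "k \<star> l \<star> tinv k \<star> tinv l \<in> D" if "k \<in> ker_phi" "l \<in> ker_phi" for k l
    using that K unfolding derived_def by (blast intro: generate.incl)
  hence "f \<star> g \<star> tinv f \<star> tinv g \<in> D" if "f \<in> carrier thompson_F" "g \<in> carrier thompson_F" for f g
    using hom_image_commutative[OF hom _ that] D.commutator_mem_iff that ker_phi_carrier by metis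
  hence "derived_set thompson_F (carrier thompson_F) \<subseteq> D" by blast
  thus ?thesis unfolding derived_def by (rule F.generate_subgroup_incl[OF _ D.subgroup_axioms])
qed

lemma ker_phi_derived_F: "ker_phi \<subseteq> derived thompson_F (carrier thompson_F)"
proof
  fix f assume f: "f \<in> ker_phi"
  let ?D = "derived thompson_F (carrier thompson_F)"
  have "carrier thompson_F \<lhd> thompson_F" by (rule F.normal_invI[OF F.subgroup_self]) auto
  hence "?D \<lhd> thompson_F" by (rule F.derived_is_normal)
  then interpret D: normal ?D thompson_F .
  interpret Q: group "thompson_F Mod ?D" by (rule D.factorgroup_is_group)
  have hom: "group_hom thompson_F (thompson_F Mod ?D) ((#>\<^bsub>thompson_F\<^esub>) ?D)"
    by unfold_locales (rule D.r_coset_hom_Mod)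
  have "?D #>\<^bsub>thompson_F\<^esub> f = ?D"
    using abelian_hom_trivial_on_ker_phi[OF hom F.derived_quot_is_comm_group f] by (simp add: FactGroup_def)
  thus "f \<in> ?D" by (rule F.coset_join1[OF _ ker_phi_carrier[OF f] D.subgroup_axioms])
qed

lemma ker_phi_perfect: "derived thompson_F ker_phi = ker_phi"
proof
  show "derived thompson_F ker_phi \<subseteq> ker_phi"
    by (rule F.derived_incl[OF subset_refl subgroup_ker_phi])
  show "ker_phi \<subseteq> derived thompson_F ker_phi"
    using ker_phi_derived_F derived_subset_if_kernel_commutes[OF F.derived_is_normal[OF normal_ker_phi]] by blast
qed

section \<open>Subgroups of finite index\<close>

text \<open>The normal core as the kernel of the action \<open>\<rho>\<close> on the finite set of cosets; finiteness of its index is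
recorded as finiteness of the range of \<open>\<rho>\<close>.\<close>
lemma (in group) finite_index_core:
  assumes H: "subgroup H G" and fin: "finite (rcosets H)"
  obtains N \<rho> where "N \<lhd> G" "N \<subseteq> H" "finite (\<rho> ` carrier G)"
    "\<And>g h. g \<in> carrier G \<Longrightarrow> h \<in> carrier G \<Longrightarrow> \<rho> g = (\<rho> h :: 'a set \<Rightarrow> 'a set) \<Longrightarrow> g \<otimes> inv h \<in> N"
proof -
  define \<rho> where "\<rho> = (\<lambda>g. \<lambda>C\<in>rcosets H. C #> g)"
  define N where "N = {g \<in> carrier G. \<forall>C\<in>rcosets H. C #> g = C}"
  have HG: "H \<subseteq> carrier G" using H by (rule subgroup.subset)
  have CG: "C \<subseteq> carrier G" if "C \<in> rcosets H" for C
    using rcosets_part_G[OF H] that by blast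
  have step: "C #> g \<in> rcosets H" if C: "C \<in> rcosets H" and g: "g \<in> carrier G" for C g
  proof -
    obtain a where a: "a \<in> carrier G" "C = H #> a" using C unfolding RCOSETS_def by auto
    hence "C #> g = H #> (a \<otimes> g)" using HG g by (simp add: coset_mult_assoc)
    thus ?thesis unfolding RCOSETS_def using a g by blast
  qed
  have "\<rho> ` carrier G \<subseteq> rcosets H \<rightarrow>\<^sub>E rcosets H" unfolding \<rho>_def using step by auto
  hence "finite (\<rho> ` carrier G)" using finite_PiE[OF fin, of "\<lambda>_. rcosets H"] fin finite_subset by blast
  moreover have "g \<otimes> inv h \<in> N" if gh: "g \<in> carrier G" "h \<in> carrier G" and eq: "\<rho> g = \<rho> h" for g h
  proof -
    have "C #> (g \<otimes> inv h) = C" if C: "C \<in> rcosets H" for C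
    proof (rule coset_mult_inv2[OF _ gh CG[OF C]])
      show "C #> g = C #> h" using fun_cong[OF eq, of C] C by (simp add: \<rho>_def)
    qed
    thus ?thesis using gh by (simp add: N_def)
  qed
  moreover have "N \<subseteq> H"
  proof
    fix g assume "g \<in> N"
    moreover have "H \<in> rcosets H" unfolding RCOSETS_def using coset_mult_one[OF HG] one_closed by blast
    ultimately have "g \<in> carrier G" "H #> g = H" by (simp_all add: N_def)
    thus "g \<in> H" using coset_join1 H by blast
  qed
  moreover have "N \<lhd> G"
  proof (rule normal_invI)
    show "subgroup N G"
    proof (rule subgroupI)
      have "\<one> \<in> N" using CG by (simp add: N_def)
      thus "N \<noteq> {}" by blast
      show "inv g \<in> N" if "g \<in> N" for g
      proof -
        have g: "g \<in> carrier G" using that by (simp add: N_def)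
        have "C #> inv g = C" if C: "C \<in> rcosets H" for C
        proof -
          have "C #> inv g = (C #> g) #> inv g" using \<open>g \<in> N\<close> C by (simp add: N_def)
          thus ?thesis using g CG[OF C] by (simp add: coset_mult_assoc)
        qed
        thus ?thesis using g by (simp add: N_def)
      qed
      show "g \<otimes> h \<in> N" if "g \<in> N" "h \<in> N" for g h
      proof -
        have gh: "g \<in> carrier G" "h \<in> carrier G" using that by (auto simp: N_def)
        have "C #> (g \<otimes> h) = C" if C: "C \<in> rcosets H" for C
          using coset_mult_assoc[OF CG[OF C] gh] \<open>g \<in> N\<close> \<open>h \<in> N\<close> C by (simp add: N_def)
        thus ?thesis using gh by (simp add: N_def)
      qed
    qed (auto simp: N_def)
    show "x \<otimes> g \<otimes> inv x \<in> N" if x: "x \<in> carrier G" and gN: "g \<in> N" for x g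
    proof -
      have g: "g \<in> carrier G" using gN by (simp add: N_def)
      have "C #> (x \<otimes> g \<otimes> inv x) = C" if C: "C \<in> rcosets H" for C
      proof -
        have "C #> (x \<otimes> g \<otimes> inv x) = ((C #> x) #> g) #> inv x"
          using x g CG[OF C] by (simp add: coset_mult_assoc m_assoc)
        also have "(C #> x) #> g = C #> x" using gN step[OF C x] by (simp add: N_def)
        finally show ?thesis using x CG[OF C] by (simp add: coset_mult_assoc)
      qed
      thus ?thesis using x g by (simp add: N_def)
    qed
  qed
  ultimately show ?thesis using that by blast
qed

lemma thompson_pow:
  "h \<in> carrier thompson_F \<Longrightarrow> 0 \<le> t \<Longrightarrow> t \<le> 1 \<Longrightarrow> (h [^]\<^bsub>thompson_F\<^esub> (n::nat)) t = (h ^^ n) t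
     \<and> 0 \<le> (h ^^ n) t \<and> (h ^^ n) t \<le> 1"
proof (induction n arbitrary: t)
  case (Suc n)
  thus ?case using Suc.IH[of "h t"] by (simp add: funpow_swap1)
qed simp

lemma pushing_pow:
  assumes g: "g \<in> carrier thompson_F" and e: "0 < e" "e < 1 / 4" "g e = 1 - e"
  shows "1 - e \<le> (g ^^ Suc n) e"
proof (induction n)
  case (Suc n)
  have b: "0 \<le> (g ^^ Suc n) e" "(g ^^ Suc n) e \<le> 1"
    using thompson_pow[OF g, of e "Suc n"] e(1,2) by auto
  have "e \<le> (g ^^ Suc n) e" using Suc e(1,2) by linarith
  hence "g e \<le> g ((g ^^ Suc n) e)" using thompson_less_iff(2)[OF g, of e "(g ^^ Suc n) e"] b e(1,2) by simp
  thus ?case using e(3) by simp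
qed (use e in simp)

text \<open>Modulo \<open>N\<close> the element \<open>f\<close> equals \<open>c\<close>, which commutes with \<open>u\<close>.\<close>
lemma (in group) commutator_trick:
  assumes N: "N \<lhd> G" and c: "f \<in> carrier G" "u \<in> carrier G" "c \<in> carrier G"
    and "f \<otimes> inv c \<in> N" "c \<otimes> u = u \<otimes> c"
  shows "f \<otimes> u \<otimes> inv f \<otimes> inv u \<in> N"
proof -
  define n where "n = f \<otimes> inv c"
  interpret N: normal N G by (rule N)
  have n: "n \<in> N" "n \<in> carrier G" using assms by (auto simp: n_def)
  have f: "f = n \<otimes> c" using c by (simp add: n_def m_assoc)
  have "c \<otimes> u \<otimes> inv c = u" using assms(6) c by (simp add: m_assoc)
  hence "n \<otimes> (c \<otimes> u \<otimes> inv c) \<otimes> inv n \<otimes> inv u = n \<otimes> (u \<otimes> inv n \<otimes> inv u)"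
    using n(2) c by (simp add: m_assoc)
  hence "f \<otimes> u \<otimes> inv f \<otimes> inv u = n \<otimes> (u \<otimes> inv n \<otimes> inv u)"
    unfolding f using n(2) c by (simp add: m_assoc inv_mult_group)
  also have "\<dots> \<in> N" using n N.inv_op_closed2[OF c(2)] by simp
  finally show ?thesis .
qed

lemma (in group) conj_shift:
  assumes N: "N \<lhd> G" and c: "f \<in> carrier G" "x \<in> carrier G" "y \<in> carrier G"
    and "(x \<otimes> f \<otimes> inv x) \<otimes> inv ((x \<otimes> y) \<otimes> f \<otimes> inv (x \<otimes> y)) \<in> N"
  shows "f \<otimes> inv (y \<otimes> f \<otimes> inv y) \<in> N"
proof -
  interpret N: normal N G by (rule N)
  have "f \<otimes> inv (y \<otimes> f \<otimes> inv y) =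
    inv x \<otimes> ((x \<otimes> f \<otimes> inv x) \<otimes> inv ((x \<otimes> y) \<otimes> f \<otimes> inv (x \<otimes> y))) \<otimes> x"
    using c by (simp add: m_assoc inv_mult_group)
  also have "\<dots> \<in> N" by (rule N.inv_op_closed1[OF c(2) assms(5)])
  finally show ?thesis .
qed

text \<open>It suffices that the core \<open>N\<close> contains the commutators of the kernel, as the kernel is perfect. Given \<open>f\<close> and \<open>u\<close> with
supports in \<open>[e, 1 - e]\<close>, choose \<open>g\<close> that moves \<open>e\<close> to \<open>1 - e\<close>. Infinitely many conjugates of \<open>f\<close> by
powers of \<open>g\<close> meet finitely many cosets of \<open>N\<close>; so \<open>f\<close> is congruent modulo \<open>N\<close> to a conjugate of itself whose
support lies to the right of the support of \<open>u\<close>, and which therefore commutes with \<open>u\<close>.\<close>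
lemma finite_index_contains_ker_phi:
  assumes "finite_index_subgroup H thompson_F"
  shows "ker_phi \<subseteq> H"
proof -
  have H: "subgroup H thompson_F" "finite (rcosets\<^bsub>thompson_F\<^esub> H)"
    using assms by (auto simp: finite_index_subgroup_def)
  obtain N and \<rho> :: "(real \<Rightarrow> real) \<Rightarrow> (real \<Rightarrow> real) set \<Rightarrow> (real \<Rightarrow> real) set" where
    N: "N \<lhd> thompson_F" "N \<subseteq> H" and fin: "finite (\<rho> ` carrier thompson_F)"
    and \<rho>: "\<And>g h. g \<in> carrier thompson_F \<Longrightarrow> h \<in> carrier thompson_F \<Longrightarrow> \<rho> g = \<rho> h \<Longrightarrow> g \<star> tinv h \<in> N"
    using F.finite_index_core[OF H] by blast
  interpret N: normal N thompson_F by (rule N)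
  have com: "f \<star> u \<star> tinv f \<star> tinv u \<in> N" if fu: "f \<in> ker_phi" "u \<in> ker_phi" for f u
  proof -
    have c: "f \<in> carrier thompson_F" "u \<in> carrier thompson_F" using fu by (auto dest: ker_phi_carrier)
    obtain e where e: "0 < e" "e < 1 / 4" "e \<in> dyadic_rationals" "supported e f" "supported e u"
      using finite_supported[of "{f, u}"] fu by auto
    obtain g where g: "g \<in> carrier thompson_F" "g e = 1 - e"
      using exists_mapping_point[of e "1 - e"] e by auto
    define a where "a = (\<lambda>i::nat. tconj (g [^]\<^bsub>thompson_F\<^esub> i) f)"
    have ac: "a i \<in> carrier thompson_F" for i using g(1) c by (simp add: a_def)
    have "\<not> inj (\<lambda>i. \<rho> (a i))"
    proof
      assume "inj (\<lambda>i. \<rho> (a i))"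
      moreover have "range (\<lambda>i. \<rho> (a i)) \<subseteq> \<rho> ` carrier thompson_F" using ac by blast
      ultimately have "finite (UNIV :: nat set)" using inj_on_finite fin by blast
      thus False by simp
    qed
    then obtain i j where ij: "i < j" "\<rho> (a i) = \<rho> (a j)" unfolding inj_def by (metis linorder_neqE_nat)
    then obtain d where d: "j = i + Suc d" using less_imp_Suc_add by auto
    define y where "y = g [^]\<^bsub>thompson_F\<^esub> Suc d"
    have y: "y \<in> carrier thompson_F" using g by (simp add: y_def)
    have "g [^]\<^bsub>thompson_F\<^esub> j = g [^]\<^bsub>thompson_F\<^esub> i \<star> y" unfolding y_def d by (rule F.nat_pow_mult[OF g(1), symmetric])
    hence "tconj (g [^]\<^bsub>thompson_F\<^esub> i) f \<star> tinv (tconj (g [^]\<^bsub>thompson_F\<^esub> i \<star> y) f) \<in> N"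
      using \<rho>[OF ac ac ij(2)] by (simp add: a_def)
    hence "f \<star> tinv (tconj y f) \<in> N" by (rule F.conj_shift[OF N(1) c(1) F.nat_pow_closed[OF g(1)] y])
    moreover have "tconj y f \<star> u = u \<star> tconj y f"
    proof (rule disjoint_commute)
      fix t :: real assume t: "0 \<le> t" "t \<le> 1"
      show "tconj y f t = t \<or> u t = t"
      proof (cases "1 - e \<le> t")
        case True
        thus ?thesis using supportedD[OF e(5) t] by blast
      next
        case False
        have s: "0 \<le> tinv y t" "tinv y t \<le> 1" "y (tinv y t) = t" using y t by simp_all
        have "t \<le> y e" using pushing_pow[OF g(1) e(1,2) g(2), of d] thompson_pow[OF g(1), of e "Suc d"] e(1,2) False
          by (simp add: y_def del: funpow.simps F.nat_pow_Suc)
        hence "tinv y t \<le> e" using thompson_less_iff(2)[OF y s(1,2), of e] s(3) e(1,2) by simp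
        hence "f (tinv y t) = tinv y t" using supportedD[OF e(4) s(1,2)] by blast
        thus ?thesis using y c(1) t s by simp
      qed
    qed (use y c in simp_all)
    moreover have "tconj y f \<in> carrier thompson_F" using y c by simp
    ultimately show ?thesis using F.commutator_trick[OF N(1) c] by blast
  qed
  hence "derived_set thompson_F ker_phi \<subseteq> N" by blast
  hence "derived thompson_F ker_phi \<subseteq> N" unfolding derived_def
    by (rule F.generate_subgroup_incl[OF _ N.subgroup_axioms])
  thus ?thesis using N(2) ker_phi_perfect by simp
qed

section \<open>Reversal\<close>

lemma dpl_reverse:
  assumes "dpl f a b c d" shows "dpl (\<lambda>t. 1 - f (1 - t)) (1 - b) (1 - a) (1 - d) (1 - c)"
proof -
  have "dpl_on f a b" using assms by (simp add: dpl_def)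
  hence "dpl_on (\<lambda>t. 1 - f (1 - t)) (1 - b) (1 - a)"
  proof (induction rule: dpl_on_induct)
    case (affine a b k c)
    show ?case
    proof (rule dpl_on_affine)
      show "1 - f (1 - t) = 2 powi k * t + (1 - 2 powi k - c)" if "1 - b \<le> t" "t \<le> 1 - a" for t
        using affine(4)[of "1 - t"] that by (simp add: algebra_simps)
    qed (use affine in simp_all)
  next
    case (join a m b)
    thus ?case by (blast intro: dpl_on_join)
  qed
  thus ?thesis using dplD(6-8)[OF assms] by (simp add: dpl_def)
qed

lemma rev01_Bij: "rev01 \<in> carrier (BijGroup {0..1})"
proof -
  have "bij_betw rev01 {0..1} {0..1}"
    by (rule bij_betw_byWitness[of _ "\<lambda>x. 1 - x"]) (auto simp: rev01_def)
  thus ?thesis by (simp add: BijGroup_def Bij_def rev01_def)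
qed

lemma rev01_inv: "inv\<^bsub>BijGroup {0..1}\<^esub> rev01 = rev01"
proof -
  interpret B: group "BijGroup {0..1::real}" by (rule group_BijGroup)
  have "rev01 \<otimes>\<^bsub>BijGroup {0..1}\<^esub> rev01 = \<one>\<^bsub>BijGroup {0..1}\<^esub>"
    using rev01_Bij by (auto simp: BijGroup_def compose_def rev01_def fun_eq_iff)
  thus ?thesis using B.inv_equality rev01_Bij by blast
qed

lemma Rev_apply:
  assumes "f \<in> carrier thompson_F" "0 \<le> t" "t \<le> 1" shows "Rev f t = 1 - f (1 - t)"
proof -
  have fB: "f \<in> Bij {0..1}" using thompson_Bij[OF assms(1)] .
  have rB: "rev01 \<in> Bij {0..1}" using rev01_Bij by (simp add: BijGroup_def)
  have "compose {0..1} rev01 f \<in> Bij {0..1}" using fB rB by (rule compose_Bij[rotated])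
  thus ?thesis
    using assms fB rB by (simp add: Rev_def rev01_inv) (simp add: BijGroup_def compose_def rev01_def)
qed

lemma Rev_carrier [simp]:
  assumes f: "f \<in> carrier thompson_F" shows "Rev f \<in> carrier thompson_F"
  unfolding thompson_iff
proof
  interpret B: group "BijGroup {0..1::real}" by (rule group_BijGroup)
  have "f \<in> carrier (BijGroup {0..1})" using thompson_Bij[OF f] by (simp add: BijGroup_def)
  hence "Rev f \<in> carrier (BijGroup {0..1})" unfolding Rev_def using rev01_Bij by simp
  thus "Rev f \<in> extensional {0..1}" by (simp add: BijGroup_def Bij_def)
  have "dpl (\<lambda>t. 1 - f (1 - t)) 0 1 0 1" using dpl_reverse[OF thompson_dpl[OF f]] by simp
  thus "dpl (Rev f) 0 1 0 1" by (rule dpl_cong) (simp add: Rev_apply[OF f])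
qed

lemma Rev_Rev: "f \<in> carrier thompson_F \<Longrightarrow> Rev (Rev f) = f"
  by (rule thompson_ext) (simp_all add: Rev_apply)

lemma Rev_mult:
  "f \<in> carrier thompson_F \<Longrightarrow> g \<in> carrier thompson_F \<Longrightarrow> Rev (f \<star> g) = Rev f \<star> Rev g"
  by (rule thompson_ext) (simp_all add: Rev_apply)

lemma Rev_hom: "group_hom thompson_F thompson_F Rev"
  by unfold_locales (auto simp: hom_def Rev_mult)

lemma phi_Rev:
  assumes f: "f \<in> carrier thompson_F" shows "phi (Rev f) = prod.swap (phi f)"
proof -
  obtain e where e: "0 < e" "e \<le> 1" "\<And>t. 0 \<le> t \<Longrightarrow> t \<le> e \<Longrightarrow> f t = 2 powi fst (phi f) * t"
    using germ_0[OF f] by auto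
  have 1: "snd (phi (Rev f)) = fst (phi f)"
  proof (rule phi_snd_unique)
    show "Rev f t = 1 - 2 powi fst (phi f) * (1 - t)" if "1 - e \<le> t" "t \<le> 1" for t
      using Rev_apply[OF f, of t] e(3)[of "1 - t"] that e(1,2) by simp
  qed (use f e in simp_all)
  obtain d where d: "d < 1" "0 \<le> d" "\<And>t. d \<le> t \<Longrightarrow> t \<le> 1 \<Longrightarrow> f t = 1 - 2 powi snd (phi f) * (1 - t)"
    using germ_1[OF f] by auto
  have 2: "fst (phi (Rev f)) = snd (phi f)"
  proof (rule phi_fst_unique)
    show "Rev f t = 2 powi snd (phi f) * t" if "0 \<le> t" "t \<le> 1 - d" for t
      using Rev_apply[OF f, of t] d(3)[of "1 - t"] that d(1,2) by simp
  qed (use f d in simp_all)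
  show ?thesis using 1 2 by (simp add: prod_eq_iff)
qed

section \<open>Expanding elements\<close>

text \<open>The copy of \<open>f\<close> on the middle half of the unit interval.\<close>
definition squeeze :: "(real \<Rightarrow> real) \<Rightarrow> real \<Rightarrow> real" where
  "squeeze f = restrict (\<lambda>t. if t \<le> 3 / 4 then if t \<le> 1 / 4 then t else 1 / 4 + f (2 * t - 1 / 2) / 2 else t) {0..1}"

lemma squeeze_carrier:
  assumes f: "f \<in> carrier thompson_F" shows "squeeze f \<in> carrier thompson_F"
proof -
  have D: "(1/4::real) \<in> dyadic_rationals" "(3/4::real) \<in> dyadic_rationals" by simp_all
  have 1: "dpl (\<lambda>t. t) 0 (1/4) 0 (1/4)" by (rule dpl_affine[of _ _ _ _ 0]) (use D in simp_all)
  have 3: "dpl (\<lambda>t. t) (3/4) 1 (3/4) 1" by (rule dpl_affine[of _ _ _ _ 0]) (use D in simp_all)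
  have a: "dpl (\<lambda>t. 2 * t - 1 / 2) (1/4) (3/4) 0 1" by (rule dpl_affine[of _ _ _ _ 1]) (use D in simp_all)
  have b: "dpl (\<lambda>t. 1 / 4 + t / 2) 0 1 (1/4) (3/4)"
    by (rule dpl_affine[of _ _ _ _ "-1"]) (use D in \<open>simp_all add: power_int_minus\<close>)
  have 2: "dpl (\<lambda>t. 1 / 4 + f (2 * t - 1 / 2) / 2) (1/4) (3/4) (1/4) (3/4)"
    using dpl_comp[OF dpl_comp[OF a thompson_dpl[OF f]] b] .
  have "dpl (\<lambda>t. if t \<le> 3 / 4 then if t \<le> 1 / 4 then t else 1 / 4 + f (2 * t - 1 / 2) / 2 else t) 0 1 0 1"
    by (rule dpl_glue[OF dpl_glue[OF 1 2] 3])
  hence "dpl (squeeze f) 0 1 0 1" by (rule dpl_cong) (simp add: squeeze_def)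
  thus ?thesis by (simp add: thompson_iff) (simp add: squeeze_def)
qed

lemma squeeze_apply:
  assumes "f \<in> carrier thompson_F"
  shows "0 \<le> t \<Longrightarrow> t \<le> 1 / 4 \<Longrightarrow> squeeze f t = t" "3 / 4 \<le> t \<Longrightarrow> t \<le> 1 \<Longrightarrow> squeeze f t = t"
    "1 / 4 \<le> t \<Longrightarrow> t \<le> 3 / 4 \<Longrightarrow> squeeze f t = 1 / 4 + f (2 * t - 1 / 2) / 2"
proof -
  show "squeeze f t = t" if "0 \<le> t" "t \<le> 1 / 4" using that by (simp add: squeeze_def)
  show "squeeze f t = t" if "3 / 4 \<le> t" "t \<le> 1"
  proof (cases "t = 3 / 4")
    case True
    have "squeeze f (3 / 4) = 3 / 4" using thompson_ends[OF assms] by (simp add: squeeze_def)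
    thus ?thesis using True by blast
  qed (use that in \<open>simp add: squeeze_def\<close>)
  show "squeeze f t = 1 / 4 + f (2 * t - 1 / 2) / 2" if "1 / 4 \<le> t" "t \<le> 3 / 4"
  proof (cases "t = 1 / 4")
    case True
    have "squeeze f (1 / 4) = 1 / 4 + f (2 * (1 / 4) - 1 / 2) / 2"
      using thompson_ends[OF assms] by (simp add: squeeze_def)
    thus ?thesis using True by blast
  qed (use that in \<open>simp add: squeeze_def\<close>)
qed

lemma squeeze_hom: "group_hom thompson_F thompson_F squeeze"
proof unfold_locales
  have "squeeze (f \<star> g) = squeeze f \<star> squeeze g" if c: "f \<in> carrier thompson_F" "g \<in> carrier thompson_F" for f g
  proof (rule thompson_ext)
    fix t :: real assume t: "0 \<le> t" "t \<le> 1"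
    have fg: "f \<star> g \<in> carrier thompson_F" using c by simp
    note S = squeeze_apply[OF c(1)] squeeze_apply[OF c(2)] squeeze_apply[OF fg]
    consider "t \<le> 1 / 4" | "3 / 4 \<le> t" | "1 / 4 < t" "t < 3 / 4" by linarith
    thus "squeeze (f \<star> g) t = (squeeze f \<star> squeeze g) t"
    proof cases
      case 3
      have "0 \<le> g (2 * t - 1 / 2)" "g (2 * t - 1 / 2) \<le> 1" using 3 c by simp_all
      moreover from this have "squeeze f (1 / 4 + g (2 * t - 1 / 2) / 2) = 1 / 4 + f (g (2 * t - 1 / 2)) / 2"
        using S(3)[of "1 / 4 + g (2 * t - 1 / 2) / 2"] by simp
      ultimately show ?thesis using S(6)[of t] S(9)[of t] 3 t c squeeze_carrier by simp
    qed (use S t c squeeze_carrier in simp_all)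
  qed (use c squeeze_carrier in simp_all)
  thus "squeeze \<in> hom thompson_F thompson_F" unfolding hom_def using squeeze_carrier by simp
qed

lemma squeeze_onto:
  assumes f: "f \<in> carrier thompson_F" and s: "supported (1 / 4) f"
  shows "\<exists>g\<in>carrier thompson_F. squeeze g = f"
proof -
  have e: "f (1 / 4) = 1 / 4" "f (3 / 4) = 3 / 4" using supportedD[OF s] by simp_all
  have D: "(1/4::real) \<in> dyadic_rationals" "(3/4::real) \<in> dyadic_rationals" by simp_all
  have a: "dpl (\<lambda>t. 2 * t - 1 / 2) (1/4) (3/4) 0 1" by (rule dpl_affine[of _ _ _ _ 1]) (use D in simp_all)
  have b: "dpl (\<lambda>t. 1 / 4 + t / 2) 0 1 (1/4) (3/4)"
    by (rule dpl_affine[of _ _ _ _ "-1"]) (use D in \<open>simp_all add: power_int_minus\<close>)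
  have m: "dpl f (1/4) (3/4) (1/4) (3/4)"
    using dpl_subinterval[OF thompson_dpl[OF f], of "1/4" "3/4"] D e by simp
  have "dpl (\<lambda>t. 2 * f (1 / 4 + t / 2) - 1 / 2) 0 1 0 1" using dpl_comp[OF dpl_comp[OF b m] a] .
  from thompson_of_dpl[OF this] obtain g where g: "g \<in> carrier thompson_F"
    "\<And>t. 0 \<le> t \<Longrightarrow> t \<le> 1 \<Longrightarrow> g t = 2 * f (1 / 4 + t / 2) - 1 / 2" by auto
  have "squeeze g = f"
  proof (rule thompson_ext)
    fix t :: real assume t: "0 \<le> t" "t \<le> 1"
    consider "t \<le> 1 / 4" | "3 / 4 \<le> t" | "1 / 4 \<le> t" "t \<le> 3 / 4" by linarith
    thus "squeeze g t = f t"
    proof cases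
      case 3
      have "1 / 4 + (2 * t - 1 / 2) / 2 = t" by (simp add: field_simps)
      thus ?thesis using squeeze_apply(3)[OF g(1) 3] g(2)[of "2 * t - 1 / 2"] 3
        by (simp add: diff_divide_distrib)
    qed (use squeeze_apply(1,2)[OF g(1), of t] supportedD[OF s, of t] t in simp_all)
  qed (use squeeze_carrier g f in simp_all)
  thus ?thesis using g by blast
qed

text \<open>The elements supported in \<open>[1/4, 3/4]\<close> form a copy of the whole group, which has two generators.\<close>
lemma middle_finitely_generated:
  "\<exists>A. finite A \<and> A \<subseteq> ker_phi \<and>
    (\<forall>f\<in>carrier thompson_F. supported (1 / 4) f \<longrightarrow> f \<in> generate thompson_F A)"
proof -
  obtain x y where xy: "x \<in> carrier thompson_F" "y \<in> carrier thompson_F"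
    "carrier thompson_F = generate thompson_F {x, y}" "phi x = (1, -1)" "phi y = (0, -1)"
    using thompson_two_generators by blast
  have "squeeze f \<in> ker_phi" if "f \<in> carrier thompson_F" for f
  proof (rule ker_phiI)
    show "supported (1 / 4) (squeeze f)"
      unfolding supported_def using squeeze_apply(1,2)[OF that] by auto
  qed (use squeeze_carrier that in simp_all)
  moreover have "f \<in> generate thompson_F (squeeze ` {x, y})"
    if f: "f \<in> carrier thompson_F" "supported (1 / 4) f" for f
    using squeeze_onto[OF f] group_hom.generate_img[OF squeeze_hom, of "{x, y}"] xy by auto
  ultimately show ?thesis using xy(1,2) by (intro exI[of _ "squeeze ` {x, y}"]) simp
qed

text \<open>Only the group structure and the kernel enter, so this property is invariant under isomorphisms that preserve the
kernel. Finiteness of \<open>A\<close> is essential: it keeps all of \<open>A\<close> away from the endpoints.\<close>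
definition expands :: "(real \<Rightarrow> real) \<Rightarrow> bool" where
  "expands h \<longleftrightarrow> (\<exists>A. finite A \<and> A \<subseteq> ker_phi \<and>
     ker_phi \<subseteq> generate thompson_F (\<Union>n::nat. tconj (h [^]\<^bsub>thompson_F\<^esub> n) ` A))"

lemma tconj_hom: "g \<in> carrier thompson_F \<Longrightarrow> group_hom thompson_F thompson_F (tconj g)"
  by unfold_locales (simp add: hom_def F.m_assoc)

text \<open>Choose \<open>h\<close> with slope at most \<open>1 / 2\<close> on \<open>[0, 1/4]\<close> and on \<open>[3/4, 1]\<close>. Its powers carry \<open>[1/4, 3/4]\<close>
to intervals that exhaust \<open>(0,1)\<close>, so a conjugate by a negative power moves any given element of the kernel into
the finitely generated subgroup of elements supported in \<open>[1/4, 3/4]\<close>.\<close>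
lemma exists_expanding:
  assumes "m < 0" "n < 0"
  shows "\<exists>h\<in>carrier thompson_F. phi h = (m, n) \<and> expands h"
proof -
  have p2: "(2::real) powi k \<le> 1 / 2" if "k < 0" for k :: int
    using power_int_increasing[of k "-1" "2::real"] that by (simp add: power_int_minus)
  have "(2::real) powi m * (1 / 4) < 1 - 2 powi n * (1 - 3 / 4)" using p2[OF assms(1)] p2[OF assms(2)] by simp
  from exists_with_germs[OF _ _ _ _ _ this]
  obtain h where h: "h \<in> carrier thompson_F" "phi h = (m, n)"
    and h0: "\<And>t. 0 \<le> t \<Longrightarrow> t \<le> 1 / 4 \<Longrightarrow> h t = 2 powi m * t"
    and h1: "\<And>t. 3 / 4 \<le> t \<Longrightarrow> t \<le> 1 \<Longrightarrow> h t = 1 - 2 powi n * (1 - t)" by force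
  have low: "0 \<le> (h ^^ k) (1 / 4) \<and> (h ^^ k) (1 / 4) \<le> (1 / 2) ^ k / 4" for k
  proof (induction k)
    case (Suc k)
    let ?t = "(h ^^ k) (1 / 4)"
    have "(1 / 2 :: real) ^ k \<le> 1" by (rule power_le_one) simp_all
    hence "h ?t = 2 powi m * ?t" using h0[of ?t] Suc by simp
    moreover have "2 powi m * ?t \<le> 1 / 2 * ?t" using p2[OF assms(1)] Suc by (intro mult_right_mono) simp_all
    ultimately show ?case using Suc by simp
  qed simp
  have high: "(h ^^ k) (3 / 4) \<le> 1 \<and> 1 - (h ^^ k) (3 / 4) \<le> (1 / 2) ^ k / 4" for k
  proof (induction k)
    case (Suc k)
    let ?t = "(h ^^ k) (3 / 4)"
    have "(1 / 2 :: real) ^ k \<le> 1" by (rule power_le_one) simp_all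
    hence "h ?t = 1 - 2 powi n * (1 - ?t)" using h1[of ?t] Suc by simp
    moreover have "2 powi n * (1 - ?t) \<le> 1 / 2 * (1 - ?t)" using p2[OF assms(2)] Suc by (intro mult_right_mono) simp_all
    ultimately show ?case using Suc by simp
  qed simp
  obtain A where A: "finite A" "A \<subseteq> ker_phi"
    "\<And>f. f \<in> carrier thompson_F \<Longrightarrow> supported (1 / 4) f \<Longrightarrow> f \<in> generate thompson_F A"
    using middle_finitely_generated by blast
  have Ac: "A \<subseteq> carrier thompson_F" using A(2) ker_phi_carrier by blast
  let ?B = "\<Union>n::nat. tconj (h [^]\<^bsub>thompson_F\<^esub> n) ` A"
  have "k \<in> generate thompson_F ?B" if k: "k \<in> ker_phi" for k
  proof -
    have kc: "k \<in> carrier thompson_F" using k by (rule ker_phi_carrier)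
    obtain e where e: "0 < e" "e < 1 / 4" "supported e k" using finite_supported[of "{k}"] k by auto
    obtain N where N: "(1 / 2 :: real) ^ N < e" using real_arch_pow_inv[OF e(1), of "1 / 2"] by auto
    define g where "g = h [^]\<^bsub>thompson_F\<^esub> N"
    have g: "g \<in> carrier thompson_F" using h by (simp add: g_def)
    have ge: "g (1 / 4) \<le> e" "1 - e \<le> g (3 / 4)"
      using low[of N] high[of N] N thompson_pow[OF h(1), of "1 / 4" N] thompson_pow[OF h(1), of "3 / 4" N]
      by (simp_all add: g_def)
    define f where "f = tconj (tinv g) k"
    have f: "f \<in> carrier thompson_F" using g kc by (simp add: f_def)
    have "supported (1 / 4) f" unfolding supported_def
    proof (intro allI impI)
      fix t :: real assume t: "0 \<le> t" "t \<le> 1" "t \<le> 1 / 4 \<or> 1 - 1 / 4 \<le> t"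
      have "g t \<le> e \<or> 1 - e \<le> g t"
        using t thompson_less_iff(2)[OF g, of t "1 / 4"] thompson_less_iff(2)[OF g, of "3 / 4" t] ge by auto
      hence "k (g t) = g t" using supportedD[OF e(3)] g t by simp
      thus "f t = t" using g kc t by (simp add: f_def)
    qed
    hence "f \<in> generate thompson_F A" using A(3) f by blast
    hence "tconj g f \<in> generate thompson_F (tconj g ` A)"
      using group_hom.generate_img[OF tconj_hom[OF g] Ac] by blast
    also have "\<dots> \<subseteq> generate thompson_F ?B" by (rule F.mono_generate) (auto simp: g_def)
    also have "tconj g f = k" using g kc by (simp add: f_def F.m_assoc)
    finally show ?thesis .
  qed
  thus ?thesis using h A(1,2) unfolding expands_def by blast
qed

lemma ker_phi_moves:
  assumes "0 < d" shows "\<exists>k\<in>ker_phi. \<exists>t. 0 \<le> t \<and> t \<le> d \<and> t \<le> 1 \<and> k t \<noteq> t"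
proof -
  obtain q where q: "0 < q" "q < min d (1 / 4)" "q \<in> dyadic_rationals"
    using exists_small_dyadic[of "min d (1 / 4)"] assms by auto
  obtain g where g: "g \<in> carrier thompson_F" "g q = q / 2"
    using exists_mapping_point[of q "q / 2"] q by auto
  obtain k where "k \<in> ker_phi" "\<forall>t. q \<le> t \<longrightarrow> t \<le> 1 - q \<longrightarrow> k t = g t"
    using ker_phi_agrees_inside[OF g(1), of q] q by auto
  thus ?thesis using g q by (intro bexI[of _ k] exI[of _ q]) auto
qed

text \<open>If the slope at \<open>0\<close> is at least \<open>1\<close>, then \<open>h\<close> does not decrease points of some \<open>[0,d]\<close> on which the elements of \<open>A\<close>
are the identity, so all conjugates of \<open>A\<close> by positive powers of \<open>h\<close> are the identity on \<open>[0,d]\<close> too. The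
kernel is not.\<close>
lemma expands_fst:
  assumes h: "h \<in> carrier thompson_F" and ex: "expands h"
  shows "fst (phi h) < 0"
proof (rule ccontr)
  assume "\<not> fst (phi h) < 0"
  hence "(2::real) powi 0 \<le> 2 powi fst (phi h)" by (intro power_int_increasing) auto
  hence p: "(1::real) \<le> 2 powi fst (phi h)" by simp
  obtain A where A: "finite A" "A \<subseteq> ker_phi"
    "ker_phi \<subseteq> generate thompson_F (\<Union>n::nat. tconj (h [^]\<^bsub>thompson_F\<^esub> n) ` A)"
    using ex unfolding expands_def by blast
  obtain e where e: "0 < e" "e < 1 / 4" "\<And>x. x \<in> A \<Longrightarrow> supported e x" using finite_supported[OF A(1,2)] by blast
  obtain c where c: "0 < c" "c \<le> 1" "\<And>t. 0 \<le> t \<Longrightarrow> t \<le> c \<Longrightarrow> h t = 2 powi fst (phi h) * t"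
    using germ_0[OF h] by blast
  define d where "d = min e c"
  have d: "0 < d" "d \<le> e" "d \<le> c" "d \<le> 1" using e c by (auto simp: d_def)
  have ht: "t \<le> h t" if "0 \<le> t" "t \<le> d" for t
    using c(3)[of t] that d mult_right_mono[OF p that(1)] by simp
  have hn: "t \<le> (h ^^ n) t" if t: "0 \<le> t" "t \<le> d" for t n
  proof (induction n)
    case (Suc n)
    have "h t \<le> h ((h ^^ n) t)"
      using thompson_less_iff(2)[OF h, of t "(h ^^ n) t"] thompson_pow[OF h, of t n] Suc t d by simp
    thus ?case using ht[OF t] by simp
  qed simp
  define S where "S = {f \<in> carrier thompson_F. \<forall>t. 0 \<le> t \<longrightarrow> t \<le> d \<longrightarrow> f t = t}"
  have S: "subgroup S thompson_F"
  proof (rule F.subgroupI)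
    have "\<one>\<^bsub>thompson_F\<^esub> \<in> S" using d by (simp add: S_def)
    thus "S \<noteq> {}" by blast
    show "tinv f \<in> S" if "f \<in> S" for f
      using that d thompson_inv_eq[of f] by (simp add: S_def)
    show "f \<star> g \<in> S" if "f \<in> S" "g \<in> S" for f g using that d by (simp add: S_def)
  qed (simp add: S_def)
  have "tconj (h [^]\<^bsub>thompson_F\<^esub> n) x \<in> S" if x: "x \<in> A" for n :: nat and x
  proof -
    define g where "g = h [^]\<^bsub>thompson_F\<^esub> n"
    have g: "g \<in> carrier thompson_F" using h by (simp add: g_def)
    have xc: "x \<in> carrier thompson_F" using x A(2) ker_phi_carrier by blast
    have "tconj g x t = t" if t: "0 \<le> t" "t \<le> d" for t
    proof -
      have s: "0 \<le> tinv g t" "tinv g t \<le> 1" "g (tinv g t) = t" using g t d by simp_all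
      have "t \<le> g t" using hn[OF t, of n] thompson_pow[OF h, of t n] t d by (simp add: g_def)
      hence "tinv g t \<le> t" using thompson_less_iff(2)[OF g s(1,2), of t] s(3) t d by simp
      hence "x (tinv g t) = tinv g t" using supportedD[OF e(3)[OF x] s(1,2)] t d by simp
      thus ?thesis using g xc t d s by simp
    qed
    thus ?thesis using g xc by (simp add: S_def g_def)
  qed
  hence "generate thompson_F (\<Union>n::nat. tconj (h [^]\<^bsub>thompson_F\<^esub> n) ` A) \<subseteq> S"
    by (intro F.generate_subgroup_incl[OF _ S]) blast
  hence "ker_phi \<subseteq> S" using A(3) by blast
  thus False using ker_phi_moves[OF d(1)] by (auto simp: S_def)
qed

lemma Rev_ker_phi: "f \<in> ker_phi \<Longrightarrow> Rev f \<in> ker_phi"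
  by (simp add: ker_phi_def phi_Rev zero_prod_def)

lemma expands_Rev:
  assumes h: "h \<in> carrier thompson_F" and ex: "expands h" shows "expands (Rev h)"
proof -
  interpret R: group_hom thompson_F thompson_F Rev by (rule Rev_hom)
  obtain A where A: "finite A" "A \<subseteq> ker_phi"
    "ker_phi \<subseteq> generate thompson_F (\<Union>n::nat. tconj (h [^]\<^bsub>thompson_F\<^esub> n) ` A)"
    using ex unfolding expands_def by blast
  let ?B = "\<Union>n::nat. tconj (h [^]\<^bsub>thompson_F\<^esub> n) ` A"
  have Ac: "x \<in> carrier thompson_F" if "x \<in> A" for x using that A(2) ker_phi_carrier by blast
  have B: "?B \<subseteq> carrier thompson_F" using Ac h by auto
  have "Rev (tconj (h [^]\<^bsub>thompson_F\<^esub> n) x) = tconj (Rev h [^]\<^bsub>thompson_F\<^esub> n) (Rev x)"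
    if "x \<in> A" for n :: nat and x
    using Ac[OF that] h by (simp add: R.hom_nat_pow)
  hence "Rev ` tconj (h [^]\<^bsub>thompson_F\<^esub> n) ` A = tconj (Rev h [^]\<^bsub>thompson_F\<^esub> n) ` Rev ` A" for n :: nat
    unfolding image_image by (intro image_cong refl)
  hence im: "Rev ` ?B = (\<Union>n::nat. tconj (Rev h [^]\<^bsub>thompson_F\<^esub> n) ` Rev ` A)" by (simp only: image_UN)
  have "k \<in> Rev ` generate thompson_F ?B" if "k \<in> ker_phi" for k
  proof (rule image_eqI)
    show "k = Rev (Rev k)" using Rev_Rev[OF ker_phi_carrier[OF that]] by simp
    show "Rev k \<in> generate thompson_F ?B" using A(3) Rev_ker_phi[OF that] by (rule subsetD)
  qed
  hence "ker_phi \<subseteq> generate thompson_F (Rev ` ?B)" using R.generate_img[OF B] by blast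
  thus ?thesis unfolding expands_def im using A(1,2) Rev_ker_phi
    by (intro exI[of _ "Rev ` A"]) blast
qed

lemma expands_neg:
  assumes "h \<in> carrier thompson_F" "expands h" shows "fst (phi h) < 0 \<and> snd (phi h) < 0"
  using expands_fst[OF assms] expands_fst[OF Rev_carrier[OF assms(1)] expands_Rev[OF assms]] phi_Rev[OF assms(1)]
  by simp

section \<open>Isomorphisms between subgroups of finite index\<close>

text \<open>The derived subgroup lies between those of the kernel and of the whole group, and both are the kernel.\<close>
lemma derived_intermediate:
  assumes "subgroup H thompson_F" "ker_phi \<subseteq> H"
  shows "derived (thompson_F\<lparr>carrier := H\<rparr>) H = ker_phi"
proof -
  have HF: "H \<subseteq> carrier thompson_F" using assms(1) by (rule subgroup.subset)
  have "derived thompson_F H \<subseteq> derived thompson_F (carrier thompson_F)"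
    by (rule F.mono_derived[OF HF])
  also have "\<dots> \<subseteq> ker_phi" by (rule derived_subset_if_kernel_commutes[OF normal_ker_phi]) (simp add: ker_phi_perfect)
  finally have "derived thompson_F H \<subseteq> ker_phi" .
  moreover have "derived thompson_F ker_phi \<subseteq> derived thompson_F H" by (rule F.mono_derived[OF assms(2)])
  ultimately have "derived thompson_F H = ker_phi" by (simp add: ker_phi_perfect)
  thus ?thesis using F.derived_consistent[OF subset_refl assms(1)] by simp
qed

locale kernel_iso =
  fixes H H' \<theta>
  assumes sub: "subgroup H thompson_F" "subgroup H' thompson_F"
    and ker: "ker_phi \<subseteq> H" "ker_phi \<subseteq> H'"
    and iso: "\<theta> \<in> iso (thompson_F\<lparr>carrier := H\<rparr>) (thompson_F\<lparr>carrier := H'\<rparr>)"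
begin

lemma hom: "group_hom (thompson_F\<lparr>carrier := H\<rparr>) (thompson_F\<lparr>carrier := H'\<rparr>) \<theta>"
  using F.subgroup_imp_group[OF sub(1)] F.subgroup_imp_group[OF sub(2)] iso
  by (simp add: group_hom_def group_hom_axioms_def iso_def)

lemma onto: "\<theta> ` H = H'"
  using iso by (simp add: iso_def bij_betw_def)

lemma closed: "f \<in> H \<Longrightarrow> \<theta> f \<in> H'"
  using onto by blast

lemma mem: "f \<in> H \<Longrightarrow> f \<in> carrier thompson_F" "f \<in> H' \<Longrightarrow> f \<in> carrier thompson_F"
  using subgroup.mem_carrier[OF sub(1)] subgroup.mem_carrier[OF sub(2)] by blast+

lemma mult: "f \<in> H \<Longrightarrow> g \<in> H \<Longrightarrow> \<theta> (f \<star> g) = \<theta> f \<star> \<theta> g"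
  using group_hom.hom_mult[OF hom] by simp

lemma inv: "f \<in> H \<Longrightarrow> \<theta> (tinv f) = tinv (\<theta> f)"
  using group_hom.hom_inv[OF hom, of f] sub closed by simp

lemma pow: "f \<in> H \<Longrightarrow> \<theta> (f [^]\<^bsub>thompson_F\<^esub> (n::nat)) = \<theta> f [^]\<^bsub>thompson_F\<^esub> n"
  using group_hom.hom_nat_pow[OF hom, of f n] by (simp flip: F.nat_pow_consistent)

lemma pow_mem: "f \<in> H \<Longrightarrow> f [^]\<^bsub>thompson_F\<^esub> (n::nat) \<in> H"
  using F.subgroup_int_pow_closed[OF sub(1), of f "int n"] by (simp add: int_pow_int)

lemma ker_phi_image: "\<theta> ` ker_phi = ker_phi"
  using group_hom.derived_img[OF hom, of H] onto
    derived_intermediate[OF sub(1) ker(1)] derived_intermediate[OF sub(2) ker(2)] by simp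

lemma expands_image:
  assumes f: "f \<in> H" and ex: "expands f" shows "expands (\<theta> f)"
proof -
  obtain A where A: "finite A" "A \<subseteq> ker_phi"
    "ker_phi \<subseteq> generate thompson_F (\<Union>n::nat. tconj (f [^]\<^bsub>thompson_F\<^esub> n) ` A)"
    using ex unfolding expands_def by blast
  let ?B = "\<Union>n::nat. tconj (f [^]\<^bsub>thompson_F\<^esub> n) ` A"
  have AH: "x \<in> H" if "x \<in> A" for x using that A(2) ker(1) by blast
  have conjH: "tconj (f [^]\<^bsub>thompson_F\<^esub> n) x \<in> H" if "x \<in> A" for n :: nat and x
    using AH[OF that] pow_mem[OF f] sub(1) by (simp add: subgroup.m_closed subgroup.m_inv_closed)
  have B: "?B \<subseteq> H" using conjH by blast
  have "\<theta> (tconj (f [^]\<^bsub>thompson_F\<^esub> n) x) = tconj (\<theta> f [^]\<^bsub>thompson_F\<^esub> n) (\<theta> x)"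
    if "x \<in> A" for n :: nat and x
    using AH[OF that] pow_mem[OF f] sub(1) mult inv pow[OF f]
    by (simp add: subgroup.m_closed subgroup.m_inv_closed)
  hence "\<theta> ` tconj (f [^]\<^bsub>thompson_F\<^esub> n) ` A = tconj (\<theta> f [^]\<^bsub>thompson_F\<^esub> n) ` \<theta> ` A" for n :: nat
    unfolding image_image by (intro image_cong refl)
  hence im: "\<theta> ` ?B = (\<Union>n::nat. tconj (\<theta> f [^]\<^bsub>thompson_F\<^esub> n) ` \<theta> ` A)" by (simp only: image_UN)
  have imH: "\<theta> ` ?B \<subseteq> H'" using B closed by blast
  have "ker_phi = \<theta> ` ker_phi" by (simp add: ker_phi_image)
  also have "\<dots> \<subseteq> \<theta> ` generate thompson_F ?B" using A(3) by (rule image_mono)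
  also have "\<dots> = generate thompson_F (\<theta> ` ?B)"
    using group_hom.generate_img[OF hom, of ?B] B
      F.generate_consistent[OF B sub(1)] F.generate_consistent[OF imH sub(2)] by simp
  finally have "ker_phi \<subseteq> generate thompson_F (\<Union>n::nat. tconj (\<theta> f [^]\<^bsub>thompson_F\<^esub> n) ` \<theta> ` A)"
    unfolding im .
  moreover have "finite (\<theta> ` A)" "\<theta> ` A \<subseteq> ker_phi" using A(1,2) ker_phi_image by auto
  ultimately show ?thesis unfolding expands_def by blast
qed

lemma phi_image_cong:
  assumes "f \<in> H" "g \<in> H" "phi f = phi g" shows "phi (\<theta> f) = phi (\<theta> g)"
proof -
  have "f \<star> tinv g \<in> ker_phi" using assms mem by (simp add: ker_phi_def phi_mult phi_inv)
  hence "\<theta> (f \<star> tinv g) \<in> ker_phi" using ker_phi_image by blast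
  moreover have "\<theta> (f \<star> tinv g) = \<theta> f \<star> tinv (\<theta> g)"
    using assms sub(1) mult inv by (simp add: subgroup.m_inv_closed)
  ultimately have "phi (\<theta> f \<star> tinv (\<theta> g)) = 0" by (simp add: ker_phi_def)
  thus ?thesis using assms closed mem by (simp add: phi_mult phi_inv)
qed

lemma neg_image:
  assumes f: "f \<in> H" and neg: "fst (phi f) < 0" "snd (phi f) < 0"
  shows "fst (phi (\<theta> f)) < 0 \<and> snd (phi (\<theta> f)) < 0"
proof -
  obtain h where h: "h \<in> carrier thompson_F" "phi h = phi f" "expands h"
    using exists_expanding[OF neg] by auto
  have "h \<star> tinv f \<in> ker_phi" using h f mem by (simp add: ker_phi_def phi_mult phi_inv)
  hence "h \<star> tinv f \<star> f \<in> H" using ker(1) f sub(1) by (blast intro: subgroup.m_closed)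
  hence hH: "h \<in> H" using h f mem by (simp add: F.m_assoc)
  have "expands (\<theta> h)" by (rule expands_image[OF hH h(3)])
  hence "fst (phi (\<theta> h)) < 0 \<and> snd (phi (\<theta> h)) < 0" using expands_neg mem closed hH by blast
  thus ?thesis using phi_image_cong[OF hH f h(2)] by simp
qed

lemma inverse_iso: "kernel_iso H' H (inv_into H \<theta>)"
  using group.iso_set_sym[OF F.subgroup_imp_group[OF sub(1)] iso] sub ker
  by (simp add: kernel_iso_def)

lemma inverse_apply: "f \<in> H \<Longrightarrow> inv_into H \<theta> (\<theta> f) = f"
  using iso by (simp add: iso_def bij_betw_def)

lemma neg_image_iff:
  assumes "f \<in> H"
  shows "fst (phi (\<theta> f)) < 0 \<and> snd (phi (\<theta> f)) < 0 \<longleftrightarrow> fst (phi f) < 0 \<and> snd (phi f) < 0"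
  using neg_image[OF assms] kernel_iso.neg_image[OF inverse_iso, of "\<theta> f"] closed[OF assms]
    inverse_apply[OF assms] by auto

end

text \<open>Here \<open>(u1, u2)\<close> and \<open>(w1, w2)\<close> are the images of the basis vectors. Preserving the open negative quadrant forces
all entries to be nonnegative. Reflecting it as well forbids that \<open>(-1, 0)\<close>, which lies outside, is mapped
inside, so one of \<open>u1\<close>, \<open>u2\<close> vanishes; likewise for \<open>w1\<close>, \<open>w2\<close>.\<close>
lemma quadrant_preserving:
  fixes u1 u2 w1 w2 :: int
  assumes Q: "\<And>i j. i < 0 \<and> j < 0 \<longleftrightarrow> i * u1 + j * w1 < 0 \<and> i * u2 + j * w2 < 0"
  shows "u2 = 0 \<and> w1 = 0 \<and> u1 > 0 \<and> w2 > 0 \<or> u1 = 0 \<and> w2 = 0 \<and> u2 > 0 \<and> w1 > 0"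
proof -
  have pos: "0 \<le> x" if "\<And>i j::int. i < 0 \<Longrightarrow> j < 0 \<Longrightarrow> i * x + j * y < 0" for x y :: int
  proof (rule ccontr)
    assume "\<not> 0 \<le> x"
    \<comment> \<open>If \<open>x\<close> were negative, a large multiple of it would outweigh \<open>y\<close>.\<close>
    define z where "z = (\<bar>y\<bar> + 1) * (- x)"
    have "(- (\<bar>y\<bar> + 1)) * x + (- 1) * y < 0" by (rule that) auto
    hence "z < y" by (simp add: z_def algebra_simps)
    moreover have "(\<bar>y\<bar> + 1) * 1 \<le> z" unfolding z_def using \<open>\<not> 0 \<le> x\<close> by (intro mult_left_mono) auto
    hence "\<bar>y\<bar> + 1 \<le> z" by (simp only: mult_1_right)
    ultimately show False using abs_ge_self[of y] by linarith
  qed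
  have Q1: "i * u1 + j * w1 < 0" and Q2: "i * u2 + j * w2 < 0" if "i < 0" "j < 0" for i j
    using Q[of i j] that by simp_all
  have "0 \<le> u1" "0 \<le> u2" using pos[OF Q1] pos[OF Q2] by simp_all
  moreover have "0 \<le> w1" by (rule pos[of w1 u1]) (subst add.commute, rule Q1)
  moreover have "0 \<le> w2" by (rule pos[of w2 u2]) (subst add.commute, rule Q2)
  moreover have "\<not> (u1 > 0 \<and> u2 > 0)" using Q[of "-1" 0] by auto
  moreover have "\<not> (w1 > 0 \<and> w2 > 0)" using Q[of 0 "-1"] by auto
  moreover have "u1 + w1 > 0" "u2 + w2 > 0" using Q[of "-1" "-1"] by auto
  ultimately show ?thesis by linarith
qed

lemma (in group) finite_index_pow:
  assumes H: "subgroup H G" and fin: "finite (rcosets H)" and g: "g \<in> carrier G"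
  shows "\<exists>n>0. g [^] (n::nat) \<in> H"
proof -
  have "\<not> inj (\<lambda>i::nat. H #> (g [^] i))"
  proof
    assume "inj (\<lambda>i::nat. H #> (g [^] i))"
    moreover have "range (\<lambda>i::nat. H #> (g [^] i)) \<subseteq> rcosets H"
      using g unfolding RCOSETS_def by auto
    ultimately have "finite (UNIV :: nat set)" using inj_on_finite fin by blast
    thus False by simp
  qed
  then obtain i j :: nat where ij: "i < j" "H #> (g [^] i) = H #> (g [^] j)"
    unfolding inj_def by (metis linorder_neqE_nat)
  then obtain d where d: "j = Suc d + i" using less_imp_Suc_add[OF ij(1)] by (auto simp: add.commute)
  have "H #> (g [^] j \<otimes> inv (g [^] i)) = H"
    by (rule coset_mult_inv2[OF ij(2)[symmetric]]) (use g subgroup.subset[OF H] in auto)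
  hence "g [^] j \<otimes> inv (g [^] i) \<in> H" using coset_join1 H g by simp
  moreover have "g [^] j = g [^] Suc d \<otimes> g [^] i" unfolding d by (rule nat_pow_mult[OF g, symmetric])
  ultimately have "g [^] Suc d \<in> H" using g by (simp add: m_assoc del: nat_pow_Suc)
  thus ?thesis by blast
qed

text \<open>A lattice of finite index contains a multiple of the standard basis; a common multiple \<open>N\<close> serves both
coordinates.\<close>
lemma finite_index_diagonal:
  assumes "finite_index_subgroup H thompson_F"
  shows "\<exists>N>0. \<exists>\<alpha>\<in>H. \<exists>\<beta>\<in>H. phi \<alpha> = (int N, 0) \<and> phi \<beta> = (0, int N)"
proof -
  have H: "subgroup H thompson_F" "finite (rcosets\<^bsub>thompson_F\<^esub> H)"
    using assms by (auto simp: finite_index_subgroup_def)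
  obtain u v where uv: "u \<in> carrier thompson_F" "v \<in> carrier thompson_F" "phi u = (1, 0)" "phi v = (0, 1)"
    using commuting_germs by blast
  obtain m :: nat where m: "0 < m" "u [^]\<^bsub>thompson_F\<^esub> m \<in> H" using F.finite_index_pow[OF H uv(1)] by blast
  obtain n :: nat where n: "0 < n" "v [^]\<^bsub>thompson_F\<^esub> n \<in> H" using F.finite_index_pow[OF H uv(2)] by blast
  have "u [^]\<^bsub>thompson_F\<^esub> (m * n) \<in> H" "v [^]\<^bsub>thompson_F\<^esub> (m * n) \<in> H"
    using F.subgroup_int_pow_closed[OF H(1) m(2), of "int n"] F.subgroup_int_pow_closed[OF H(1) n(2), of "int m"]
    uv by (simp_all add: int_pow_int F.nat_pow_pow mult.commute)
  moreover have "phi (u [^]\<^bsub>thompson_F\<^esub> (m * n)) = (int (m * n), 0)" "phi (v [^]\<^bsub>thompson_F\<^esub> (m * n)) = (0, int (m * n))"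
    using uv by (simp_all add: phi_nat_pow)
  moreover have "0 < m * n" using m n by simp
  ultimately show ?thesis by blast
qed

text \<open>The projections of the lattice \<open>phi(H)\<close> to the axes are generated by \<open>a\<close> and by \<open>b\<close>.\<close>
definition projections :: "(real \<Rightarrow> real) set \<Rightarrow> nat \<Rightarrow> nat \<Rightarrow> bool" where
  "projections H a b \<longleftrightarrow> (\<forall>f\<in>H. int a dvd fst (phi f) \<and> int b dvd snd (phi f)) \<and>
     (\<exists>f\<in>H. fst (phi f) = int a) \<and> (\<exists>f\<in>H. snd (phi f) = int b)"

lemma projectionsD:
  assumes "projections H a b" "f \<in> H" shows "\<exists>s t. phi f = (int a * s, int b * t)"
  using assms unfolding projections_def by (metis dvdE prod.collapse)

text \<open>Each side divides all the common values \<open>n * y f = k * x f\<close> and is itself one of them.\<close>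
lemma scale_eq_of_projections:
  assumes "\<And>f. f \<in> H \<Longrightarrow> n * y f = k * x f" "0 < k" "0 < n" "0 < a" "0 < c"
    and "\<And>f. f \<in> H \<Longrightarrow> int a dvd x f" "\<exists>f\<in>H. x f = int a"
    and "\<And>f. f \<in> H \<Longrightarrow> int c dvd y f" "\<exists>f\<in>H. y f = int c"
  shows "k * int a = n * int c"
proof -
  obtain f where f: "f \<in> H" "x f = int a" using assms(7) by blast
  obtain g where g: "g \<in> H" "y g = int c" using assms(9) by blast
  have "n * int c dvd n * y f" using assms(8)[OF f(1)] by (rule mult_dvd_mono[OF dvd_refl])
  hence 1: "n * int c dvd k * int a" using assms(1)[OF f(1)] f(2) by simp
  have "k * int a dvd k * x g" using assms(6)[OF g(1)] by (rule mult_dvd_mono[OF dvd_refl])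
  hence 2: "k * int a dvd n * int c" using assms(1)[OF g(1)] g(2) by simp
  show ?thesis using zdvd_antisym_nonneg[OF _ _ 2 1] assms(2-5) by simp
qed

text \<open>The lattice map induced by \<open>\<theta>\<close> is known on the finite-index sublattice spanned by \<open>(N, 0)\<close> and \<open>(0, N)\<close>, where
\<open>quadrant_preserving\<close> applies. Multiplying by \<open>N\<close> extends the result to all of \<open>H\<close>, and comparing projections
determines the two entries.\<close>
lemma iso_preserves_phi:
  assumes "kernel_iso H H' \<theta>" and fin: "finite_index_subgroup H thompson_F"
    and P: "projections H a b" "projections H' c d" and pos: "0 < a" "0 < b" "0 < c" "0 < d"
  shows "(\<forall>f\<in>H. \<forall>s t. phi f = (int a * s, int b * t) \<longrightarrow> phi (\<theta> f) = (int c * s, int d * t)) \<or>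
    (\<forall>f\<in>H. \<forall>s t. phi f = (int a * s, int b * t) \<longrightarrow> phi (\<theta> f) = (int c * t, int d * s))"
proof -
  interpret kernel_iso H H' \<theta> by (rule assms(1))
  obtain N \<alpha> \<beta> where N: "0 < N" and \<alpha>: "\<alpha> \<in> H" "phi \<alpha> = (int N, 0)" and \<beta>: "\<beta> \<in> H" "phi \<beta> = (0, int N)"
    using finite_index_diagonal[OF fin] by blast
  define u1 u2 w1 w2 where "u1 = fst (phi (\<theta> \<alpha>))" and "u2 = snd (phi (\<theta> \<alpha>))"
    and "w1 = fst (phi (\<theta> \<beta>))" and "w2 = snd (phi (\<theta> \<beta>))"
  have intpow: "h [^]\<^bsub>thompson_F\<^esub> (i::int) \<in> H" "\<theta> (h [^]\<^bsub>thompson_F\<^esub> i) = \<theta> h [^]\<^bsub>thompson_F\<^esub> i"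
    if "h \<in> H" for h and i :: int
  proof -
    show "h [^]\<^bsub>thompson_F\<^esub> i \<in> H" using F.subgroup_int_pow_closed[OF sub(1) that] .
    show "\<theta> (h [^]\<^bsub>thompson_F\<^esub> i) = \<theta> h [^]\<^bsub>thompson_F\<^esub> i"
      using pow[OF that] pow_mem[OF that] inv mem that closed
      by (cases i rule: int_cases2) (simp_all add: F.int_pow_neg int_pow_int)
  qed
  \<comment> \<open>\<open>\<theta>\<close> is linear on the sublattice spanned by \<open>phi \<alpha>\<close> and \<open>phi \<beta>\<close>.\<close>
  have lin: "h \<in> H \<and> phi h = (i * int N, j * int N) \<and> phi (\<theta> h) = (i * u1 + j * w1, i * u2 + j * w2)"
    if "h = \<alpha> [^]\<^bsub>thompson_F\<^esub> i \<star> \<beta> [^]\<^bsub>thompson_F\<^esub> j" for h and i j :: int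
  proof -
    have c: "\<alpha> \<in> carrier thompson_F" "\<beta> \<in> carrier thompson_F" "\<theta> \<alpha> \<in> carrier thompson_F" "\<theta> \<beta> \<in> carrier thompson_F"
      using \<alpha>(1) \<beta>(1) mem closed by auto
    have "h \<in> H" unfolding that using intpow(1) \<alpha>(1) \<beta>(1) subgroup.m_closed[OF sub(1)] by blast
    moreover have "\<theta> h = \<theta> \<alpha> [^]\<^bsub>thompson_F\<^esub> i \<star> \<theta> \<beta> [^]\<^bsub>thompson_F\<^esub> j"
      unfolding that using mult intpow \<alpha>(1) \<beta>(1) by simp
    ultimately show ?thesis unfolding that
      using c \<alpha>(2) \<beta>(2) by (simp add: phi_mult phi_int_pow u1_def u2_def w1_def w2_def)
  qed
  have "i < 0 \<and> j < 0 \<longleftrightarrow> i * u1 + j * w1 < 0 \<and> i * u2 + j * w2 < 0" for i j :: int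
  proof -
    define h where "h = \<alpha> [^]\<^bsub>thompson_F\<^esub> i \<star> \<beta> [^]\<^bsub>thompson_F\<^esub> j"
    note L = lin[OF h_def]
    have "i * int N < 0 \<longleftrightarrow> i < 0" "j * int N < 0 \<longleftrightarrow> j < 0" using N by (simp_all add: mult_less_0_iff)
    thus ?thesis using neg_image_iff[of h] L by simp
  qed
  hence cases: "u2 = 0 \<and> w1 = 0 \<and> u1 > 0 \<and> w2 > 0 \<or> u1 = 0 \<and> w2 = 0 \<and> u2 > 0 \<and> w1 > 0"
    by (rule quadrant_preserving)
  \<comment> \<open>The \<open>N\<close>-th power of \<open>f\<close> has its value under \<open>phi\<close> in that sublattice.\<close>
  have rel: "int N * fst (phi (\<theta> f)) = u1 * fst (phi f) + w1 * snd (phi f) \<and>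
     int N * snd (phi (\<theta> f)) = u2 * fst (phi f) + w2 * snd (phi f)" if f: "f \<in> H" for f
  proof -
    define h where "h = \<alpha> [^]\<^bsub>thompson_F\<^esub> fst (phi f) \<star> \<beta> [^]\<^bsub>thompson_F\<^esub> snd (phi f)"
    note L = lin[OF h_def]
    have "phi (f [^]\<^bsub>thompson_F\<^esub> N) = phi h" using L f mem by (simp add: phi_nat_pow mult.commute)
    hence "phi (\<theta> (f [^]\<^bsub>thompson_F\<^esub> N)) = phi (\<theta> h)"
      by (rule phi_image_cong[OF pow_mem[OF f] conjunct1[OF L]])
    hence "phi (\<theta> f [^]\<^bsub>thompson_F\<^esub> N) = phi (\<theta> h)" by (simp only: pow[OF f])
    thus ?thesis using L f mem closed by (simp add: phi_nat_pow mult.commute)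
  qed
  have Hab: "\<And>f. f \<in> H \<Longrightarrow> int a dvd fst (phi f)" "\<exists>f\<in>H. fst (phi f) = int a"
      "\<And>f. f \<in> H \<Longrightarrow> int b dvd snd (phi f)" "\<exists>f\<in>H. snd (phi f) = int b"
    using P(1) by (auto simp: projections_def)
  have Hcd: "\<And>f. f \<in> H \<Longrightarrow> int c dvd fst (phi (\<theta> f))" "\<exists>f\<in>H. fst (phi (\<theta> f)) = int c"
      "\<And>f. f \<in> H \<Longrightarrow> int d dvd snd (phi (\<theta> f))" "\<exists>f\<in>H. snd (phi (\<theta> f)) = int d"
    using P(2) closed onto unfolding projections_def by (blast, metis imageE, blast, metis imageE)
  have N': "0 < int N" using N by simp
  from cases show ?thesis
  proof
    assume C: "u2 = 0 \<and> w1 = 0 \<and> u1 > 0 \<and> w2 > 0"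
    have r: "int N * fst (phi (\<theta> f)) = u1 * fst (phi f)" "int N * snd (phi (\<theta> f)) = w2 * snd (phi f)"
      if "f \<in> H" for f using rel[OF that] C by simp_all
    have e1: "u1 * int a = int N * int c"
      by (rule scale_eq_of_projections[of H, OF r(1) _ N' pos(1,3) Hab(1,2) Hcd(1,2)]) (use C in auto)
    have e2: "w2 * int b = int N * int d"
      by (rule scale_eq_of_projections[of H, OF r(2) _ N' pos(2,4) Hab(3,4) Hcd(3,4)]) (use C in auto)
    have "phi (\<theta> f) = (int c * s, int d * t)" if "f \<in> H" "phi f = (int a * s, int b * t)" for f s t
    proof -
      have "int N * fst (phi (\<theta> f)) = int N * (int c * s)" "int N * snd (phi (\<theta> f)) = int N * (int d * t)"
        using r[OF that(1)] that(2) e1 e2 by (simp_all flip: mult.assoc)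
      thus ?thesis using N' by (simp add: prod_eq_iff)
    qed
    thus ?thesis by blast
  next
    assume C: "u1 = 0 \<and> w2 = 0 \<and> u2 > 0 \<and> w1 > 0"
    have r: "int N * fst (phi (\<theta> f)) = w1 * snd (phi f)" "int N * snd (phi (\<theta> f)) = u2 * fst (phi f)"
      if "f \<in> H" for f using rel[OF that] C by simp_all
    have e1: "w1 * int b = int N * int c"
      by (rule scale_eq_of_projections[of H, OF r(1) _ N' pos(2,3) Hab(3,4) Hcd(1,2)]) (use C in auto)
    have e2: "u2 * int a = int N * int d"
      by (rule scale_eq_of_projections[of H, OF r(2) _ N' pos(1,4) Hab(1,2) Hcd(3,4)]) (use C in auto)
    have "phi (\<theta> f) = (int c * t, int d * s)" if "f \<in> H" "phi f = (int a * s, int b * t)" for f s t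
    proof -
      have "int N * fst (phi (\<theta> f)) = int N * (int c * t)" "int N * snd (phi (\<theta> f)) = int N * (int d * s)"
        using r[OF that(1)] that(2) e1 e2 by (simp_all flip: mult.assoc)
      thus ?thesis using N' by (simp add: prod_eq_iff)
    qed
    thus ?thesis by blast
  qed
qed

section \<open>The outer rectangular subgroup\<close>

lemma K_tilde_iff: "(x, y) \<in> K_tilde a b \<longleftrightarrow> int a dvd x \<and> int b dvd y"
proof -
  interpret Z: group Z2 unfolding Z2_def by (intro DirProd_group group_integer_group)
  have carr: "carrier Z2 = UNIV" by (simp add: Z2_def DirProd_def integer_group_def)
  have mlt: "p \<otimes>\<^bsub>Z2\<^esub> q = p + q" for p q by (simp add: Z2_def mult_DirProd' integer_group_def plus_prod_def)
  have one: "\<one>\<^bsub>Z2\<^esub> = 0" by (simp add: Z2_def integer_group_def zero_prod_def)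
  have inv: "inv\<^bsub>Z2\<^esub> p = - p" for p by (rule Z.inv_equality) (simp_all add: carr mlt one)
  let ?G = "generate Z2 {(int a, 0), (0, int b)}"
  have S: "subgroup {(x, y). int a dvd x \<and> int b dvd y} Z2"
    by (rule Z.subgroupI) (auto simp: carr mlt inv intro: dvd_add)
  have G: "subgroup ?G Z2" by (rule Z.generate_is_subgroup) (simp add: carr)
  have "?G \<subseteq> {(x, y). int a dvd x \<and> int b dvd y}"
    by (rule Z.generate_subgroup_incl[OF _ S]) simp
  moreover have "(int a * s, int b * t) \<in> ?G" for s t
  proof -
    have mult: "p [^]\<^bsub>Z2\<^esub> (i::int) = (i * fst p, i * snd p)" for p i
    proof -
      have "p [^]\<^bsub>Z2\<^esub> (n::nat) = (int n * fst p, int n * snd p)" for n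
        by (induction n) (simp_all add: one mlt prod_eq_iff algebra_simps)
      thus ?thesis by (cases i rule: int_cases2) (simp_all add: Z.int_pow_neg int_pow_int inv carr)
    qed
    have "(int a, 0) [^]\<^bsub>Z2\<^esub> s \<otimes>\<^bsub>Z2\<^esub> (0, int b) [^]\<^bsub>Z2\<^esub> t \<in> ?G"
      by (intro subgroup.m_closed[OF G] Z.subgroup_int_pow_closed[OF G] generate.incl) simp_all
    thus ?thesis by (simp add: mult mlt mult.commute)
  qed
  ultimately show ?thesis unfolding K_tilde_def by (auto elim!: dvdE)
qed

lemma K_rect_iff:
  "f \<in> K_rect a b \<longleftrightarrow> f \<in> carrier thompson_F \<and> int a dvd fst (phi f) \<and> int b dvd snd (phi f)"
  unfolding K_rect_def using K_tilde_iff[of "fst (phi f)" "snd (phi f)" a b] by simp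

lemma phi_surj: "\<exists>f\<in>carrier thompson_F. phi f = (x, y)"
proof -
  obtain u v where uv: "u \<in> carrier thompson_F" "v \<in> carrier thompson_F" "phi u = (1, 0)" "phi v = (0, 1)"
    using commuting_germs by blast
  thus ?thesis
    by (intro bexI[of _ "u [^]\<^bsub>thompson_F\<^esub> x \<star> v [^]\<^bsub>thompson_F\<^esub> y"]) (simp_all add: phi_mult phi_int_pow)
qed

lemma int_subgroup_principal:
  fixes S :: "int set"
  assumes diff: "\<And>x y. x \<in> S \<Longrightarrow> y \<in> S \<Longrightarrow> x - y \<in> S" and pos: "x0 \<in> S" "0 < x0"
  shows "\<exists>a::nat. 0 < a \<and> int a \<in> S \<and> (\<forall>x\<in>S. int a dvd x)"
proof -
  define a where "a = (LEAST n::nat. 0 < n \<and> int n \<in> S)"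
  have ex: "\<exists>n::nat. 0 < n \<and> int n \<in> S" using pos by (intro exI[of _ "nat x0"]) simp
  have a: "0 < a" "int a \<in> S" using LeastI_ex[OF ex] by (simp_all add: a_def)
  have least: "a \<le> n" if "0 < n" "int n \<in> S" for n unfolding a_def using that by (intro Least_le) simp
  have zero: "0 \<in> S" using diff[OF pos(1) pos(1)] by simp
  have neg: "- x \<in> S" if "x \<in> S" for x using diff[OF zero that] by simp
  have add: "x + y \<in> S" if "x \<in> S" "y \<in> S" for x y using diff[OF that(1) neg[OF that(2)]] by simp
  have multn: "int k * int a \<in> S" for k :: nat
    by (induction k) (use zero add a in \<open>simp_all add: algebra_simps\<close>)
  have mult: "k * int a \<in> S" for k :: int
    using multn neg[OF multn] by (cases k rule: int_cases2) simp_all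
  have "int a dvd x" if x: "x \<in> S" for x
  proof -
    have "x mod int a = x - (x div int a) * int a" by (simp add: minus_div_mult_eq_mod)
    hence m: "x mod int a \<in> S" using diff[OF x mult] by simp
    have b: "0 \<le> x mod int a" "x mod int a < int a" using a(1) by simp_all
    have "x mod int a = 0"
    proof (rule ccontr)
      assume "x mod int a \<noteq> 0"
      hence "a \<le> nat (x mod int a)" using b m by (intro least) simp_all
      thus False using b by simp
    qed
    thus ?thesis by (simp add: dvd_eq_mod_eq_0)
  qed
  thus ?thesis using a by blast
qed

lemma projections_exist:
  assumes "finite_index_subgroup H thompson_F"
  shows "\<exists>a b. 0 < a \<and> 0 < b \<and> projections H a b"
proof -
  have H: "subgroup H thompson_F" using assms by (simp add: finite_index_subgroup_def)
  have c: "f \<in> carrier thompson_F" if "f \<in> H" for f using subgroup.mem_carrier[OF H that] .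
  obtain N \<alpha> \<beta> where N: "0 < N" "\<alpha> \<in> H" "phi \<alpha> = (int N, 0)" "\<beta> \<in> H" "phi \<beta> = (0, int N)"
    using finite_index_diagonal[OF assms] by blast
  have diff: "f \<star> tinv g \<in> H" "phi (f \<star> tinv g) = phi f - phi g" if "f \<in> H" "g \<in> H" for f g
    using that c subgroup.m_closed[OF H] subgroup.m_inv_closed[OF H] by (simp_all add: phi_mult phi_inv)
  have "\<exists>a::nat. 0 < a \<and> int a \<in> (\<lambda>f. fst (phi f)) ` H \<and> (\<forall>x\<in>(\<lambda>f. fst (phi f)) ` H. int a dvd x)"
  proof (rule int_subgroup_principal)
    show "x - y \<in> (\<lambda>f. fst (phi f)) ` H" if xy: "x \<in> (\<lambda>f. fst (phi f)) ` H" "y \<in> (\<lambda>f. fst (phi f)) ` H" for x y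
    proof -
      obtain f g where fg: "f \<in> H" "g \<in> H" "x = fst (phi f)" "y = fst (phi g)" using xy by blast
      show ?thesis by (rule image_eqI[of _ _ "f \<star> tinv g"]) (use fg diff in simp_all)
    qed
    show "int N \<in> (\<lambda>f. fst (phi f)) ` H" by (rule image_eqI[of _ _ "\<alpha>"]) (use N in simp_all)
  qed (use N in simp)
  moreover have "\<exists>a::nat. 0 < a \<and> int a \<in> (\<lambda>f. snd (phi f)) ` H \<and> (\<forall>x\<in>(\<lambda>f. snd (phi f)) ` H. int a dvd x)"
  proof (rule int_subgroup_principal)
    show "x - y \<in> (\<lambda>f. snd (phi f)) ` H" if xy: "x \<in> (\<lambda>f. snd (phi f)) ` H" "y \<in> (\<lambda>f. snd (phi f)) ` H" for x y
    proof -
      obtain f g where fg: "f \<in> H" "g \<in> H" "x = snd (phi f)" "y = snd (phi g)" using xy by blast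
      show ?thesis by (rule image_eqI[of _ _ "f \<star> tinv g"]) (use fg diff in simp_all)
    qed
    show "int N \<in> (\<lambda>f. snd (phi f)) ` H" by (rule image_eqI[of _ _ "\<beta>"]) (use N in simp_all)
  qed (use N in simp)
  ultimately obtain a b :: nat where "0 < a" "0 < b" "int a \<in> (\<lambda>f. fst (phi f)) ` H"
    "int b \<in> (\<lambda>f. snd (phi f)) ` H" "\<forall>f\<in>H. int a dvd fst (phi f)" "\<forall>f\<in>H. int b dvd snd (phi f)"
    by auto
  hence "0 < a \<and> 0 < b \<and> projections H a b" unfolding projections_def by auto
  thus ?thesis by blast
qed

lemma K_rect_subset_iff: "K_rect a b \<subseteq> K_rect c d \<longleftrightarrow> c dvd a \<and> d dvd b"
proof
  assume *: "K_rect a b \<subseteq> K_rect c d"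
  obtain f where "f \<in> carrier thompson_F" "phi f = (int a, int b)" using phi_surj by blast
  moreover from this have "f \<in> K_rect a b" by (simp add: K_rect_iff)
  hence "f \<in> K_rect c d" using * by blast
  ultimately show "c dvd a \<and> d dvd b" by (simp add: K_rect_iff)
next
  assume "c dvd a \<and> d dvd b"
  hence "int c dvd int a" "int d dvd int b" by simp_all
  thus "K_rect a b \<subseteq> K_rect c d" unfolding subset_iff K_rect_iff by (metis dvd_trans)
qed

text \<open>\<open>K_rect a b\<close> is not only minimal but least among the rectangular subgroups containing \<open>H\<close>, so the description in
\<open>Outer\<close> is unique.\<close>
lemma Outer_eq:
  assumes fin: "finite_index_subgroup H thompson_F" and P: "projections H a b" and pos: "0 < a" "0 < b"
  shows "Outer H = K_rect a b"
proof -
  have c: "f \<in> carrier thompson_F" if "f \<in> H" for f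
    using fin subgroup.mem_carrier[OF _ that] by (auto simp: finite_index_subgroup_def)
  have HK: "H \<subseteq> K_rect a b" using P c by (auto simp: K_rect_iff projections_def)
  have least: "K_rect a b \<subseteq> K" if K: "rectangular K" "H \<subseteq> K" for K
  proof -
    obtain a' b' where ab: "K = K_rect a' b'" using K(1) unfolding rectangular_def by blast
    obtain f g where fg: "f \<in> H" "fst (phi f) = int a" "g \<in> H" "snd (phi g) = int b"
      using P unfolding projections_def by blast
    have "f \<in> K_rect a' b'" "g \<in> K_rect a' b'" using fg K(2) ab by blast+
    hence "a' dvd a \<and> b' dvd b" using fg(2,4) by (simp add: K_rect_iff)
    thus ?thesis by (simp add: ab K_rect_subset_iff)
  qed
  have rect: "rectangular (K_rect a b)" using pos unfolding rectangular_def by blast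
  show ?thesis unfolding Outer_def
    by (rule the_equality) (use HK least rect in blast)+
qed

lemma Outer_projections:
  assumes fin: "finite_index_subgroup H thompson_F" and "K_rect a b = Outer H"
  shows "projections H a b"
proof -
  obtain a' b' where ab: "0 < a'" "0 < b'" "projections H a' b'" using projections_exist[OF fin] by blast
  hence "K_rect a b = K_rect a' b'" using Outer_eq[OF fin] assms(2) by simp
  hence "a = a'" "b = b'" using K_rect_subset_iff[of a b a' b'] K_rect_subset_iff[of a' b' a b]
    by (auto intro: dvd_antisym)
  thus ?thesis using ab by simp
qed

section \<open>The classification\<close>

lemma iso_subgroup_image:
  assumes "T \<in> iso (G\<lparr>carrier := K\<rparr>) L" "H \<subseteq> K"
  shows "G\<lparr>carrier := H\<rparr> \<cong> L\<lparr>carrier := T ` H\<rparr>"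
proof (rule is_isoI, rule isoI)
  show "T \<in> hom (G\<lparr>carrier := H\<rparr>) (L\<lparr>carrier := T ` H\<rparr>)"
    using assms by (auto simp: iso_def hom_def)
  show "bij_betw T (carrier (G\<lparr>carrier := H\<rparr>)) (carrier (L\<lparr>carrier := T ` H\<rparr>))"
    using assms by (auto simp: iso_def bij_betw_def intro: inj_on_subset)
qed

text \<open>An element of \<open>K_rect a b\<close> is mapped into the kernel precisely if it lies in the kernel. So the image of \<open>H\<close>
again contains the kernel and is determined by its values under \<open>phi\<close>.\<close>
lemma rect_iso_image:
  assumes T: "rect_iso a b T" and pos: "0 < a" "0 < b" and H: "subgroup H thompson_F" "ker_phi \<subseteq> H"
    and P: "projections H a b"
  shows "T ` H = {g \<in> carrier thompson_F. \<exists>f\<in>H. phi f = (int a * fst (phi g), int b * snd (phi g))}"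
proof -
  have iso: "T \<in> iso (thompson_F\<lparr>carrier := K_rect a b\<rparr>) thompson_F"
    and phiT: "\<And>f s t. f \<in> K_rect a b \<Longrightarrow> phi f = (int a * s, int b * t) \<Longrightarrow> phi (T f) = (s, t)"
    using T unfolding rect_iso_def by blast+
  have HK: "H \<subseteq> K_rect a b"
    using P subgroup.mem_carrier[OF H(1)] by (auto simp: K_rect_iff projections_def)
  have Tc: "T f \<in> carrier thompson_F" if "f \<in> K_rect a b" for f
    using iso that by (auto simp: iso_def hom_def)
  have Tm: "T (f \<star> g) = T f \<star> T g" if "f \<in> K_rect a b" "g \<in> K_rect a b" for f g
    using iso that by (auto simp: iso_def hom_def)
  have onto: "T ` K_rect a b = carrier thompson_F" using iso by (simp add: iso_def bij_betw_def)
  have phi_back: "phi f = (int a * fst (phi (T f)), int b * snd (phi (T f)))" if f: "f \<in> K_rect a b" for f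
  proof -
    obtain s t where st: "phi f = (int a * s, int b * t)"
      using f by (metis K_rect_iff dvdE prod.collapse)
    show ?thesis using phiT[OF f st] st by simp
  qed
  show ?thesis
  proof (intro equalityI subsetI CollectI conjI)
    fix g assume "g \<in> T ` H"
    then obtain f where f: "f \<in> H" "g = T f" by blast
    hence fK: "f \<in> K_rect a b" using HK by blast
    show "g \<in> carrier thompson_F" using Tc[OF fK] f by simp
    show "\<exists>f\<in>H. phi f = (int a * fst (phi g), int b * snd (phi g))"
      using phi_back[OF fK] f by blast
  next
    fix g assume "g \<in> {g \<in> carrier thompson_F. \<exists>f\<in>H. phi f = (int a * fst (phi g), int b * snd (phi g))}"
    then obtain f where g: "g \<in> carrier thompson_F" and f: "f \<in> H"
      "phi f = (int a * fst (phi g), int b * snd (phi g))" by blast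
    obtain h where h: "h \<in> K_rect a b" "T h = g" using g onto by (metis imageE)
    have "phi h = phi f" using phi_back[OF h(1)] h(2) f(2) by simp
    moreover have c: "h \<in> carrier thompson_F" "f \<in> carrier thompson_F"
      using h(1) subgroup.mem_carrier[OF H(1) f(1)] by (simp_all add: K_rect_iff)
    ultimately have "h \<star> tinv f \<in> ker_phi" by (simp add: ker_phi_def phi_mult phi_inv)
    hence "h \<star> tinv f \<star> f \<in> H" using H f(1) by (blast intro: subgroup.m_closed)
    hence "h \<in> H" using c by (simp add: F.m_assoc)
    thus "g \<in> T ` H" using h(2) by blast
  qed
qed

lemma Rev_iso: "Rev \<in> iso (thompson_F\<lparr>carrier := carrier thompson_F\<rparr>) thompson_F"
proof (rule isoI)
  show "bij_betw Rev (carrier (thompson_F\<lparr>carrier := carrier thompson_F\<rparr>)) (carrier thompson_F)"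
    by (rule bij_betw_byWitness[of _ Rev]) (auto simp: Rev_Rev)
qed (auto simp: hom_def Rev_mult)

theorem theorem1p8:
  fixes H H' :: "(real \<Rightarrow> real) set"
    and a b c d :: nat
    and \<tau> :: "nat \<Rightarrow> nat \<Rightarrow> (real \<Rightarrow> real) \<Rightarrow> real \<Rightarrow> real"
  assumes tau: "\<And>m n. 0 < m \<Longrightarrow> 0 < n \<Longrightarrow> rect_iso m n (\<tau> m n)"
    and "finite_index_subgroup H thompson_F"
    and "finite_index_subgroup H' thompson_F"
    and "0 < a" "0 < b" "0 < c" "0 < d"
    and "K_rect a b = Outer H"
    and "K_rect c d = Outer H'"
  shows "thompson_F\<lparr>carrier := H\<rparr> \<cong> thompson_F\<lparr>carrier := H'\<rparr> \<longleftrightarrow>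
    \<tau> a b ` H = \<tau> c d ` H' \<or> \<tau> a b ` H = Rev ` (\<tau> c d ` H')"
proof -
  note fin = assms(2,3) and pos = assms(4-7)
  have sub: "subgroup H thompson_F" "subgroup H' thompson_F"
    using fin by (simp_all add: finite_index_subgroup_def)
  have ker: "ker_phi \<subseteq> H" "ker_phi \<subseteq> H'" using fin by (simp_all add: finite_index_contains_ker_phi)
  have P: "projections H a b" "projections H' c d"
    using Outer_projections fin assms(8,9) by simp_all
  have T: "rect_iso a b (\<tau> a b)" "rect_iso c d (\<tau> c d)" using tau pos by simp_all
  have KH: "H \<subseteq> K_rect a b" "H' \<subseteq> K_rect c d"
    using P subgroup.mem_carrier[OF sub(1)] subgroup.mem_carrier[OF sub(2)]
    by (auto simp: K_rect_iff projections_def)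
  have isoT: "\<tau> a b \<in> iso (thompson_F\<lparr>carrier := K_rect a b\<rparr>) thompson_F"
    "\<tau> c d \<in> iso (thompson_F\<lparr>carrier := K_rect c d\<rparr>) thompson_F"
    using T unfolding rect_iso_def by blast+
  have I: "thompson_F\<lparr>carrier := H\<rparr> \<cong> thompson_F\<lparr>carrier := \<tau> a b ` H\<rparr>"
    and I': "thompson_F\<lparr>carrier := H'\<rparr> \<cong> thompson_F\<lparr>carrier := \<tau> c d ` H'\<rparr>"
    using iso_subgroup_image isoT KH by blast+
  have im_carrier: "\<tau> c d ` H' \<subseteq> carrier thompson_F"
    using isoT(2) KH(2) by (auto simp: iso_def hom_def)
  note J = rect_iso_image[OF T(1) pos(1,2) sub(1) ker(1) P(1)] rect_iso_image[OF T(2) pos(3,4) sub(2) ker(2) P(2)]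
  show ?thesis
  proof
    assume "thompson_F\<lparr>carrier := H\<rparr> \<cong> thompson_F\<lparr>carrier := H'\<rparr>"
    then obtain \<theta> where "\<theta> \<in> iso (thompson_F\<lparr>carrier := H\<rparr>) (thompson_F\<lparr>carrier := H'\<rparr>)"
      unfolding is_iso_def by blast
    then interpret kernel_iso H H' \<theta> by (rule kernel_iso.intro[OF sub ker])
    consider "\<forall>f\<in>H. \<forall>s t. phi f = (int a * s, int b * t) \<longrightarrow> phi (\<theta> f) = (int c * s, int d * t)"
      | "\<forall>f\<in>H. \<forall>s t. phi f = (int a * s, int b * t) \<longrightarrow> phi (\<theta> f) = (int c * t, int d * s)"
      using iso_preserves_phi[OF kernel_iso_axioms fin(1) P pos] by blast
    thus "\<tau> a b ` H = \<tau> c d ` H' \<or> \<tau> a b ` H = Rev ` (\<tau> c d ` H')"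
    proof cases
      case 1
      have "(\<exists>f\<in>H. phi f = (int a * s, int b * t)) \<longleftrightarrow> (\<exists>f\<in>H'. phi f = (int c * s, int d * t))" for s t
      proof
        assume "\<exists>f\<in>H. phi f = (int a * s, int b * t)"
        thus "\<exists>f\<in>H'. phi f = (int c * s, int d * t)" using 1 closed by blast
      next
        assume "\<exists>f\<in>H'. phi f = (int c * s, int d * t)"
        then obtain f where f: "f \<in> H" "phi (\<theta> f) = (int c * s, int d * t)" using onto by blast
        obtain s' t' where st: "phi f = (int a * s', int b * t')" using projectionsD[OF P(1) f(1)] by blast
        hence "(int c * s', int d * t') = (int c * s, int d * t)" using 1[rule_format, OF f(1)] f(2) by metis
        hence "s' = s" "t' = t" using pos by simp_all
        thus "\<exists>f\<in>H. phi f = (int a * s, int b * t)" using f(1) st by blast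
      qed
      thus ?thesis unfolding J by simp
    next
      case 2
      have e: "(\<exists>f\<in>H. phi f = (int a * s, int b * t)) \<longleftrightarrow> (\<exists>f\<in>H'. phi f = (int c * t, int d * s))" for s t
      proof
        assume "\<exists>f\<in>H. phi f = (int a * s, int b * t)"
        thus "\<exists>f\<in>H'. phi f = (int c * t, int d * s)" using 2 closed by blast
      next
        assume "\<exists>f\<in>H'. phi f = (int c * t, int d * s)"
        then obtain f where f: "f \<in> H" "phi (\<theta> f) = (int c * t, int d * s)" using onto by blast
        obtain s' t' where st: "phi f = (int a * s', int b * t')" using projectionsD[OF P(1) f(1)] by blast
        hence "(int c * t', int d * s') = (int c * t, int d * s)" using 2[rule_format, OF f(1)] f(2) by metis
        hence "s' = s" "t' = t" using pos by simp_all
        thus "\<exists>f\<in>H. phi f = (int a * s, int b * t)" using f(1) st by blast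
      qed
      have "g \<in> \<tau> a b ` H \<longleftrightarrow> Rev g \<in> \<tau> c d ` H'" if "g \<in> carrier thompson_F" for g
        using that e[of "fst (phi g)" "snd (phi g)"] unfolding J by (simp add: phi_Rev)
      hence "\<tau> a b ` H = {g \<in> carrier thompson_F. Rev g \<in> \<tau> c d ` H'}"
        using J(1) by blast
      also have "\<dots> = Rev ` (\<tau> c d ` H')"
      proof (intro equalityI subsetI)
        fix g assume "g \<in> {g \<in> carrier thompson_F. Rev g \<in> \<tau> c d ` H'}"
        thus "g \<in> Rev ` (\<tau> c d ` H')" using Rev_Rev by (metis (no_types, lifting) image_eqI mem_Collect_eq)
      next
        fix g assume "g \<in> Rev ` (\<tau> c d ` H')"
        then obtain x where "x \<in> \<tau> c d ` H'" "g = Rev x" by (rule imageE)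
        thus "g \<in> {g \<in> carrier thompson_F. Rev g \<in> \<tau> c d ` H'}" using im_carrier Rev_Rev by auto
      qed
      finally show ?thesis by blast
    qed
  next
    have G': "thompson_F\<lparr>carrier := \<tau> c d ` H'\<rparr> \<cong> thompson_F\<lparr>carrier := H'\<rparr>"
      by (rule group.iso_sym[OF F.subgroup_imp_group[OF sub(2)] I'])
    assume "\<tau> a b ` H = \<tau> c d ` H' \<or> \<tau> a b ` H = Rev ` (\<tau> c d ` H')"
    thus "thompson_F\<lparr>carrier := H\<rparr> \<cong> thompson_F\<lparr>carrier := H'\<rparr>"
    proof
      assume "\<tau> a b ` H = \<tau> c d ` H'"
      thus ?thesis using iso_trans[OF I] G' by simp
    next
      assume e: "\<tau> a b ` H = Rev ` (\<tau> c d ` H')"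
      have "thompson_F\<lparr>carrier := H'\<rparr> \<cong> thompson_F\<lparr>carrier := Rev ` (\<tau> c d ` H')\<rparr>"
        using iso_trans[OF I' iso_subgroup_image[OF Rev_iso im_carrier]] .
      hence "thompson_F\<lparr>carrier := \<tau> a b ` H\<rparr> \<cong> thompson_F\<lparr>carrier := H'\<rparr>"
        unfolding e by (rule group.iso_sym[OF F.subgroup_imp_group[OF sub(2)]])
      thus ?thesis by (rule iso_trans[OF I])
    qed
  qed
qed

end
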